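(* Let $L^q \subset S^n$ be an oriented immersed submanifold (of dimension $q$) of the standard round sphere, and let $\mu \in \Omega^1(L)$ be a $1$-form on $L$. Equip $T^*S^n$ with the Calabi--Yau structure given by the Stenzel metric, with Kähler form $\omega_{\mathrm{St}}$. Then the submanifold $N^*L + \mu$ (the twisted conormal bundle) is Lagrangian in $T^*S^n$ if and only if $\mu = 0$.
   Context: Twisted conormal bundle. Let $x: L \to S^n$ be the immersion; objects on $S^n$ are pulled back to $L$ along $x$. Using the round metric, $T^*S^n|_L = T^*L \oplus N^*L$ (orthogonal splitting), where $N^*L$ is the conormal bundle (covectors annihilating $TL$). The immersed $n$-dimensional submanifold $$N^*L+\mu := X_\mu = \{(p,\xi+\mu(p)) \in T^*S^n|_L \mid p \in L,\ \xi \in N_p^*L\}$$ is the conormal bundle with each fiber affinely translated by $\mu(p) \in T_p^*L$. Stenzel structure. View $T^*S^n=\{(x,\xi) : |x|=1,\ \langle x,\xi\rangle=0\} \subset \mathbb{R}^{n+1}\oplus(\mathbb{R}^{n+1})^*$ and identify it with the complex quadric $Q=\{z\in\mathbb{C}^{n+1} \mid \sum_{k=0}^n z_k^2=1\}$ by the diffeomorphism $$\Psi(x,\xi) = x\cosh|\xi| + i\,\frac{\xi}{|\xi|}\sinh|\xi|$$ (the second term is $0$ if $\xi=0$). $T^*S^n$ inherits the complex structure of $Q$. The Stenzel metric is the complete Ricci-flat Kähler metric on $Q$ whose Kähler form $\omega_{\mathrm{St}}$ is, up to a positive constant, $i\partial\bar\partial$ of a function of $|z|^2$ restricted to $Q$.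 Explicitly, with $\cosh w=|z|^2$, $w\ge 0$ (so $w=2|\xi|$), the potential is $U(w)$ with $U'(0)=0$, $\frac{d}{dw}\bigl(U'(w)\bigr)^n = c\,n\,(\sinh w)^{n-1}$, $c>0$ a constant. An $n$-dimensional immersed submanifold $N$ of $T^*S^n$ is Lagrangian if $\omega_{\mathrm{St}}|_N=0$.
   Formalization: The formal theorem assumes q < n (positive codimension); for q = n the bundle N*L+μ is the graph of μ, which is Lagrangian for many nonzero μ, so the claim as stated fails there. *)

theory Defs
  imports "HOL-Analysis.Analysis"
begin

section \<open>Smooth functions on open subsets of \<open>Euclidean_space q\<close>\<close>

text \<open>
  The model space of a \<open>q\<close>-dimensional manifold is the library's \<open>Euclidean_space q\<close>, whose points
  are the functions \<open>nat \<Rightarrow> real\<close> vanishing at all indices \<open>\<ge> q\<close>; the value \<open>q = 0\<close> is included.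
\<close>

definition pderiv_at ::
    "nat \<Rightarrow> ((nat \<Rightarrow> real) \<Rightarrow> 'b::real_normed_vector) \<Rightarrow> (nat \<Rightarrow> real) \<Rightarrow> 'b" where
  "pderiv_at i f a = vector_derivative (\<lambda>t. f (a(i := t))) (at (a i))"

fun Ck_on ::
    "nat \<Rightarrow> nat \<Rightarrow> (nat \<Rightarrow> real) set \<Rightarrow> ((nat \<Rightarrow> real) \<Rightarrow> 'b::real_normed_vector) \<Rightarrow> bool" where
  "Ck_on q 0 V f \<longleftrightarrow> continuous_on V f"
| "Ck_on q (Suc k) V f \<longleftrightarrow> continuous_on V f \<and>
     (\<forall>i<q. (\<forall>a\<in>V. (\<lambda>t. f (a(i := t))) differentiable (at (a i))) \<and> Ck_on q k V (pderiv_at i f))"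

definition smooth_on ::
    "nat \<Rightarrow> (nat \<Rightarrow> real) set \<Rightarrow> ((nat \<Rightarrow> real) \<Rightarrow> 'b::real_normed_vector) \<Rightarrow> bool" where
  "smooth_on q V f \<longleftrightarrow> (\<forall>k. Ck_on q k V f)"

definition jacobian_det ::
    "nat \<Rightarrow> ((nat \<Rightarrow> real) \<Rightarrow> nat \<Rightarrow> real) \<Rightarrow> (nat \<Rightarrow> real) \<Rightarrow> real" where
  "jacobian_det q T a =
     (\<Sum>\<sigma> | \<sigma> permutes {..<q}. of_int (sign \<sigma>) * (\<Prod>i<q. pderiv_at i (\<lambda>b. T b (\<sigma> i)) a))"

section \<open>Oriented manifolds, immersions, one-forms\<close>

type_synonym 'm chart = "'m set \<times> ('m \<Rightarrow> nat \<Rightarrow> real)"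

definition is_chart :: "nat \<Rightarrow> 'm::topological_space chart \<Rightarrow> bool" where
  "is_chart q = (\<lambda>(U, \<phi>). open U \<and> openin (Euclidean_space q) (\<phi> ` U) \<and>
     homeomorphic_map (top_of_set U) (subtopology (Euclidean_space q) (\<phi> ` U)) \<phi>)"

text \<open>
  The manifold is the whole type \<open>'m\<close>. An orientation is given by an atlas whose
  transition maps have positive Jacobian determinant (no condition if \<open>q = 0\<close>).
\<close>

definition oriented_atlas :: "nat \<Rightarrow> 'm::topological_space chart set \<Rightarrow> bool" where
  "oriented_atlas q A \<longleftrightarrow>
     (\<forall>C\<in>A. is_chart q C) \<and> (\<Union>(U, \<phi>)\<in>A. U) = UNIV \<and>
     (\<forall>(U, \<phi>)\<in>A. \<forall>(V, \<psi>)\<in>A.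
        (\<forall>k<q. smooth_on q (\<phi> ` (U \<inter> V)) (\<lambda>a. \<psi> (inv_into U \<phi> a) k)) \<and>
        (\<forall>a\<in>\<phi> ` (U \<inter> V). jacobian_det q (\<lambda>b. \<psi> (inv_into U \<phi> b)) a > 0))"

definition immersion ::
    "nat \<Rightarrow> 'm::topological_space chart set \<Rightarrow> ('m \<Rightarrow> real^'d) \<Rightarrow> bool" where
  "immersion q A x \<longleftrightarrow>
     (\<forall>(U, \<phi>)\<in>A. smooth_on q (\<phi> ` U) (x \<circ> inv_into U \<phi>) \<and>
        (\<forall>a\<in>\<phi> ` U. \<forall>v. (\<Sum>i<q. v i *\<^sub>R pderiv_at i (x \<circ> inv_into U \<phi>) a) = 0
            \<longrightarrow> (\<forall>i<q. v i = 0)))"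

text \<open>
  The tangent space of the manifold at \<open>p\<close>, identified with its image under the (injective)
  differential of the immersion \<open>x\<close>; it does not depend on the chart.
\<close>

definition tangent_space ::
    "nat \<Rightarrow> 'm::topological_space chart set \<Rightarrow> ('m \<Rightarrow> real^'d) \<Rightarrow> 'm \<Rightarrow> (real^'d) set" where
  "tangent_space q A x p =
     (\<Union>(U, \<phi>)\<in>{(U, \<phi>)\<in>A. p \<in> U}. span ((\<lambda>i. pderiv_at i (x \<circ> inv_into U \<phi>) (\<phi> p)) ` {..<q}))"

text \<open>Only the values \<open>\<mu> p v\<close> with \<open>v \<in> tangent_space q A x p\<close> matter.\<close>

definition one_form ::
    "nat \<Rightarrow> 'm::topological_space chart set \<Rightarrow> ('m \<Rightarrow> real^'d) \<Rightarrow> ('m \<Rightarrow> real^'d \<Rightarrow> real) \<Rightarrow> bool" where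
  "one_form q A x \<mu> \<longleftrightarrow>
     (\<forall>p. \<forall>u\<in>tangent_space q A x p. \<forall>v\<in>tangent_space q A x p. \<forall>r s.
        \<mu> p (r *\<^sub>R u + s *\<^sub>R v) = r * \<mu> p u + s * \<mu> p v) \<and>
     (\<forall>(U, \<phi>)\<in>A. \<forall>i<q. smooth_on q (\<phi> ` U)
        (\<lambda>a. \<mu> (inv_into U \<phi> a) (pderiv_at i (x \<circ> inv_into U \<phi>) a)))"

section \<open>Twisted conormal bundle\<close>

text \<open>
  Covectors on \<open>\<real>\<^sup>n\<^sup>+\<^sup>1\<close> are identified with vectors through the inner product.
  \<open>covector_of\<close> realises \<open>\<mu>(p)\<close> in the summand \<open>T\<^sup>*L\<close> of \<open>T\<^sup>*S\<^sup>n|\<^sub>L = T\<^sup>*L \<oplus> N\<^sup>*L\<close>.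
\<close>

definition covector_of :: "(real^'d) set \<Rightarrow> (real^'d \<Rightarrow> real) \<Rightarrow> real^'d" where
  "covector_of T l = (THE m. m \<in> T \<and> (\<forall>v\<in>T. m \<bullet> v = l v))"

definition conormal_space ::
    "nat \<Rightarrow> 'm::topological_space chart set \<Rightarrow> ('m \<Rightarrow> real^'d) \<Rightarrow> 'm \<Rightarrow> (real^'d) set" where
  "conormal_space q A x p = {\<xi>. x p \<bullet> \<xi> = 0 \<and> (\<forall>v\<in>tangent_space q A x p. \<xi> \<bullet> v = 0)}"

text \<open>
  The total space is kept over the abstract manifold; it is immersed in \<open>T\<^sup>*S\<^sup>n\<close> by
  \<open>(p, \<eta>) \<mapsto> (x p, \<eta>)\<close>.
\<close>

definition twisted_conormal ::
    "nat \<Rightarrow> 'm::topological_space chart set \<Rightarrow> ('m \<Rightarrow> real^'d) \<Rightarrow> ('m \<Rightarrow> real^'d \<Rightarrow> real)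
      \<Rightarrow> ('m \<times> (real^'d)) set" where
  "twisted_conormal q A x \<mu> =
     {(p, \<xi> + covector_of (tangent_space q A x p) (\<mu> p)) | p \<xi>. \<xi> \<in> conormal_space q A x p}"

section \<open>The Stenzel Kaehler form\<close>

definition quadric :: "(complex^'d) set" where
  "quadric = {z. (\<Sum>k\<in>UNIV. (z $ k)\<^sup>2) = 1}"

definition Psi :: "real^'d \<Rightarrow> real^'d \<Rightarrow> complex^'d" where
  "Psi y \<eta> = (\<chi> k. Complex (y $ k * cosh (norm \<eta>)) (\<eta> $ k / norm \<eta> * sinh (norm \<eta>)))"

lemma Psi_in_quadric:
  fixes y \<eta> :: "real^'d"
  assumes "norm y = 1" "y \<bullet> \<eta> = 0"
  shows "Psi y \<eta> \<in> quadric"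
proof -
  define C S where "C = cosh (norm \<eta>)" and "S = sinh (norm \<eta>) / norm \<eta>"
  have y: "(\<Sum>k\<in>UNIV. y $ k * y $ k) = 1"
    using assms(1) by (simp add: norm_eq_1 inner_vec_def)
  have o: "(\<Sum>k\<in>UNIV. y $ k * \<eta> $ k) = 0"
    using assms(2) by (simp add: inner_vec_def)
  have e: "(\<Sum>k\<in>UNIV. \<eta> $ k * \<eta> $ k) = (norm \<eta>)\<^sup>2"
    unfolding power2_norm_eq_inner by (simp add: inner_vec_def)
  have CS: "C\<^sup>2 - S\<^sup>2 * (norm \<eta>)\<^sup>2 = 1"
    by (cases "\<eta> = 0") (simp_all add: C_def S_def cosh_square_eq power_divide)
  have "(Psi y \<eta> $ k)\<^sup>2 = complex_of_real (C\<^sup>2 * (y $ k * y $ k) - S\<^sup>2 * (\<eta> $ k * \<eta> $ k))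
          + \<i> * complex_of_real (2 * C * S * (y $ k * \<eta> $ k))" for k
    by (simp add: Psi_def C_def S_def complex_eq_iff power2_eq_square algebra_simps)
  then have "(\<Sum>k\<in>UNIV. (Psi y \<eta> $ k)\<^sup>2) =
      complex_of_real (C\<^sup>2 * (\<Sum>k\<in>UNIV. y $ k * y $ k) - S\<^sup>2 * (\<Sum>k\<in>UNIV. \<eta> $ k * \<eta> $ k))
      + \<i> * complex_of_real (2 * C * S * (\<Sum>k\<in>UNIV. y $ k * \<eta> $ k))"
    by (simp only: sum.distrib sum_subtractf sum_distrib_left of_real_sum of_real_diff)
  then show ?thesis
    using CS by (simp only: y o e quadric_def) simp
qed

definition dir_deriv :: "complex^'d \<Rightarrow> (complex^'d \<Rightarrow> complex) \<Rightarrow> complex^'d \<Rightarrow> complex" where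
  "dir_deriv v f z = vector_derivative (\<lambda>t::real. f (z + t *\<^sub>R v)) (at 0)"

definition d_dz :: "'d \<Rightarrow> (complex^'d \<Rightarrow> complex) \<Rightarrow> complex^'d \<Rightarrow> complex" where
  "d_dz k f z = (dir_deriv (axis k 1) f z - \<i> * dir_deriv (axis k \<i>) f z) / 2"

definition d_dzbar :: "'d \<Rightarrow> (complex^'d \<Rightarrow> complex) \<Rightarrow> complex^'d \<Rightarrow> complex" where
  "d_dzbar k f z = (dir_deriv (axis k 1) f z + \<i> * dir_deriv (axis k \<i>) f z) / 2"

definition i_del_delbar ::
    "(complex^'d \<Rightarrow> complex) \<Rightarrow> complex^'d \<Rightarrow> complex^'d \<Rightarrow> complex^'d \<Rightarrow> complex" where
  "i_del_delbar f z u v = \<i> * (\<Sum>j\<in>UNIV. \<Sum>k\<in>UNIV.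
     d_dz j (d_dzbar k f) z * (u $ j * cnj (v $ k) - v $ j * cnj (u $ k)))"

text \<open>
  The map \<open>z \<mapsto> z / \<surd>(\<Sum>z\<^sub>k\<^sup>2)\<close> is a holomorphic retraction of a neighbourhood of the
  quadric \<open>Q\<close> onto \<open>Q\<close>. Since \<open>\<partial>\<close> and \<open>\<partial>\<close>-bar commute with holomorphic pull-back,
  the form \<open>i_del_delbar\<close> of a function \<open>f\<close> on the complex manifold \<open>Q\<close> is the restriction to
  \<open>TQ\<close> of \<open>i_del_delbar (f \<circ> quadric_retract)\<close>.
\<close>

definition quadric_retract :: "complex^'d \<Rightarrow> complex^'d" where
  "quadric_retract z = (1 / csqrt (\<Sum>k\<in>UNIV. (z $ k)\<^sup>2)) *s z"

lemma quadric_retract_eq: "z \<in> quadric \<Longrightarrow> quadric_retract z = z"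
  by (simp add: quadric_def quadric_retract_def)

definition i_del_delbar_quadric ::
    "(complex^'d \<Rightarrow> complex) \<Rightarrow> complex^'d \<Rightarrow> complex^'d \<Rightarrow> complex^'d \<Rightarrow> complex" where
  "i_del_delbar_quadric f = i_del_delbar (f \<circ> quadric_retract)"

text \<open>
  For even \<open>n\<close> the differential equation determines \<open>U'\<close> only up to sign; \<open>U' > 0\<close>
  is the choice for which the form is positive, i.e. a Kaehler form.
\<close>

definition stenzel_potential :: "nat \<Rightarrow> real \<Rightarrow> (real \<Rightarrow> real) \<Rightarrow> bool" where
  "stenzel_potential n c U \<longleftrightarrow> c > 0 \<and>
     (\<exists>U'. (\<forall>w\<ge>0. (U has_real_derivative U' w) (at w within {0..})) \<and>
           U' 0 = 0 \<and> (\<forall>w>0. U' w > 0) \<and>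
           (\<forall>w\<ge>0. ((\<lambda>s. U' s ^ n) has_real_derivative c * real n * sinh w ^ (n - 1))
                      (at w within {0..})))"

definition stenzel_form ::
    "(real \<Rightarrow> real) \<Rightarrow> complex^'d \<Rightarrow> complex^'d \<Rightarrow> complex^'d \<Rightarrow> complex" where
  "stenzel_form U = i_del_delbar_quadric (\<lambda>z. complex_of_real (U (arcosh ((norm z)\<^sup>2))))"

section \<open>Lagrangian submanifolds\<close>

definition differentiable_curve ::
    "nat \<Rightarrow> 'm::topological_space chart set \<Rightarrow> (real \<Rightarrow> 'm) \<Rightarrow> bool" where
  "differentiable_curve q A g \<longleftrightarrow> isCont g 0 \<and>
     (\<forall>(U, \<phi>)\<in>A. g 0 \<in> U \<longrightarrow> (\<forall>i<q. (\<lambda>t. \<phi> (g t) i) differentiable (at 0)))"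

text \<open>
  For a submanifold \<open>N\<close> of the pull-back bundle \<open>T\<^sup>*S\<^sup>n|\<^sub>L\<close>, the tangent vectors at \<open>(p, \<eta>) \<in> N\<close>
  are the velocities at time 0 of curves in \<open>N\<close> through \<open>(p, \<eta>)\<close>; they are mapped to \<open>TQ\<close>
  by the differential of \<open>(p, \<eta>) \<mapsto> Psi (x p) \<eta>\<close>.
\<close>

definition tangent_vectors ::
    "nat \<Rightarrow> 'm::topological_space chart set \<Rightarrow> ('m \<Rightarrow> real^'d) \<Rightarrow> ('m \<times> (real^'d)) set
      \<Rightarrow> 'm \<times> (real^'d) \<Rightarrow> (complex^'d) set" where
  "tangent_vectors q A x N P =
     {w. \<exists>g h. differentiable_curve q A g \<and> h differentiable (at 0) \<and>
            (\<forall>t. (g t, h t) \<in> N) \<and> (g 0, h 0) = P \<and>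
            ((\<lambda>t. Psi (x (g t)) (h t)) has_vector_derivative w) (at 0)}"

definition lagrangian ::
    "nat \<Rightarrow> 'm::topological_space chart set \<Rightarrow> ('m \<Rightarrow> real^'d)
      \<Rightarrow> (complex^'d \<Rightarrow> complex^'d \<Rightarrow> complex^'d \<Rightarrow> complex) \<Rightarrow> ('m \<times> (real^'d)) set \<Rightarrow> bool" where
  "lagrangian q A x \<omega> N \<longleftrightarrow>
     (\<forall>(p, \<eta>)\<in>N. \<forall>u\<in>tangent_vectors q A x N (p, \<eta>). \<forall>v\<in>tangent_vectors q A x N (p, \<eta>).
        \<omega> (Psi (x p) \<eta>) u v = 0)"

end

theory Submission
  imports Defs
begin

text \<open>
  On \<open>T\<^sup>*S\<^sup>n\<close> the Stenzel form is exact with primitive a constant multiple of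
  \<open>U'(2 r) / r \<cdot> \<langle>\<xi>, dx\<rangle>\<close>, where \<open>r = |\<xi>|\<close>. The canonical form \<open>\<langle>\<xi>, dx\<rangle>\<close> restricts to \<open>\<mu>\<close> on
  \<open>N\<^sup>*L + \<mu>\<close>, so the restricted Stenzel form is a multiple of \<open>d(U'(2 r) / r) \<and> \<mu> + U'(2 r) / r \<cdot> d\<mu>\<close>.
  For \<open>\<mu> = 0\<close> it vanishes; pointwise, this is the symmetry of the second fundamental form. If \<open>\<mu>\<close> is not zero at \<open>p\<close>, then evaluating on a conormal direction and a lift of a
  tangent vector forces \<open>U'(w) / w\<close> to be stationary for all large \<open>w\<close>; the differential equation of \<open>U\<close>
  then gives \<open>sinh w = w cosh w\<close>, which is absurd. (For \<open>n = 1\<close> the quotient \<open>U'(w) / w\<close> is constant,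
  but then \<open>q = 0\<close> and \<open>\<mu> = 0\<close>.)
\<close>

subsection \<open>The Stenzel potential\<close>

text \<open>The primitive is never constructed. The form is computed pointwise: for tangent vectors
  \<open>u\<close>, \<open>v\<close> of the quadric, i del delbar of F(|z|^2) is \<open>-2 * (F' *
  Im (herm u v) + F'' * Im (herm u z * cnj (herm v z)))\<close>, into which velocities of curves in
  the bundle are inserted. Two obstacles shape the development. On the zero section, neither arcosh
  nor the norm of a covector is differentiable, so \<open>F''\<close> is not at hand; but |z|^2 is
  minimal there, its derivative vanishes, and continuity of \<open>F'\<close> suffices. Moreover, a
  tangent vector is the velocity of a curve lying wholly in the bundle, so a vector with prescribed
  base velocity needs a curve whose covector part solves a linear system in a moving tangent space;
  that this solution is differentiable must be proved. In the step from Lagrangian to \<mu> = 0 the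
  term d\<mu> is avoided: one vector is vertical, and the other enters only through its base
  velocity and the derivative of the relation that covectors are orthogonal to \<open>x\<close>.
  Every radius above the norm of \<mu>(p) occurs in the fibre, which is why all large
  \<open>w\<close> are reached.\<close>

lemma stenzel_potentialE:
  assumes "stenzel_potential n c U" "n > 0"
  obtains U' U'' where
    "\<And>w. w \<ge> 0 \<Longrightarrow> (U has_real_derivative U' w) (at w within {0..})"
    "\<And>w. w > 0 \<Longrightarrow> (U' has_real_derivative U'' w) (at w)"
    "\<And>w. w > 0 \<Longrightarrow> ((\<lambda>s. U' s ^ n) has_real_derivative c * real n * sinh w ^ (n - 1)) (at w)"
    "((\<lambda>w. U' w / w) \<longlongrightarrow> root n c) (at_right 0)"
proof -
  from assms obtain U' where c: "c > 0"
    and U: "\<And>w. w \<ge> 0 \<Longrightarrow> (U has_real_derivative U' w) (at w within {0..})"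
    and U0: "U' 0 = 0" and pos: "\<And>w. w > 0 \<Longrightarrow> U' w > 0"
    and P: "\<And>w. w \<ge> 0 \<Longrightarrow> ((\<lambda>s. U' s ^ n) has_real_derivative c * real n * sinh w ^ (n - 1))
                      (at w within {0..})"
    unfolding stenzel_potential_def by blast
  have P': "((\<lambda>s. U' s ^ n) has_real_derivative c * real n * sinh w ^ (n - 1)) (at w)" if "w > 0" for w
  proof -
    have "at w within {0..} = at w"
      by (rule at_within_interior) (use that in simp)
    with P[of w] that show ?thesis by simp
  qed
  \<comment> \<open>Positivity of \<open>U'\<close> singles out the real root, and
    \<open>root n\<close> is differentiable away from 0; so the derivative of \<open>U' ^ n\<close>
    passes to \<open>U'\<close> for w > 0.\<close>
  have U'root: "U' w = root n (U' w ^ n)" if "w > 0" for w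
    using pos[OF that] assms(2) by (simp add: real_root_power_cancel)
  have "\<exists>D. (U' has_real_derivative D) (at w)" if w: "w > 0" for w
  proof -
    have "(root n has_real_derivative inverse (real n * root n (U' w ^ n) ^ (n - Suc 0))) (at (U' w ^ n))"
      using assms(2) pos[OF w] by (intro DERIV_real_root) auto
    from DERIV_chain2[OF this P'[OF w]]
    have "((\<lambda>s. root n (U' s ^ n)) has_real_derivative
        inverse (real n * root n (U' w ^ n) ^ (n - Suc 0)) * (c * real n * sinh w ^ (n - 1))) (at w)" .
    then have "(U' has_real_derivative
        inverse (real n * root n (U' w ^ n) ^ (n - Suc 0)) * (c * real n * sinh w ^ (n - 1))) (at w)"
      by (rule has_field_derivative_transform_within_open[where S="{0<..}"])
         (use w U'root in auto)
    then show ?thesis by blast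
  qed
  then obtain U'' where U'': "\<And>w. w > 0 \<Longrightarrow> (U' has_real_derivative U'' w) (at w)"
    by metis
  have P0: "((\<lambda>s. U' s ^ n) \<longlongrightarrow> 0) (at_right 0)"
    using DERIV_continuous[OF P[of 0]] U0 assms(2)
    unfolding continuous_within at_within_Ici_at_right by (metis order_refl zero_power)
  have sq: "((\<lambda>w::real. sinh w / w) \<longlongrightarrow> 1) (at_right 0)"
  proof (rule lhopital_right_0[where f'=cosh and g'="\<lambda>_. 1"])
    show "\<forall>\<^sub>F w::real in at_right 0. w \<noteq> 0"
      by (auto simp: eventually_at_filter)
    show "(sinh \<longlongrightarrow> 0) (at_right (0::real))"
      by (rule tendsto_eq_intros refl | simp)+
    show "((\<lambda>x::real. cosh x / 1) \<longlongrightarrow> 1) (at_right 0)"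
      by (rule tendsto_eq_intros refl | simp)+
  qed (auto intro!: derivative_eq_intros tendsto_eq_intros always_eventually)
  \<comment> \<open>The quotient of derivatives is \<open>c * (sinh w / w) ^ (n - 1)\<close>, so
    l'Hopital's rule gives the limit c. Its root, the limit of \<open>U' w / w\<close>, is what the
    profile must take as value on the zero section.\<close>
  have "((\<lambda>w. U' w ^ n / w ^ n) \<longlongrightarrow> c) (at_right 0)"
  proof (rule lhopital_right_0[where f'="\<lambda>w. c * real n * sinh w ^ (n - 1)" and g'="\<lambda>w. real n * w ^ (n - 1)"])
    show "((\<lambda>w::real. w ^ n) \<longlongrightarrow> 0) (at_right 0)"
      using assms(2) by (auto intro!: tendsto_eq_intros)
    show "\<forall>\<^sub>F w::real in at_right 0. w ^ n \<noteq> 0" "\<forall>\<^sub>F w::real in at_right 0. real n * w ^ (n - 1) \<noteq> 0"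
      by (rule eventually_mono[OF eventually_at_right_less[of 0]], use assms(2) in simp)+
    show "\<forall>\<^sub>F w in at_right 0. ((\<lambda>w. U' w ^ n) has_real_derivative c * real n * sinh w ^ (n - 1)) (at w)"
      using P' by (auto simp: eventually_at_filter)
    show "\<forall>\<^sub>F w in at_right 0. ((\<lambda>w. w ^ n) has_real_derivative real n * w ^ (n - 1)) (at w)"
      by (auto intro!: always_eventually derivative_eq_intros)
    have "((\<lambda>w. c * (sinh w / w) ^ (n - 1)) \<longlongrightarrow> c * 1 ^ (n - 1)) (at_right 0)"
      by (intro tendsto_intros sq)
    then show "((\<lambda>w. c * real n * sinh w ^ (n - 1) / (real n * w ^ (n - 1))) \<longlongrightarrow> c) (at_right 0)"
      using assms(2) by (simp add: power_divide)
  qed (rule P0)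
  then have "((\<lambda>w. root n (U' w ^ n / w ^ n)) \<longlongrightarrow> root n c) (at_right 0)"
    by (rule tendsto_real_root)
  moreover have "\<forall>\<^sub>F w in at_right 0. root n (U' w ^ n / w ^ n) = U' w / w"
  proof -
    have "root n ((U' w / w) ^ n) = U' w / w" if "w > 0" for w
      using assms(2) pos[OF that] that by (intro real_root_power_cancel) auto
    then show ?thesis
      by (auto simp: eventually_at_filter power_divide)
  qed
  ultimately have lim: "((\<lambda>w. U' w / w) \<longlongrightarrow> root n c) (at_right 0)"
    using tendsto_cong by fast
  show ?thesis
    by (rule that[OF U U'' P' lim])
qed

text \<open>\<open>G\<close> is the derivative of the potential as a function of s = cosh w = |z|^2.
  At s = 1 the function arcosh has a vertical tangent, and the finite limit of
  \<open>U' w / w\<close> compensates for it. Only a one-sided derivative and continuity of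
  \<open>G\<close> are obtained there, which is all that the zero section requires.\<close>

lemma radial_profileE:
  fixes U U' U'' :: "real \<Rightarrow> real"
  assumes U: "\<And>w. w \<ge> 0 \<Longrightarrow> (U has_real_derivative U' w) (at w within {0..})"
    and U': "\<And>w. w > 0 \<Longrightarrow> (U' has_real_derivative U'' w) (at w)"
    and lim: "((\<lambda>w. U' w / w) \<longlongrightarrow> l) (at_right 0)"
  obtains G where
    "\<And>s. s \<ge> 1 \<Longrightarrow> ((\<lambda>s. U (arcosh s)) has_real_derivative G s) (at s within {1..})"
    "continuous (at 1 within {1..}) G"
    "\<And>w. w > 0 \<Longrightarrow> G (cosh w) = U' w / sinh w"
    "\<And>w. w > 0 \<Longrightarrow> (G has_real_derivative (U'' w * sinh w - U' w * cosh w) / sinh w ^ 3) (at (cosh w))"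
proof -
  define G where "G s = (if s = 1 then l else U' (arcosh s) / sqrt (s\<^sup>2 - 1))" for s
  have arc_pos: "arcosh s > 0" if "s > 1" for s :: real
    using that by simp
  have sq: "((\<lambda>w::real. w / sinh w) \<longlongrightarrow> 1) (at_right 0)"
  proof (rule lhopital_right_0[where f'="\<lambda>_. 1" and g'=cosh])
    show "\<forall>\<^sub>F w::real in at_right 0. sinh w \<noteq> 0"
      by (auto simp: eventually_at_filter)
    show "(sinh \<longlongrightarrow> 0) (at_right (0::real))"
      by (rule tendsto_eq_intros refl | simp)+
    show "((\<lambda>x::real. 1 / cosh x) \<longlongrightarrow> 1) (at_right 0)"
      by (rule tendsto_eq_intros refl | simp)+
  qed (auto intro!: derivative_eq_intros tendsto_eq_intros always_eventually)
  have sinh_arc: "sinh (arcosh s) = sqrt (s\<^sup>2 - 1)" if "s > 1" for s :: real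
    using that by (simp add: sinh_arcosh_real)
  have Gcosh: "G (cosh w) = U' w / sinh w" if "w > 0" for w
    using that by (simp add: G_def cosh_square_eq arcosh_cosh_real)
  have arc_lim: "filterlim arcosh (at_right 0) (at_right (1::real))"
  proof -
    have "continuous (at 1 within {1..}) (arcosh :: real \<Rightarrow> real)"
      using continuous_on_arcosh'[of "{1..}" "\<lambda>x. x"] by (simp add: continuous_on_eq_continuous_within)
    then have "((arcosh :: real \<Rightarrow> real) \<longlongrightarrow> 0) (at_right 1)"
      by (simp add: continuous_within at_within_Ici_at_right)
    moreover have "\<forall>\<^sub>F s in at_right (1::real). arcosh s \<in> {0<..}"
      using arc_pos by (auto simp: eventually_at_filter)
    ultimately show ?thesis
      by (simp add: filterlim_at eventually_conj_iff) (auto simp: eventually_at_filter)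
  qed
  have Glim: "(G \<longlongrightarrow> l) (at_right 1)"
  proof -
    have "((\<lambda>w. (U' w / w) * (w / sinh w)) \<longlongrightarrow> l * 1) (at_right 0)"
      by (intro tendsto_intros lim sq)
    from filterlim_compose[OF this arc_lim]
    have "((\<lambda>s. (U' (arcosh s) / arcosh s) * (arcosh s / sinh (arcosh s))) \<longlongrightarrow> l) (at_right 1)"
      by simp
    moreover have "\<forall>\<^sub>F s in at_right 1.
        (U' (arcosh s) / arcosh s) * (arcosh s / sinh (arcosh s)) = G s"
    proof -
      have "(U' (arcosh s) / arcosh s) * (arcosh s / sinh (arcosh s)) = G s" if "s > 1" for s
        using that arc_pos[OF that] by (simp add: G_def sinh_arc del: arcosh_real_gt_1_iff)
      then show ?thesis by (auto simp: eventually_at_filter)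
    qed
    ultimately show ?thesis using tendsto_cong by fast
  qed
  have Ud: "(U has_real_derivative U' w) (at w)" if "w > 0" for w
  proof -
    have "at w within {0..} = at w"
      by (rule at_within_interior) (use that in simp)
    with U[of w] that show ?thesis by simp
  qed
  have F1: "((\<lambda>s. U (arcosh s)) has_real_derivative G s) (at s)" if "s > 1" for s
  proof -
    have "((\<lambda>s. U (arcosh s)) has_real_derivative U' (arcosh s) * (1 / sqrt (s\<^sup>2 - 1))) (at s)"
      by (rule DERIV_chain2[OF Ud[OF arc_pos[OF that]] arcosh_real_has_field_derivative[OF that]])
    then show ?thesis using that by (simp add: G_def)
  qed
  have F0: "((\<lambda>s. U (arcosh s)) has_real_derivative G 1) (at 1 within {1..})"
  proof -
    have "(U \<longlongrightarrow> U 0) (at_right 0)"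
      using DERIV_continuous[OF U[of 0]] by (simp add: continuous_within at_within_Ici_at_right)
    from filterlim_compose[OF this arc_lim]
    have "((\<lambda>s. U (arcosh s)) \<longlongrightarrow> U 0) (at_right 1)" .
    then have 1: "((\<lambda>s. U (arcosh s) - U 0) \<longlongrightarrow> 0) (at_right 1)"
      using LIM_zero by blast
    \<comment> \<open>The chain rule fails at s = 1; the one-sided difference quotient is evaluated
      by l'Hopital's rule from the limit of \<open>G\<close>.\<close>
    have "((\<lambda>s. (U (arcosh s) - U 0) / (s - 1)) \<longlongrightarrow> l) (at_right 1)"
    proof (rule lhopital_right[where f'=G and g'="\<lambda>_. 1"])
      show "\<forall>\<^sub>F s in at_right 1. ((\<lambda>s. U (arcosh s) - U 0) has_real_derivative G s) (at s)"
      proof -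
        have "((\<lambda>s. U (arcosh s) - U 0) has_real_derivative G s) (at s)" if "s > 1" for s
          using DERIV_diff[OF F1[OF that] DERIV_const[of "U 0"]] by simp
        then show ?thesis by (auto simp: eventually_at_filter)
      qed
      show "((\<lambda>s. s - 1) \<longlongrightarrow> 0) (at_right (1::real))"
        by (auto intro!: tendsto_eq_intros)
      show "((\<lambda>s. G s / 1) \<longlongrightarrow> l) (at_right 1)" using Glim by simp
      show "\<forall>\<^sub>F s in at_right 1. s - 1 \<noteq> (0::real)" by (auto simp: eventually_at_filter)
      show "\<forall>\<^sub>F s in at_right (1::real). ((\<lambda>s. s - 1) has_real_derivative 1) (at s)"
        by (auto intro!: always_eventually derivative_eq_intros)
    qed (use 1 in auto)
    then show ?thesis
      by (simp add: has_field_derivative_iff at_within_Ici_at_right G_def)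
  qed
  show ?thesis
  proof (rule that[of G])
    fix s :: real assume "s \<ge> 1"
    then show "((\<lambda>s. U (arcosh s)) has_real_derivative G s) (at s within {1..})"
      using F0 F1 has_field_derivative_at_within by (cases "s = 1") force+
  next
    show "continuous (at 1 within {1..}) G"
      using Glim by (simp add: continuous_within at_within_Ici_at_right G_def)
  next
    fix w :: real assume w: "w > 0"
    then show "G (cosh w) = U' w / sinh w" by (rule Gcosh)
    have c1: "cosh w > 1" using cosh_real_strict_mono[of 0 w] w by simp
    have d: "(arcosh has_real_derivative 1 / sinh w) (at (cosh w))"
      using arcosh_real_has_field_derivative[OF c1] w by (simp add: cosh_square_eq)
    have "(U' has_real_derivative U'' w) (at (arcosh (cosh w)))"
      using U'[OF w] w by (simp add: arcosh_cosh_real)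
    from DERIV_chain2[OF this d]
    have a: "((\<lambda>s. U' (arcosh s)) has_real_derivative U'' w * (1 / sinh w)) (at (cosh w))" .
    have "(sinh has_real_derivative cosh w) (at (arcosh (cosh w)))"
      using w by (auto intro!: derivative_eq_intros simp: arcosh_cosh_real)
    from DERIV_chain2[OF this d]
    have b: "((\<lambda>s. sinh (arcosh s)) has_real_derivative cosh w * (1 / sinh w)) (at (cosh w))" .
    have s0: "sinh (arcosh (cosh w)) \<noteq> 0" using w by (simp add: arcosh_cosh_real)
    have "((\<lambda>s. U' (arcosh s) / sinh (arcosh s)) has_real_derivative
       (U'' w * sinh w - U' w * cosh w) / sinh w ^ 3) (at (cosh w))"
      using DERIV_divide[OF a b s0] w
      by (simp add: arcosh_cosh_real field_simps power2_eq_square power3_eq_cube)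
    then show "(G has_real_derivative (U'' w * sinh w - U' w * cosh w) / sinh w ^ 3) (at (cosh w))"
      by (rule has_field_derivative_transform_within_open[where S="{1<..}"])
         (use c1 in \<open>auto simp: G_def sinh_arc\<close>)
  qed
qed

lemma sinh_less_mult_cosh:
  fixes w :: real
  assumes "w > 0"
  shows "sinh w < w * cosh w"
proof -
  have "\<exists>z>0. z < w \<and> sinh w - sinh 0 = (w - 0) * cosh z"
    by (rule MVT2[OF assms]) (auto intro!: derivative_eq_intros)
  then obtain z where z: "0 < z" "z < w" "sinh w = w * cosh z" by auto
  then have "cosh z < cosh w" using cosh_real_strict_mono[of z w] by simp
  then show ?thesis using z assms by simp
qed

text \<open>The chain rule and the differential equation give two expressions for the derivative of
  \<open>U' ^ n\<close>, hence \<open>U' w ^ n = c * w * sinh w ^ (n - 1)\<close> beyond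
  \<open>w0\<close>. Differentiating this and comparing with the differential equation once more
  leaves (n - 1) w cosh w = (n - 1) sinh w. For n = 1 the last equation is void, and
  \<open>U' w = c * w\<close> is indeed a solution.\<close>

lemma stenzel_profile_not_linear:
  assumes n: "n \<ge> 2" and c: "c > 0" and w0: "w0 \<ge> 0"
    and d: "\<And>w. w > 0 \<Longrightarrow> (U' has_real_derivative U'' w) (at w)"
    and P: "\<And>w. w > 0 \<Longrightarrow> ((\<lambda>s. U' s ^ n) has_real_derivative c * real n * sinh w ^ (n - 1)) (at w)"
    and eq: "\<And>w. w > w0 \<Longrightarrow> U'' w = U' w / w"
  shows False
proof -
  obtain k where k: "n = Suc (Suc k)" using n by (metis Suc_le_D numeral_2_eq_2 Suc_le_mono)
  have val: "U' w ^ n = c * w * sinh w ^ (n - 1)" if "w > w0" for w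
  proof -
    have w: "w > 0" using that w0 by simp
    have "((\<lambda>s. U' s ^ n) has_real_derivative real n * U' w ^ (n - 1) * U'' w) (at w)"
      using DERIV_power[OF d[OF w], of n] by (simp add: mult_ac)
    from DERIV_unique[OF this P[OF w]]
    have "real n * (U' w ^ (n - 1) * U' w) = real n * (c * w * sinh w ^ (n - 1))"
      using w by (simp add: eq[OF that] field_simps)
    then show ?thesis using k by (simp add: mult.commute)
  qed
  define w where "w = w0 + 1"
  have w: "w > 0" "w > w0" using w0 by (auto simp: w_def)
  have "((\<lambda>w. c * w * sinh w ^ (n - 1)) has_real_derivative
      c * sinh w ^ (n - 1) + c * w * (real (n - 1) * sinh w ^ k * cosh w)) (at w)"
  proof -
    have "(sinh has_real_derivative cosh w) (at w)" by (auto intro!: derivative_eq_intros)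
    from DERIV_power[OF this, of "n - 1"]
    have "((\<lambda>w. sinh w ^ (n - 1)) has_real_derivative real (n - 1) * sinh w ^ k * cosh w) (at w)"
      using k by (simp add: mult_ac)
    from DERIV_mult[OF DERIV_cmult[OF DERIV_ident, of c] this] show ?thesis
      by (simp add: algebra_simps)
  qed
  moreover have "((\<lambda>w. c * w * sinh w ^ (n - 1)) has_real_derivative c * real n * sinh w ^ (n - 1)) (at w)"
    by (rule has_field_derivative_transform_within_open[OF P[OF w(1)], where S="{w0<..}"]) (use w val in auto)
  ultimately have "c * sinh w ^ (n - 1) + c * w * (real (n - 1) * sinh w ^ k * cosh w) = c * real n * sinh w ^ (n - 1)"
    by (rule DERIV_unique)
  then have "(c * real (Suc k) * sinh w ^ k) * (w * cosh w) = (c * real (Suc k) * sinh w ^ k) * sinh w"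
    unfolding k by (simp add: algebra_simps)
  then have "w * cosh w = sinh w" using c w by simp
  then show False using sinh_less_mult_cosh[OF w(1)] by simp
qed

text \<open>
  The last hypothesis says that \<open>U'(w) / w\<close> is stationary at \<open>w = 2 r\<close>: \<open>S1\<close> and \<open>S * E\<close> are the rates
  of change of \<open>sinh r / r\<close> and \<open>cosh r\<close> when \<open>r\<close> changes at the rate \<open>E / r\<close>.
\<close>

lemma stationary_profile_algebra:
  fixes r E :: real
  assumes r: "r > 0" and E: "E \<noteq> 0"
    and S: "S = sinh r / r" and C: "C = cosh r"
    and S1: "S1 = (cosh r / r - sinh r / r\<^sup>2) * (E / r)"
    and G: "G = U1 / sinh (2 * r)"
    and g: "g = (U2 * sinh (2 * r) - U1 * cosh (2 * r)) / sinh (2 * r) ^ 3"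
    and eq: "G * (S1 * C + S * E * S) + g * (S * E * C + S * S * E + S1 * S * r\<^sup>2) * (2 * S * C) = 0"
  shows "U2 = U1 / (2 * r)"
proof -
  let ?sh = "sinh (2 * r)" and ?ch = "cosh (2 * r)"
  have sh: "?sh > 0" using r by simp
  have sd: "?sh = 2 * sinh r * cosh r" and cd: "?ch = (cosh r)\<^sup>2 + (sinh r)\<^sup>2"
    by (simp_all add: sinh_double cosh_double)
  \<comment> \<open>Written with the doubled argument, both summands carry the nonzero factor E /
    r^2. In what remains, the multiples of \<open>U1 * cosh (2 * r) / sinh (2 * r)\<close>
    cancel.\<close>
  have a: "S1 * C + S * E * S = E / r\<^sup>2 * (?ch - ?sh / (2 * r))"
    unfolding sd cd S C S1 using r by (simp add: field_simps power2_eq_square)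
  have b: "S * E * C + S * S * E + S1 * S * r\<^sup>2 = E * ?sh / r" "2 * S * C = ?sh / r"
    unfolding sd S C S1 using r by (simp_all add: field_simps power2_eq_square)
  have "E / r\<^sup>2 * (G * (?ch - ?sh / (2 * r)) + g * ?sh\<^sup>2) = 0"
    using eq unfolding a b using r by (simp add: field_simps power2_eq_square)
  then have "G * (?ch - ?sh / (2 * r)) + g * ?sh\<^sup>2 = 0" using E r by simp
  moreover have "G * (?ch - ?sh / (2 * r)) + g * ?sh\<^sup>2 = U2 - U1 / (2 * r)"
    unfolding G g using sh r by (simp add: field_simps power2_eq_square power3_eq_cube)
  ultimately show ?thesis by simp
qed

subsection \<open>The Stenzel form on the quadric\<close>

text \<open>A product rule in which the first factor is merely continuous, at the price that the
  second one vanishes at the point. This is the device for the zero section, both for the form and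
  for the curves mapped by \<open>Psi\<close>.\<close>

lemma has_derivative_scaleR_vanishing:
  fixes f :: "'a::real_normed_vector \<Rightarrow> real" and p :: "'a \<Rightarrow> 'b::real_normed_vector"
  assumes f: "isCont f a" and p: "(p has_derivative p') (at a)" and "p a = 0"
  shows "((\<lambda>x. f x *\<^sub>R p x) has_derivative (\<lambda>h. f a *\<^sub>R p' h)) (at a)"
proof -
  have bl: "bounded_linear p'" and R: "((\<lambda>y. norm (p y - p' (y - a)) / norm (y - a)) \<longlongrightarrow> 0) (at a)"
    using p \<open>p a = 0\<close> by (auto simp: has_derivative_iff_norm)
  from bl obtain K where K: "\<And>x. norm (p' x) \<le> norm x * K"
    using bounded_linear.bounded by blast
  have fa: "(f \<longlongrightarrow> f a) (at a)" using f by (simp add: isCont_def)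
  have "((\<lambda>y. \<bar>f y\<bar> * (norm (p y - p' (y - a)) / norm (y - a)) + \<bar>f y - f a\<bar> * K) \<longlongrightarrow>
      \<bar>f a\<bar> * 0 + \<bar>f a - f a\<bar> * K) (at a)"
    by (intro tendsto_intros fa R)
  then have lim: "((\<lambda>y. \<bar>f y\<bar> * (norm (p y - p' (y - a)) / norm (y - a)) + \<bar>f y - f a\<bar> * K) \<longlongrightarrow> 0) (at a)"
    by simp
  have le: "norm (f y *\<^sub>R p y - f a *\<^sub>R p a - f a *\<^sub>R p' (y - a)) / norm (y - a)
      \<le> \<bar>f y\<bar> * (norm (p y - p' (y - a)) / norm (y - a)) + \<bar>f y - f a\<bar> * K" if "y \<noteq> a" for y
  proof -
    have "f y *\<^sub>R p y - f a *\<^sub>R p a - f a *\<^sub>R p' (y - a) =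
       f y *\<^sub>R (p y - p' (y - a)) + (f y - f a) *\<^sub>R p' (y - a)"
      using \<open>p a = 0\<close> by (simp add: algebra_simps)
    then have "norm (f y *\<^sub>R p y - f a *\<^sub>R p a - f a *\<^sub>R p' (y - a)) \<le>
        \<bar>f y\<bar> * norm (p y - p' (y - a)) + \<bar>f y - f a\<bar> * norm (p' (y - a))"
      by (metis norm_triangle_ineq norm_scaleR)
    also have "\<dots> \<le> \<bar>f y\<bar> * norm (p y - p' (y - a)) + \<bar>f y - f a\<bar> * (norm (y - a) * K)"
      by (intro add_left_mono mult_left_mono K) auto
    finally show ?thesis using that by (simp add: field_simps)
  qed
  have "((\<lambda>y. norm (f y *\<^sub>R p y - f a *\<^sub>R p a - f a *\<^sub>R p' (y - a)) / norm (y - a)) \<longlongrightarrow> 0) (at a)"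
    by (rule tendsto_sandwich[OF _ _ tendsto_const lim])
       (use le in \<open>auto simp: eventually_at_filter intro!: always_eventually\<close>)
  then show ?thesis
    using bounded_linear_scaleR_right[THEN bounded_linear_compose, OF bl]
    by (auto simp: has_derivative_iff_norm)
qed

text \<open>The quadric is \<open>bil z z = 1\<close>, so \<open>bil z h = 0\<close> is the equation
  of its tangent space at \<open>z\<close>.\<close>

definition bil :: "complex^'d \<Rightarrow> complex^'d \<Rightarrow> complex" where
  "bil z h = (\<Sum>k\<in>UNIV. z $ k * h $ k)"

definition herm :: "complex^'d \<Rightarrow> complex^'d \<Rightarrow> complex" where
  "herm u v = (\<Sum>k\<in>UNIV. u $ k * cnj (v $ k))"

lemma quadric_iff_bil: "z \<in> quadric \<longleftrightarrow> bil z z = 1"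
  by (simp add: quadric_def bil_def power2_eq_square)

lemma bil_commute: "bil z h = bil h z"
  by (simp add: bil_def mult.commute)

lemma bil_scale_right: "bil z (a *s h) = a * bil z h"
  by (simp add: bil_def sum_distrib_left mult.left_commute)

lemma Re_herm: "Re (herm u v) = u \<bullet> v"
  by (simp add: herm_def inner_vec_def inner_complex_def)

lemma cnj_herm: "cnj (herm u v) = herm v u"
  by (simp add: herm_def mult.commute)

lemma herm_scale_left: "herm (a *s u) v = a * herm u v"
  by (simp add: herm_def sum_distrib_left mult.assoc)

lemma herm_self: "herm z z = of_real ((norm z)\<^sup>2)"
  unfolding norm_vec_def L2_set_def herm_def
  by (subst real_sqrt_pow2) (simp_all add: sum_nonneg complex_norm_square[symmetric] del: of_real_power)

lemma bil_axis: "bil z (axis k a) = z $ k * a"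
  by (simp add: bil_def axis_def if_distrib if_distribR sum.delta cong: if_cong)

lemma inner_axis_complex: "(z::complex^'d) \<bullet> axis k a = z $ k \<bullet> a"
  by (simp add: inner_axis)

lemma norm_bil_self_le: "norm (bil z z) \<le> (norm z)\<^sup>2"
proof -
  have "norm (bil z z) \<le> (\<Sum>k\<in>UNIV. (norm (z $ k))\<^sup>2)"
    unfolding bil_def by (rule order_trans[OF norm_sum]) (simp add: norm_mult power2_eq_square)
  also have "\<dots> = (norm z)\<^sup>2"
    unfolding norm_vec_def L2_set_def by (subst real_sqrt_pow2) (simp_all add: sum_nonneg)
  finally show ?thesis .
qed

lemma norm_quadric_ge_1: "z \<in> quadric \<Longrightarrow> (norm z)\<^sup>2 \<ge> 1"
  using norm_bil_self_le[of z] by (simp add: quadric_iff_bil)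

text \<open>The real part of the quadric equation and the norm condition differ by twice the sum of
  the squared imaginary parts. The points in question form the zero section.\<close>

lemma quadric_norm_1_real:
  assumes "z \<in> quadric" "(norm z)\<^sup>2 = 1"
  shows "cnj (z $ k) = z $ k"
proof -
  have "(\<Sum>k\<in>UNIV. (Im (z $ k))\<^sup>2) = 0"
  proof -
    have "(\<Sum>k\<in>UNIV. (Re (z $ k))\<^sup>2 - (Im (z $ k))\<^sup>2) = 1"
      using arg_cong[OF assms(1)[unfolded quadric_iff_bil bil_def], of Re] by (simp add: power2_eq_square)
    moreover have "(\<Sum>k\<in>UNIV. (Re (z $ k))\<^sup>2 + (Im (z $ k))\<^sup>2) = 1"
      using arg_cong[OF herm_self[of z], of Re] assms(2) by (simp add: herm_def power2_eq_square)
    ultimately show ?thesis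
      by (simp add: sum.distrib sum_subtractf)
  qed
  then have "Im (z $ k) = 0"
    by (subst (asm) sum_nonneg_eq_0_iff) auto
  then show ?thesis by (simp add: complex_eq_iff)
qed

text \<open>Only the modulus of the square root enters, so the branch cut of \<open>csqrt\<close>
  disappears from the pulled-back potential.\<close>

lemma norm_quadric_retract:
  "(norm (quadric_retract z))\<^sup>2 = (norm z)\<^sup>2 / norm (bil z z)"
proof -
  have "herm (a *s z) (a *s z) = of_real ((norm a)\<^sup>2 * (norm z)\<^sup>2)" for a :: complex
  proof -
    have "herm (a *s z) (a *s z) = (a * cnj a) * herm z z"
      by (simp add: herm_def sum_distrib_left mult_ac)
    then show ?thesis
      unfolding herm_self complex_norm_square[symmetric] by simp
  qed
  then have *: "(norm (a *s z))\<^sup>2 = (norm a)\<^sup>2 * (norm z)\<^sup>2" for a :: complex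
    unfolding herm_self by (metis of_real_eq_iff)
  have "(norm (csqrt w))\<^sup>2 = norm w" for w
    by (simp flip: norm_power)
  then show ?thesis
    by (simp add: quadric_retract_def * norm_divide power_divide bil_def power2_eq_square[of "z $ _"])
qed

section \<open>Wirtinger derivatives in terms of real differentials\<close>

lemma dir_deriv_eq:
  assumes "(f has_derivative f') (at z)"
  shows "dir_deriv v f z = f' v"
proof -
  interpret f': bounded_linear f' using assms by (rule has_derivative_bounded_linear)
  have "((\<lambda>t::real. z + t *\<^sub>R v) has_derivative (\<lambda>t. t *\<^sub>R v)) (at 0)"
    by (auto intro!: derivative_eq_intros)
  from has_derivative_compose[OF this, of f f'] assms
  have "((\<lambda>t. f (z + t *\<^sub>R v)) has_vector_derivative f' v) (at 0)"
    by (simp add: has_vector_derivative_def f'.scaleR)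
  then show ?thesis
    unfolding dir_deriv_def by (rule vector_derivative_at)
qed

text \<open>The operators \<open>d_dz\<close> extract the complex-linear part of the real
  differential \<open>g'\<close>, which sends u to (g'(u) - i g'(i u)) / 2. Sums over coordinates
  thereby become evaluations of \<open>g'\<close> at two vectors.\<close>

lemma sum_d_dz:
  assumes "(g has_derivative g') (at z)"
  shows "(\<Sum>j\<in>UNIV. d_dz j g z * u $ j) = (g' u - \<i> * g' (\<i> *s u)) / 2"
proof -
  interpret g': bounded_linear g' using assms by (rule has_derivative_bounded_linear)
  have dec: "w = (\<Sum>j\<in>UNIV. Re (w $ j) *\<^sub>R axis j 1 + Im (w $ j) *\<^sub>R axis j \<i>)" for w :: "complex^'a"
    by (simp add: vec_eq_iff axis_def if_distrib if_distribR sum.delta sum.distrib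
        complex_eq_iff cong: if_cong)
  have g'w: "g' w = (\<Sum>j\<in>UNIV. Re (w $ j) *\<^sub>R g' (axis j 1) + Im (w $ j) *\<^sub>R g' (axis j \<i>))" for w
    by (subst dec[of w]) (simp add: g'.sum g'.add g'.scaleR)
  have t: "((a - \<i> * b) / 2) * w = (Re w *\<^sub>R a + Im w *\<^sub>R b - \<i> * (Re (\<i> * w) *\<^sub>R a + Im (\<i> * w) *\<^sub>R b)) / 2" for a b w
    by (simp add: complex_eq_iff field_simps)
  show ?thesis
    unfolding d_dz_def dir_deriv_eq[OF assms] t
    unfolding g'w[of u] g'w[of "\<i> *s u"]
    by (simp only: vector_smult_component sum_divide_distrib[symmetric] sum_subtractf sum_distrib_left[symmetric])
qed

lemma has_derivative_bil_self:
  "((\<lambda>z. bil z z) has_derivative (\<lambda>h. 2 * bil z h)) (at z)"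
  unfolding bil_def
  by (rule derivative_eq_intros bounded_linear_imp_has_derivative[OF bounded_linear_vec_nth] refl)+
     (simp add: sum_distrib_left sum.distrib[symmetric] algebra_simps)

lemma has_derivative_norm_bil:
  assumes "bil z z \<noteq> 0"
  shows "((\<lambda>z. norm (bil z z)) has_derivative (\<lambda>h. (2 * bil z h) \<bullet> sgn (bil z z))) (at z)"
  by (rule has_derivative_compose[OF has_derivative_bil_self has_derivative_norm[OF assms]])

lemma has_derivative_norm_square:
  "((\<lambda>z::complex^'d. (norm z)\<^sup>2) has_derivative (\<lambda>h. 2 * (z \<bullet> h))) (at z)"
  unfolding power2_norm_eq_inner
  by (rule derivative_eq_intros refl)+ (simp add: inner_commute)

text \<open>
  \<open>nrm2 z\<close> is the squared norm of \<open>quadric_retract z\<close>, with differential \<open>dnrm2 z\<close>;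
  \<open>dbar_nrm2 k\<close> is its derivative in the direction of the conjugate of \<open>z\<^sub>k\<close>.
\<close>

definition nrm2 :: "complex^'d \<Rightarrow> real" where
  "nrm2 z = (norm z)\<^sup>2 / norm (bil z z)"

lemma nrm2_ge_1: "bil z z \<noteq> 0 \<Longrightarrow> nrm2 z \<ge> 1"
  using norm_bil_self_le[of z] by (simp add: nrm2_def)

lemma nrm2_quadric: "z \<in> quadric \<Longrightarrow> nrm2 z = (norm z)\<^sup>2"
  by (simp add: nrm2_def quadric_iff_bil)

definition dnrm2 :: "complex^'d \<Rightarrow> complex^'d \<Rightarrow> real" where
  "dnrm2 z h = 2 * (z \<bullet> h) / norm (bil z z)
     - (norm z)\<^sup>2 * ((2 * bil z h) \<bullet> sgn (bil z z)) / (norm (bil z z))\<^sup>2"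

lemma has_derivative_nrm2:
  assumes "bil z z \<noteq> 0"
  shows "(nrm2 has_derivative dnrm2 z) (at z)"
proof -
  have "((\<lambda>z. (norm z)\<^sup>2 / norm (bil z z)) has_derivative dnrm2 z) (at z)"
    by (rule has_derivative_eq_rhs[OF has_derivative_divide'[OF has_derivative_norm_square has_derivative_norm_bil[OF assms]]])
       (use assms in \<open>auto intro!: ext simp: dnrm2_def field_simps power2_eq_square\<close>)
  then show ?thesis by (simp add: nrm2_def[abs_def])
qed

definition dbar_nrm2 :: "'d \<Rightarrow> complex^'d \<Rightarrow> complex" where
  "dbar_nrm2 k z = z $ k * of_real (1 / norm (bil z z))
     - (of_real ((norm z)\<^sup>2 / norm (bil z z) ^ 3) * bil z z) * cnj (z $ k)"

lemma dnrm2_axis: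
  assumes "bil z z \<noteq> 0"
  shows "(of_real (dnrm2 z (axis k 1)) + \<i> * of_real (dnrm2 z (axis k \<i>))) / 2 = dbar_nrm2 k z"
  using assms
  by (simp add: dnrm2_def dbar_nrm2_def bil_axis inner_axis_complex inner_complex_def complex_eq_iff
       sgn_div_norm scaleR_conv_of_real power2_eq_square power3_eq_cube field_simps)

lemma open_bil_nonzero: "open {z. bil z z \<noteq> 0}"
proof -
  have "continuous_on UNIV (\<lambda>z::complex^'d. bil z z)"
    unfolding bil_def by (intro continuous_intros)
  then show ?thesis
    by (intro open_Collect_neq) (auto intro: continuous_on_const)
qed

text \<open>The outer derivative is one-sided at s = 1, but \<open>nrm2\<close> maps the open set
  \<open>bil z z \<noteq> 0\<close> into {1..}; the chain rule relative to this set applies, and on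
  an open set it gives the full derivative.\<close>

lemma has_derivative_stenzel_potential:
  assumes F: "\<And>s. s \<ge> 1 \<Longrightarrow> ((\<lambda>s. U (arcosh s)) has_real_derivative G s) (at s within {1..})"
    and z: "bil z z \<noteq> 0"
  shows "(((\<lambda>z. complex_of_real (U (arcosh ((norm z)\<^sup>2)))) \<circ> quadric_retract) has_derivative
     (\<lambda>h. of_real (G (nrm2 z) * dnrm2 z h))) (at z)"
proof -
  let ?S = "{z. bil z z \<noteq> (0::complex)}"
  have "((\<lambda>z. U (arcosh (nrm2 z))) has_derivative (\<lambda>h. G (nrm2 z) * dnrm2 z h)) (at z within ?S)"
  proof (rule has_derivative_in_compose2[where t="{1..}" and f=nrm2 and g="\<lambda>s. U (arcosh s)" and g'="\<lambda>s h. G s * h"])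
    show "((\<lambda>s. U (arcosh s)) has_derivative (*) (G x)) (at x within {1..})" if "x \<in> {1..}" for x
      using F[of x] that by (simp add: has_field_derivative_def)
    show "nrm2 ` ?S \<subseteq> {1..}" using nrm2_ge_1 by auto
    show "(nrm2 has_derivative dnrm2 z) (at z within ?S)"
      by (rule has_derivative_at_withinI[OF has_derivative_nrm2[OF z]])
  qed (use z in simp)
  then have "((\<lambda>z. U (arcosh (nrm2 z))) has_derivative (\<lambda>h. G (nrm2 z) * dnrm2 z h)) (at z)"
    using at_within_open[OF _ open_bil_nonzero, of z] z by simp
  from has_derivative_of_real[OF this, where 'a=complex] show ?thesis
    by (simp add: o_def norm_quadric_retract nrm2_def)
qed

lemma d_dzbar_stenzel_potential:
  assumes F: "\<And>s. s \<ge> 1 \<Longrightarrow> ((\<lambda>s. U (arcosh s)) has_real_derivative G s) (at s within {1..})"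
    and z: "bil z z \<noteq> 0"
  shows "d_dzbar k ((\<lambda>z. complex_of_real (U (arcosh ((norm z)\<^sup>2)))) \<circ> quadric_retract) z
     = G (nrm2 z) *\<^sub>R dbar_nrm2 k z"
proof -
  have "(((\<lambda>z. complex_of_real (U (arcosh ((norm z)\<^sup>2)))) \<circ> quadric_retract) has_derivative
     (\<lambda>h. of_real (G (nrm2 z) * dnrm2 z h))) (at z)"
    using F z by (rule has_derivative_stenzel_potential)
  from dir_deriv_eq[OF this] show ?thesis
    unfolding d_dzbar_def dnrm2_axis[OF z, symmetric]
    by (simp add: scaleR_conv_of_real algebra_simps add_divide_distrib)
qed

lemma dbar_nrm2_quadric:
  assumes "z \<in> quadric"
  shows "dbar_nrm2 k z = z $ k - of_real ((norm z)\<^sup>2) * cnj (z $ k)"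
  using assms by (simp add: dbar_nrm2_def quadric_iff_bil)

text \<open>\<open>N\<close> and \<open>B\<close> can stay abstract: \<open>N\<close> vanishes on
  tangent vectors of the quadric, and the \<open>B\<close> term is a multiple of
  \<open>cnj (z $ k)\<close>, which is killed by contraction with the conjugate of a tangent
  vector.\<close>

lemma has_derivative_dbar_nrm2:
  assumes z: "z \<in> quadric"
  obtains N B where "\<And>h. bil z h = 0 \<Longrightarrow> N h = 0"
    "\<And>k. (dbar_nrm2 k has_derivative
       (\<lambda>h. h $ k + z $ k * of_real (N h) - (B h * cnj (z $ k) + of_real ((norm z)\<^sup>2) * cnj (h $ k)))) (at z)"
proof -
  have z1: "bil z z = 1" using z by (simp add: quadric_iff_bil)
  then have z0: "bil z z \<noteq> 0" by simp
  note nb = has_derivative_norm_bil[OF z0]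
  define N where "N h = - ((2 * bil z h) \<bullet> 1)" for h
  have N: "((\<lambda>z. 1 / norm (bil z z)) has_derivative N) (at z)"
    by (rule derivative_eq_intros nb refl)+ (use z1 in \<open>auto simp: N_def\<close>)
  have n3: "norm (bil z z) ^ 3 \<noteq> 0" using z1 by simp
  from has_derivative_mult[OF has_derivative_of_real[OF has_derivative_divide'[OF
        has_derivative_norm_square has_derivative_power[OF nb, where n=3] n3], where 'a=complex]
      has_derivative_bil_self]
  obtain B where B: "((\<lambda>z. complex_of_real ((norm z)\<^sup>2 / norm (bil z z) ^ 3) * bil z z) has_derivative B) (at z)" by blast
  have c: "((\<lambda>z. cnj (z $ k)) has_derivative (\<lambda>h. cnj (h $ k))) (at z)" for k
    by (intro bounded_linear_imp_has_derivative bounded_linear_compose[OF bounded_linear_cnj] bounded_linear_vec_nth)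
  have n: "((\<lambda>z. z $ k) has_derivative (\<lambda>h. h $ k)) (at z)" for k
    by (intro bounded_linear_imp_has_derivative bounded_linear_vec_nth)
  show ?thesis
  proof (rule that)
    show "N h = 0" if "bil z h = 0" for h using that by (simp add: N_def)
    fix k
    show "(dbar_nrm2 k has_derivative
       (\<lambda>h. h $ k + z $ k * of_real (N h) - (B h * cnj (z $ k) + of_real ((norm z)\<^sup>2) * cnj (h $ k)))) (at z)"
      unfolding dbar_nrm2_def[abs_def]
      by (rule derivative_eq_intros N B c n refl)+ (use z1 in \<open>auto simp: algebra_simps\<close>)
  qed
qed

text \<open>With G = F' and g = F'' this is i del delbar of F(|z|^2); the contributions of the
  retraction drop out on tangent vectors. The differentiability of \<open>G\<close> is asked only
  off the zero section: on it \<open>z\<close> is real, so \<open>herm u z = bil z u = 0\<close> and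
  the second term vanishes.\<close>

lemma stenzel_form_quadric:
  fixes z u v :: "complex^'d"
  assumes F: "\<And>s. s \<ge> 1 \<Longrightarrow> ((\<lambda>s. U (arcosh s)) has_real_derivative G s) (at s within {1..})"
    and cont: "continuous (at 1 within {1..}) G"
    and G: "(norm z)\<^sup>2 > 1 \<Longrightarrow> (G has_real_derivative g) (at ((norm z)\<^sup>2))"
    and z: "z \<in> quadric" and u: "bil z u = 0" and v: "bil z v = 0"
  shows "stenzel_form U z u v =
     of_real (- 2 * (G ((norm z)\<^sup>2) * Im (herm u v) + g * Im (herm u z * cnj (herm v z))))"
proof -
  let ?f = "(\<lambda>z::complex^'d. complex_of_real (U (arcosh ((norm z)\<^sup>2)))) \<circ> quadric_retract"
  let ?s = "(norm z)\<^sup>2"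
  have z1: "bil z z = 1" using z by (simp add: quadric_iff_bil)
  then have z0: "bil z z \<noteq> 0" by simp
  obtain N B where N: "\<And>h. bil z h = 0 \<Longrightarrow> N h = 0"
    and p: "\<And>k. (dbar_nrm2 k has_derivative
       (\<lambda>h. h $ k + z $ k * of_real (N h) - (B h * cnj (z $ k) + of_real ((norm z)\<^sup>2) * cnj (h $ k)))) (at z)"
    using has_derivative_dbar_nrm2[OF z] by blast
  define P where "P k h = h $ k + z $ k * of_real (N h) - (B h * cnj (z $ k) + of_real ((norm z)\<^sup>2) * cnj (h $ k))" for k h
  have p: "(dbar_nrm2 k has_derivative P k) (at z)" for k
    unfolding P_def[abs_def] by (rule p)
  define D where "D k h = (g * dnrm2 z h) *\<^sub>R dbar_nrm2 k z + G ?s *\<^sub>R P k h" for k h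
  have GD: "((\<lambda>z. G (nrm2 z) *\<^sub>R dbar_nrm2 k z) has_derivative D k) (at z)" for k
  proof (cases "?s = 1")
    case False
    then have "(G has_real_derivative g) (at (nrm2 z))"
      using G norm_quadric_ge_1[OF z] nrm2_quadric[OF z] by simp
    then have "((\<lambda>z. G (nrm2 z)) has_derivative (\<lambda>h. g * dnrm2 z h)) (at z)"
      by (intro has_derivative_compose[OF has_derivative_nrm2[OF z0], where g=G and g'="(*) g"])
         (simp add: has_field_derivative_def)
    from has_derivative_scaleR[OF this p] show ?thesis
      by (simp add: D_def[abs_def] nrm2_quadric[OF z] add.commute)
  next
    case True
    \<comment> \<open>\<open>nrm2\<close> is minimal here, so its derivative vanishes and continuity of \<open>G\<close> suffices.\<close>
    have 0: "dbar_nrm2 k z = 0"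
      using quadric_norm_1_real[OF z True] True by (simp add: dbar_nrm2_quadric[OF z])
    have "isCont (\<lambda>z. G (nrm2 z)) z"
    proof -
      let ?S = "{z. bil z z \<noteq> (0::complex)}"
      have "continuous (at z within ?S) (\<lambda>z. G (nrm2 z))"
      proof (rule continuous_within_compose2[where f=nrm2 and g=G])
        show "continuous (at z within ?S) nrm2"
          using has_derivative_continuous[OF has_derivative_nrm2[OF z0]] continuous_at_imp_continuous_at_within by blast
        show "continuous (at (nrm2 z) within nrm2 ` ?S) G"
          unfolding nrm2_quadric[OF z] True
          by (rule continuous_within_subset[OF cont]) (use nrm2_ge_1 in auto)
      qed
      then show ?thesis
        using at_within_open[OF _ open_bil_nonzero, of z] z0 by simp
    qed
    from has_derivative_scaleR_vanishing[OF this p 0] show ?thesis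
      by (simp add: D_def[abs_def] 0 nrm2_quadric[OF z])
  qed
  have Gf: "d_dzbar k ?f y = G (nrm2 y) *\<^sub>R dbar_nrm2 k y" if "bil y y \<noteq> 0" for y k
    using F that by (rule d_dzbar_stenzel_potential)
  have D: "(d_dzbar k ?f has_derivative D k) (at z)" for k
    by (rule has_derivative_transform_within_open[OF GD open_bil_nonzero]) (use z0 Gf in auto)
  have contr: "(\<Sum>j\<in>UNIV. \<Sum>k\<in>UNIV. d_dz j (d_dzbar k ?f) z * (u $ j * cnj (v $ k)))
      = G ?s * herm u v + g * herm u z * cnj (herm v z)"
    if u: "bil z u = 0" and v: "bil z v = 0" for u v
  proof -
    have v': "(\<Sum>k\<in>UNIV. cnj (z $ k) * cnj (v $ k)) = 0"
      using arg_cong[OF v, of cnj] by (simp add: bil_def)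
    \<comment> \<open>All multiples of \<open>cnj (z $ k)\<close> disappear here by the conjugated
      tangency of \<open>v\<close>, among them the unknown \<open>B h\<close>.\<close>
    have Dsum: "(\<Sum>k\<in>UNIV. D k h * cnj (v $ k)) =
       (g * (2 * Re (herm h z))) * herm z v + G ?s * (herm h v - ?s * cnj (bil h v))" if h: "bil z h = 0" for h
    proof -
      have d: "dnrm2 z h = 2 * Re (herm h z)"
        by (simp add: dnrm2_def h z1 Re_herm inner_commute)
      have "D k h * cnj (v $ k) = (g * (2 * Re (herm h z))) * (z $ k * cnj (v $ k))
         + G ?s * (h $ k * cnj (v $ k) - ?s * cnj (h $ k * v $ k))
         - (g * (2 * Re (herm h z)) * ?s + G ?s * B h) * (cnj (z $ k) * cnj (v $ k))" for k
        unfolding D_def d dbar_nrm2_quadric[OF z] P_def N[OF h] scaleR_conv_of_real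
        by (simp add: algebra_simps)
      then show ?thesis
        by (simp only: sum.distrib sum_subtractf sum_distrib_left[symmetric] v')
           (simp add: herm_def bil_def)
    qed
    have iu: "bil z (\<i> *s u) = 0" using u by (simp add: bil_scale_right)
    have bi: "bil (\<i> *s u) v = \<i> * bil u v"
      using bil_scale_right bil_commute by metis
    have "(\<Sum>j\<in>UNIV. \<Sum>k\<in>UNIV. d_dz j (d_dzbar k ?f) z * (u $ j * cnj (v $ k)))
       = (\<Sum>k\<in>UNIV. (\<Sum>j\<in>UNIV. d_dz j (d_dzbar k ?f) z * u $ j) * cnj (v $ k))"
      by (subst sum.swap) (simp add: sum_distrib_right mult.assoc)
    also have "\<dots> = (\<Sum>k\<in>UNIV. (D k u * cnj (v $ k) - \<i> * (D k (\<i> *s u) * cnj (v $ k))) / 2)"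
      unfolding sum_d_dz[OF D] by (simp add: algebra_simps diff_divide_distrib)
    also have "\<dots> = ((\<Sum>k\<in>UNIV. D k u * cnj (v $ k)) - \<i> * (\<Sum>k\<in>UNIV. D k (\<i> *s u) * cnj (v $ k))) / 2"
      by (simp add: sum_divide_distrib[symmetric] sum_subtractf sum_distrib_left)
    \<comment> \<open>The term with \<open>cnj (bil u v)\<close> is antilinear in \<open>u\<close>,
      so it cancels between \<open>u\<close> and \<open>\<i> *s u\<close>, while the linear terms
      double.\<close>
    also have "\<dots> = G ?s * herm u v + g * (of_real (Re (herm u z)) - \<i> * of_real (Re (\<i> * herm u z))) * herm z v"
      unfolding Dsum[OF u] Dsum[OF iu] herm_scale_left bi
      by (simp add: algebra_simps diff_divide_distrib add_divide_distrib)
    also have "of_real (Re (herm u z)) - \<i> * of_real (Re (\<i> * herm u z)) = herm u z"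
      by (simp add: complex_eq_iff)
    finally show ?thesis by (simp only: cnj_herm)
  qed
  have "stenzel_form U z u v = \<i> * ((G ?s * herm u v + g * herm u z * cnj (herm v z))
       - (G ?s * herm v u + g * herm v z * cnj (herm u z)))"
    unfolding stenzel_form_def i_del_delbar_quadric_def i_del_delbar_def
      contr[OF u v, symmetric] contr[OF v u, symmetric]
    by (simp add: sum_subtractf right_diff_distrib)
  also have "herm v u = cnj (herm u v)" by (simp add: cnj_herm)
  finally show ?thesis
    by (simp add: complex_eq_iff algebra_simps)
qed

text \<open>The interface to the geometry. The coefficient \<open>g\<close> is existential because
  \<open>U''\<close> is controlled for w > 0 only; its value is fixed off the zero section.\<close>

lemma stenzel_formE:
  assumes "stenzel_potential n c U" "n > 0"
  obtains U' U'' G :: "real \<Rightarrow> real" where "c > 0"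
    "\<And>w. w > 0 \<Longrightarrow> (U' has_real_derivative U'' w) (at w)"
    "\<And>w. w > 0 \<Longrightarrow> ((\<lambda>s. U' s ^ n) has_real_derivative c * real n * sinh w ^ (n - 1)) (at w)"
    "\<And>w. w > 0 \<Longrightarrow> G (cosh w) = U' w / sinh w"
    "\<And>(z::complex^'d) u v. z \<in> quadric \<Longrightarrow> bil z u = 0 \<Longrightarrow> bil z v = 0 \<Longrightarrow>
       \<exists>g. stenzel_form U z u v =
          of_real (- 2 * (G ((norm z)\<^sup>2) * Im (herm u v) + g * Im (herm u z * cnj (herm v z)))) \<and>
        (\<forall>w>0. (norm z)\<^sup>2 = cosh w \<longrightarrow> g = (U'' w * sinh w - U' w * cosh w) / sinh w ^ 3)"
proof -
  show ?thesis
  proof (rule stenzel_potentialE[OF assms])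
    fix U' U''
    assume U: "\<And>w. w \<ge> 0 \<Longrightarrow> (U has_real_derivative U' w) (at w within {0..})"
      and U': "\<And>w. w > 0 \<Longrightarrow> (U' has_real_derivative U'' w) (at w)"
      and P: "\<And>w. w > 0 \<Longrightarrow> ((\<lambda>s. U' s ^ n) has_real_derivative c * real n * sinh w ^ (n - 1)) (at w)"
      and lim: "((\<lambda>w. U' w / w) \<longlongrightarrow> root n c) (at_right 0)"
    show ?thesis
    proof (rule radial_profileE[OF U U' lim])
      fix G
      assume F: "\<And>s. s \<ge> 1 \<Longrightarrow> ((\<lambda>s. U (arcosh s)) has_real_derivative G s) (at s within {1..})"
        and cont: "continuous (at 1 within {1..}) G"
        and Gc: "\<And>w. w > 0 \<Longrightarrow> G (cosh w) = U' w / sinh w"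
        and Gd: "\<And>w. w > 0 \<Longrightarrow> (G has_real_derivative (U'' w * sinh w - U' w * cosh w) / sinh w ^ 3) (at (cosh w))"
      show ?thesis
      proof (rule that[of U' U'' G])
        show "c > 0" using assms unfolding stenzel_potential_def by simp
        fix z u v :: "complex^'d" assume z: "z \<in> quadric" and u: "bil z u = 0" and v: "bil z v = 0"
        define w where "w = arcosh ((norm z)\<^sup>2)"
        define g where "g = (U'' w * sinh w - U' w * cosh w) / sinh w ^ 3"
        have "(G has_real_derivative g) (at ((norm z)\<^sup>2))" if "(norm z)\<^sup>2 > 1"
          using Gd[of w] that by (simp add: w_def g_def)
        then have "stenzel_form U z u v =
              of_real (- 2 * (G ((norm z)\<^sup>2) * Im (herm u v) + g * Im (herm u z * cnj (herm v z))))"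
          using F cont z u v by (intro stenzel_form_quadric) auto
        moreover have "g = (U'' w' * sinh w' - U' w' * cosh w') / sinh w' ^ 3" if "w' > 0" "(norm z)\<^sup>2 = cosh w'" for w'
          using that by (simp add: g_def w_def arcosh_cosh_real)
        ultimately show "\<exists>g. stenzel_form U z u v =
              of_real (- 2 * (G ((norm z)\<^sup>2) * Im (herm u v) + g * Im (herm u z * cnj (herm v z)))) \<and>
            (\<forall>w>0. (norm z)\<^sup>2 = cosh w \<longrightarrow> g = (U'' w * sinh w - U' w * cosh w) / sinh w ^ 3)"
          by blast
      qed (use U' P Gc in auto)
    qed
  qed
qed

subsection \<open>Differential calculus on Euclidean charts\<close>

lemma has_vector_derivative_zeroI:
  fixes R :: "real \<Rightarrow> 'a::real_normed_vector"
  assumes "R 0 = 0" and le: "\<And>e. e > 0 \<Longrightarrow> \<forall>\<^sub>F t in at 0. norm (R t) \<le> e * \<bar>t\<bar>"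
  shows "(R has_vector_derivative 0) (at 0)"
proof -
  have "((\<lambda>t. norm (R t) / \<bar>t\<bar>) \<longlongrightarrow> 0) (at 0)"
  proof (rule tendstoI)
    fix e :: real assume "e > 0"
    then have "\<forall>\<^sub>F t in at 0. norm (R t) \<le> e / 2 * \<bar>t\<bar>" using le[of "e/2"] by simp
    then show "\<forall>\<^sub>F t in at 0. dist (norm (R t) / \<bar>t\<bar>) 0 < e"
    proof (rule eventually_mono[OF eventually_conj[OF eventually_neq_at_within[of 0]]])
      fix t :: real assume "t \<noteq> 0 \<and> norm (R t) \<le> e / 2 * \<bar>t\<bar>"
      moreover from this \<open>e > 0\<close> have "e / 2 * \<bar>t\<bar> < e * \<bar>t\<bar>" by simp
      ultimately show "dist (norm (R t) / \<bar>t\<bar>) 0 < e" by (simp add: divide_less_eq)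
    qed
  qed
  then show ?thesis
    using \<open>R 0 = 0\<close> by (simp add: has_vector_derivative_def has_derivative_iff_norm)
qed

lemma has_vector_derivative_zeroD:
  fixes R :: "real \<Rightarrow> 'a::real_normed_vector"
  assumes "(R has_vector_derivative 0) (at 0)" "R 0 = 0" "e > 0"
  shows "\<forall>\<^sub>F t in at 0. norm (R t) \<le> e * \<bar>t\<bar>"
proof -
  have "((\<lambda>t. norm (R t) / \<bar>t\<bar>) \<longlongrightarrow> 0) (at 0)"
    using assms by (simp add: has_vector_derivative_def has_derivative_iff_norm)
  from tendstoD[OF this \<open>e > 0\<close>] have "\<forall>\<^sub>F t in at 0. norm (R t) / \<bar>t\<bar> < e" by simp
  then show ?thesis
    by (rule eventually_mono[OF eventually_conj[OF eventually_neq_at_within[of 0]]])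
       (auto simp: divide_less_eq intro: less_imp_le)
qed

lemma has_vector_derivative_transform_ev:
  assumes "(f has_vector_derivative D) (at a)" "\<forall>\<^sub>F t in at a. f t = g t" "f a = g a"
  shows "(g has_vector_derivative D) (at a)"
  using has_derivative_transform_eventually[of f _ a UNIV g] assms
  unfolding has_vector_derivative_def by simp

text \<open>Subtracting \<open>t *\<^sub>R w\<close> first turns a bound on the deviation of the
  derivative from \<open>w\<close> into one on the deviation of the increment.\<close>

lemma vector_mean_value_bound:
  fixes \<phi> :: "real \<Rightarrow> 'a::real_normed_vector"
  assumes d: "\<And>t. t \<in> closed_segment a b \<Longrightarrow> (\<phi> has_vector_derivative \<phi>' t) (at t)"
    and le: "\<And>t. t \<in> closed_segment a b \<Longrightarrow> norm (\<phi>' t - w) \<le> e"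
  shows "norm (\<phi> b - \<phi> a - (b - a) *\<^sub>R w) \<le> e * \<bar>b - a\<bar>"
proof -
  have "norm ((\<phi> b - b *\<^sub>R w) - (\<phi> a - a *\<^sub>R w)) \<le> e * norm (b - a)"
  proof (rule differentiable_bound[where S="closed_segment a b" and f'="\<lambda>t h. h *\<^sub>R (\<phi>' t - w)"])
    fix t assume t: "t \<in> closed_segment a b"
    have "((\<lambda>t. \<phi> t - t *\<^sub>R w) has_vector_derivative \<phi>' t - w) (at t)"
      using d[OF t] by (auto intro!: derivative_eq_intros)
    then show "((\<lambda>t. \<phi> t - t *\<^sub>R w) has_derivative (\<lambda>h. h *\<^sub>R (\<phi>' t - w))) (at t within closed_segment a b)"
      unfolding has_vector_derivative_def by (rule has_derivative_at_withinI)
    show "onorm (\<lambda>h. h *\<^sub>R (\<phi>' t - w)) \<le> e"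
      by (rule onorm_le) (use mult_right_mono[OF le[OF t] abs_ge_zero] in \<open>simp add: mult.commute\<close>)
  qed auto
  then show ?thesis by (simp add: algebra_simps)
qed

text \<open>Chart images are open in the space of sequences that vanish from index \<open>q\<close>
  on. There finitely many inequalities describe a neighbourhood, although the ambient function space
  is infinite dimensional.\<close>

definition qbox :: "nat \<Rightarrow> (nat \<Rightarrow> real) \<Rightarrow> real \<Rightarrow> (nat \<Rightarrow> real) set" where
  "qbox q a d = {b. (\<forall>i\<ge>q. b i = 0) \<and> (\<forall>i<q. \<bar>b i - a i\<bar> < d)}"

lemma qbox_mono: "d \<le> d' \<Longrightarrow> qbox q a d \<subseteq> qbox q a d'"
  by (fastforce simp: qbox_def)

lemma open_contains_qbox:
  assumes "open W" "a \<in> W" "\<forall>i\<ge>q. a i = 0"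
  obtains d where "d > 0" "qbox q a d \<subseteq> W"
proof -
  from assms(1) have "openin (product_topology (\<lambda>i::nat. euclidean::real topology) UNIV) W"
    by (simp add: open_fun_def)
  from product_topology_open_contains_basis[OF this assms(2)] obtain X
    where X: "\<And>i. a i \<in> X i" "\<And>i. open (X i)" "(\<Pi>\<^sub>E i\<in>UNIV. X i) \<subseteq> W" by auto
  have "\<forall>i. \<exists>d>0. ball (a i) d \<subseteq> X i" using X open_contains_ball by blast
  then obtain D where D: "\<And>i. D i > 0" "\<And>i. ball (a i) (D i) \<subseteq> X i" by metis
  \<comment> \<open>The entry 1 keeps the set nonempty when q = 0.\<close>
  define d where "d = Min (insert 1 (D ` {..<q}))"
  have "d > 0" unfolding d_def using D(1) by (subst Min_gr_iff) auto
  moreover have "d \<le> D i" if "i < q" for i unfolding d_def using that by (intro Min_le) auto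
  moreover have "qbox q a d \<subseteq> W"
    if "\<And>i. i < q \<Longrightarrow> d \<le> D i"
  proof
    fix b assume b: "b \<in> qbox q a d"
    have "b i \<in> X i" for i
    proof (cases "i < q")
      case True
      then have "b i \<in> ball (a i) (D i)"
        using b that[OF True] by (auto simp: qbox_def dist_real_def)
      then show ?thesis using D(2) by blast
    next
      case False
      then show ?thesis using b X(1)[of i] assms(3) by (simp add: qbox_def)
    qed
    then show "b \<in> W" using X(3) by auto
  qed
  ultimately show ?thesis using that by simp
qed

lemma openin_Euclidean_space_iff:
  "openin (Euclidean_space q) V \<longleftrightarrow> (\<exists>W. open W \<and> V = W \<inter> {x. \<forall>i\<ge>q. x i = 0})"
  unfolding Euclidean_space_def
  by (subst euclidean_product_topology, subst openin_subtopology, subst open_openin) (rule refl)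

lemma openin_Euclidean_spaceD:
  "openin (Euclidean_space q) V \<Longrightarrow> a \<in> V \<Longrightarrow> i \<ge> q \<Longrightarrow> a i = 0"
  using openin_subset[of "Euclidean_space q" V] unfolding topspace_Euclidean_space by blast

lemma openin_contains_qbox:
  assumes "openin (Euclidean_space q) V" "a \<in> V"
  obtains d where "d > 0" "qbox q a d \<subseteq> V"
proof -
  obtain W where W: "open W" "V = W \<inter> {x. \<forall>i\<ge>q. x i = 0}"
    using assms(1) openin_Euclidean_space_iff by blast
  with assms(2) open_contains_qbox[of W a q] obtain d where "d > 0" "qbox q a d \<subseteq> W" by blast
  then show ?thesis using that W by (auto simp: qbox_def)
qed

lemma continuous_on_qbox:
  assumes "openin (Euclidean_space q) V" "a \<in> V" "continuous_on V f" "(e::real) > 0"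
  obtains d where "d > 0" "qbox q a d \<subseteq> V" "\<And>b. b \<in> qbox q a d \<Longrightarrow> dist (f b) (f a) < e"
proof -
  have "openin (top_of_set V) (V \<inter> f -` ball (f a) e)"
    by (rule continuous_openin_preimage_gen[OF assms(3)]) simp
  then obtain W where W: "open W" "V \<inter> f -` ball (f a) e = V \<inter> W" by (auto simp: openin_open)
  have "openin (Euclidean_space q) (V \<inter> W)"
  proof -
    obtain W' where "open W'" "V = W' \<inter> {x. \<forall>i\<ge>q. x i = 0}"
      using assms(1) openin_Euclidean_space_iff by blast
    then show ?thesis unfolding openin_Euclidean_space_iff using W(1)
      by (intro exI[of _ "W' \<inter> W"]) auto
  qed
  moreover have "a \<in> V \<inter> W" using assms(2,4) W(2) by auto
  ultimately obtain d where "d > 0" "qbox q a d \<subseteq> V \<inter> W" using openin_contains_qbox by blast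
  moreover from this W(2) have "dist (f b) (f a) < e" if "b \<in> qbox q a d" for b
    using that by (auto simp: dist_commute)
  ultimately show ?thesis using that by blast
qed

section \<open>Smooth functions on chart images: chain rule and symmetry of second
  derivatives\<close>

lemma smooth_on_continuous: "smooth_on q V f \<Longrightarrow> continuous_on V f"
  unfolding smooth_on_def by (drule spec[of _ 0]) simp

lemma smooth_on_pderiv:
  assumes "smooth_on q V f" "i < q"
  shows "smooth_on q V (pderiv_at i f)"
  unfolding smooth_on_def
proof
  fix k
  have "Ck_on q (Suc k) V f" using assms(1) unfolding smooth_on_def ..
  then show "Ck_on q k V (pderiv_at i f)" using assms(2) by simp
qed

lemma smooth_on_has_pderiv:
  assumes "smooth_on q V f" "i < q" "a \<in> V"
  shows "((\<lambda>t. f (a(i := t))) has_vector_derivative pderiv_at i f a) (at (a i))"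
proof -
  have "Ck_on q (Suc 0) V f" using assms(1) unfolding smooth_on_def by blast
  then have "(\<lambda>t. f (a(i := t))) differentiable (at (a i))" using assms by simp
  then show ?thesis by (simp add: pderiv_at_def vector_derivative_works)
qed

text \<open>Telescope along the coordinates and apply the mean value inequality in each of them.\<close>

lemma smooth_on_linear_approx:
  assumes V: "openin (Euclidean_space q) V" and f: "smooth_on q V f" and a: "a \<in> V" and e: "e > 0"
  obtains d where "d > 0" "qbox q a d \<subseteq> V"
    "\<And>b. b \<in> qbox q a d \<Longrightarrow>
       norm (f b - f a - (\<Sum>i<q. (b i - a i) *\<^sub>R pderiv_at i f a)) \<le> e * (\<Sum>i<q. \<bar>b i - a i\<bar>)"
proof -
  have "\<exists>d>0. \<forall>b\<in>qbox q a d. dist (pderiv_at i f b) (pderiv_at i f a) < e" if "i < q" for i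
    using continuous_on_qbox[OF V a smooth_on_continuous[OF smooth_on_pderiv[OF f that]] e] by metis
  then obtain D where D: "\<And>i. i < q \<Longrightarrow> D i > 0"
     "\<And>i b. i < q \<Longrightarrow> b \<in> qbox q a (D i) \<Longrightarrow> dist (pderiv_at i f b) (pderiv_at i f a) < e"
    by metis
  obtain d0 where d0: "d0 > 0" "qbox q a d0 \<subseteq> V" using openin_contains_qbox[OF V a] by blast
  define d where "d = Min (insert d0 (D ` {..<q}))"
  have dpos: "d > 0" unfolding d_def using D(1) d0(1) by (subst Min_gr_iff) auto
  have dD: "d \<le> D i" if "i < q" for i unfolding d_def using that by (intro Min_le) auto
  have "d \<le> d0" unfolding d_def by (intro Min_le) auto
  then have sub: "qbox q a d \<subseteq> V" using qbox_mono d0(2) by blast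
  have near: "norm (pderiv_at i f b - pderiv_at i f a) \<le> e" if "i < q" "b \<in> qbox q a d" for i b
    using D(2)[OF that(1), of b] qbox_mono[OF dD[OF that(1)]] that(2) by (auto simp: dist_norm less_imp_le subset_iff)
  show ?thesis
  proof (rule that[OF dpos sub])
    fix b assume b: "b \<in> qbox q a d"
    define B where "B j = (\<lambda>i. if i < j then b i else a i)" for j
    have a0: "a i = 0" if "i \<ge> q" for i using openin_Euclidean_spaceD[OF V a that] .
    have step: "norm (f (B (Suc j)) - f (B j) - (b j - a j) *\<^sub>R pderiv_at j f a) \<le> e * \<bar>b j - a j\<bar>" if j: "j < q" for j
    proof -
      have inb: "(B j)(j := t) \<in> qbox q a d" if t: "t \<in> closed_segment (a j) (b j)" for t
      proof -
        have "\<bar>t - a j\<bar> \<le> \<bar>b j - a j\<bar>" using t by (auto simp: closed_segment_eq_real_ivl split: if_splits)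
        also have "\<dots> < d" using b j by (simp add: qbox_def)
        finally show ?thesis using b a0 j dpos by (auto simp: qbox_def B_def)
      qed
      have "norm (f ((B j)(j := b j)) - f ((B j)(j := a j)) - (b j - a j) *\<^sub>R pderiv_at j f a) \<le> e * \<bar>b j - a j\<bar>"
      proof (rule vector_mean_value_bound[where \<phi>="\<lambda>t. f ((B j)(j := t))" and \<phi>'="\<lambda>t. pderiv_at j f ((B j)(j := t))"])
        fix t assume t: "t \<in> closed_segment (a j) (b j)"
        show "((\<lambda>t. f ((B j)(j := t))) has_vector_derivative pderiv_at j f ((B j)(j := t))) (at t)"
          using smooth_on_has_pderiv[OF f j, of "(B j)(j := t)"] inb[OF t] sub by auto
        show "norm (pderiv_at j f ((B j)(j := t)) - pderiv_at j f a) \<le> e"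
          by (rule near[OF j inb[OF t]])
      qed
      moreover have "(B j)(j := b j) = B (Suc j)" "(B j)(j := a j) = B j" by (auto simp: B_def)
      ultimately show ?thesis by simp
    qed
    have "B q = b" "B 0 = a" using b a0 by (auto simp: B_def qbox_def)
    then have "f b - f a = (\<Sum>j<q. f (B (Suc j)) - f (B j))"
      using sum_lessThan_telescope[of "\<lambda>j. f (B j)" q] by simp
    then have "norm (f b - f a - (\<Sum>i<q. (b i - a i) *\<^sub>R pderiv_at i f a))
       = norm (\<Sum>j<q. f (B (Suc j)) - f (B j) - (b j - a j) *\<^sub>R pderiv_at j f a)"
      by (simp add: sum_subtractf)
    also have "\<dots> \<le> (\<Sum>j<q. e * \<bar>b j - a j\<bar>)"
      by (rule sum_norm_le) (use step in auto)
    finally show "norm (f b - f a - (\<Sum>i<q. (b i - a i) *\<^sub>R pderiv_at i f a)) \<le> e * (\<Sum>i<q. \<bar>b i - a i\<bar>)"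
      by (simp add: sum_distrib_left)
  qed
qed

lemma eventually_in_qbox:
  assumes "\<forall>\<^sub>F t in at 0. \<forall>i\<ge>q. \<gamma> t i = 0"
    and "\<And>i. i < q \<Longrightarrow> ((\<lambda>t. \<gamma> t i) \<longlongrightarrow> a i) (at (0::real))" and "d > 0"
  shows "\<forall>\<^sub>F t in at 0. \<gamma> t \<in> qbox q a d"
proof -
  have "\<forall>\<^sub>F t in at 0. \<bar>\<gamma> t i - a i\<bar> < d" if "i < q" for i
    using tendstoD[OF assms(2)[OF that] \<open>d > 0\<close>] by (simp add: dist_real_def)
  then have "\<forall>\<^sub>F t in at 0. \<forall>i\<in>{..<q}. \<bar>\<gamma> t i - a i\<bar> < d"
    by (intro eventually_ball_finite) auto
  with assms(1) show ?thesis
    by eventually_elim (auto simp: qbox_def)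
qed

text \<open>Smoothness is given by partial derivatives on a subset of a function space, so the chain
  rule is derived from the linear approximation. The difference quotients of \<gamma> are eventually
  bounded by \<open>K\<close>, which turns an error of order o(|\<gamma>(t) - \<gamma>(0)|) into
  o(t). The curve must stay in the model space, since \<open>f\<close> is controlled only
  there.\<close>

lemma smooth_on_chain_rule:
  assumes V: "openin (Euclidean_space q) V" and f: "smooth_on q V f" and a: "\<gamma> 0 \<in> V"
    and top: "\<forall>\<^sub>F t in at (0::real). \<forall>i\<ge>q. \<gamma> t i = 0"
    and \<gamma>: "\<And>i. i < q \<Longrightarrow> ((\<lambda>t. \<gamma> t i) has_real_derivative c i) (at 0)"
  shows "((\<lambda>t. f (\<gamma> t)) has_vector_derivative (\<Sum>i<q. c i *\<^sub>R pderiv_at i f (\<gamma> 0))) (at 0)"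
proof -
  let ?a = "\<gamma> 0"
  define L where "L t = (\<Sum>i<q. (\<gamma> t i - ?a i) *\<^sub>R pderiv_at i f ?a)" for t
  define R where "R t = f (\<gamma> t) - f ?a - L t" for t
  have L: "(L has_vector_derivative (\<Sum>i<q. c i *\<^sub>R pderiv_at i f ?a)) (at 0)"
    unfolding L_def
    by (rule has_vector_derivative_sum) (auto intro!: derivative_eq_intros \<gamma>)
  define M where "M t = (\<Sum>i<q. \<bar>(\<gamma> t i - ?a i) / t\<bar>)" for t
  have "(M \<longlongrightarrow> (\<Sum>i<q. \<bar>c i\<bar>)) (at 0)"
    unfolding M_def using \<gamma> by (intro tendsto_intros) (auto simp: has_field_derivative_iff)
  moreover define K where "K = (\<Sum>i<q. \<bar>c i\<bar>) + 1"
  ultimately have MK: "\<forall>\<^sub>F t in at 0. M t < K" by (intro order_tendstoD) auto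
  have K: "K > 0" unfolding K_def by (simp add: add_nonneg_pos sum_nonneg)
  have "(R has_vector_derivative 0) (at 0)"
  proof (rule has_vector_derivative_zeroI)
    show "R 0 = 0" by (simp add: R_def L_def)
    fix e :: real assume "e > 0"
    with K have "e / K > 0" by simp
    from smooth_on_linear_approx[OF V f a this] obtain d where d: "d > 0" "qbox q ?a d \<subseteq> V"
      and le: "\<And>b. b \<in> qbox q ?a d \<Longrightarrow>
       norm (f b - f ?a - (\<Sum>i<q. (b i - ?a i) *\<^sub>R pderiv_at i f ?a)) \<le> e / K * (\<Sum>i<q. \<bar>b i - ?a i\<bar>)" by blast
    have "((\<lambda>t. \<gamma> t i) \<longlongrightarrow> ?a i) (at 0)" if "i < q" for i
      using DERIV_isCont[OF \<gamma>[OF that]] by (simp add: isCont_def)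
    from eventually_in_qbox[OF top this d(1)]
    have "\<forall>\<^sub>F t in at 0. \<gamma> t \<in> qbox q ?a d" by simp
    with MK eventually_neq_at_within[of 0 0 UNIV] show "\<forall>\<^sub>F t in at 0. norm (R t) \<le> e * \<bar>t\<bar>"
    proof eventually_elim
      case (elim t)
      have "norm (R t) \<le> e / K * (\<Sum>i<q. \<bar>\<gamma> t i - ?a i\<bar>)"
        using le[OF elim(3)] by (simp add: R_def L_def)
      also have "(\<Sum>i<q. \<bar>\<gamma> t i - ?a i\<bar>) = M t * \<bar>t\<bar>"
        using elim(2) by (simp add: M_def sum_distrib_right)
      also have "e / K * (M t * \<bar>t\<bar>) \<le> e / K * (K * \<bar>t\<bar>)"
        using elim(1) \<open>e / K > 0\<close> by (intro mult_left_mono mult_right_mono) auto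
      finally show ?case using K by simp
    qed
  qed
  from has_vector_derivative_add[OF has_vector_derivative_add[OF this L] has_vector_derivative_const[of "f ?a"]]
  show ?thesis by (simp add: R_def)
qed

text \<open>The mean value inequality in direction \<open>i\<close> is applied to the difference of
  \<open>f\<close> along two parallel segments; the derivative of this difference is replaced by the
  linear approximation of \<open>pderiv_at i f\<close> at \<open>a\<close>. The two points lie at
  summed coordinate distances at most 2h and h from \<open>a\<close>, whence the factor 3.\<close>

lemma smooth_on_second_difference:
  assumes V: "openin (Euclidean_space q) V" and f: "smooth_on q V f" and a: "a \<in> V" and e: "e > 0"
    and i: "i < q" and j: "j < q" and ij: "i \<noteq> j"
  obtains d where "d > 0" "\<And>h. 0 < h \<Longrightarrow> h < d \<Longrightarrow>
     norm (f (a(i := a i + h, j := a j + h)) - f (a(i := a i + h)) - f (a(j := a j + h)) + f a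
       - (h * h) *\<^sub>R pderiv_at j (pderiv_at i f) a) \<le> 3 * e * (h * h)"
proof -
  let ?g = "pderiv_at i f"
  from smooth_on_linear_approx[OF V smooth_on_pderiv[OF f i] a e] obtain d where d: "d > 0" and sub: "qbox q a d \<subseteq> V"
    and le: "\<And>b. b \<in> qbox q a d \<Longrightarrow>
       norm (?g b - ?g a - (\<Sum>k<q. (b k - a k) *\<^sub>R pderiv_at k ?g a)) \<le> e * (\<Sum>k<q. \<bar>b k - a k\<bar>)" by blast
  have a0: "a k = 0" if "k \<ge> q" for k using openin_Euclidean_spaceD[OF V a that] .
  show ?thesis
  proof (rule that[OF d])
    fix h :: real assume h: "0 < h" "h < d"
    define b1 where "b1 t = a(i := t, j := a j + h)" for t
    define b2 where "b2 t = a(i := t)" for t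
    have in1: "b1 t \<in> qbox q a d" "b2 t \<in> qbox q a d" and th: "\<bar>t - a i\<bar> \<le> h"
      if t: "t \<in> closed_segment (a i) (a i + h)" for t
    proof -
      show th: "\<bar>t - a i\<bar> \<le> h" using t h by (auto simp: closed_segment_eq_real_ivl split: if_splits)
      show "b1 t \<in> qbox q a d" "b2 t \<in> qbox q a d"
        using th h i j a0 by (auto simp: qbox_def b1_def b2_def)
    qed
    have "norm ((f (b1 (a i + h)) - f (b2 (a i + h))) - (f (b1 (a i)) - f (b2 (a i)))
         - ((a i + h) - a i) *\<^sub>R (h *\<^sub>R pderiv_at j ?g a)) \<le> (3 * e * h) * \<bar>(a i + h) - a i\<bar>"
    proof (rule vector_mean_value_bound[where \<phi>="\<lambda>t. f (b1 t) - f (b2 t)" and \<phi>'="\<lambda>t. ?g (b1 t) - ?g (b2 t)"])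
      fix t assume t: "t \<in> closed_segment (a i) (a i + h)"
      have "((\<lambda>s. f (b1 s)) has_vector_derivative ?g (b1 t)) (at t)"
        using smooth_on_has_pderiv[OF f i, of "b1 t"] in1(1)[OF t] sub ij
        by (auto simp: b1_def fun_upd_twist)
      moreover have "((\<lambda>s. f (b2 s)) has_vector_derivative ?g (b2 t)) (at t)"
        using smooth_on_has_pderiv[OF f i, of "b2 t"] in1(2)[OF t] sub by (auto simp: b2_def)
      ultimately show "((\<lambda>t. f (b1 t) - f (b2 t)) has_vector_derivative ?g (b1 t) - ?g (b2 t)) (at t)"
        by (rule has_vector_derivative_diff)
      let ?L = "\<lambda>b. \<Sum>k<q. (b k - a k) *\<^sub>R pderiv_at k ?g a"
      have L: "?L (b1 t) - ?L (b2 t) = h *\<^sub>R pderiv_at j ?g a"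
      proof -
        have "?L (b1 t) - ?L (b2 t) = (\<Sum>k<q. if k = j then h *\<^sub>R pderiv_at j ?g a else 0)"
          unfolding sum_subtractf[symmetric] using ij
          by (intro sum.cong) (auto simp: b1_def b2_def algebra_simps)
        then show ?thesis using j by simp
      qed
      have s1: "(\<Sum>k<q. \<bar>b1 t k - a k\<bar>) = \<bar>t - a i\<bar> + h"
      proof -
        have "(\<Sum>k<q. \<bar>b1 t k - a k\<bar>) = (\<Sum>k<q. (if k = i then \<bar>t - a i\<bar> else 0) + (if k = j then h else 0))"
          using ij h by (intro sum.cong) (auto simp: b1_def)
        then show ?thesis using i j by (simp add: sum.distrib)
      qed
      have s2: "(\<Sum>k<q. \<bar>b2 t k - a k\<bar>) = \<bar>t - a i\<bar>"
      proof -
        have "(\<Sum>k<q. \<bar>b2 t k - a k\<bar>) = (\<Sum>k<q. if k = i then \<bar>t - a i\<bar> else 0)"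
          by (intro sum.cong) (auto simp: b2_def)
        then show ?thesis using i by simp
      qed
      have "?g (b1 t) - ?g (b2 t) - h *\<^sub>R pderiv_at j ?g a
          = (?g (b1 t) - ?g a - ?L (b1 t)) - (?g (b2 t) - ?g a - ?L (b2 t))"
        unfolding L[symmetric] by simp
      then have "norm (?g (b1 t) - ?g (b2 t) - h *\<^sub>R pderiv_at j ?g a)
          \<le> norm (?g (b1 t) - ?g a - ?L (b1 t)) + norm (?g (b2 t) - ?g a - ?L (b2 t))"
        by (simp only: norm_triangle_ineq4)
      also have "\<dots> \<le> e * (\<bar>t - a i\<bar> + h) + e * \<bar>t - a i\<bar>"
        using le[OF in1(1)[OF t]] le[OF in1(2)[OF t]] unfolding s1 s2 by (rule add_mono)
      also have "\<dots> \<le> e * (h + h) + e * h"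
        using th[OF t] e by (intro add_mono mult_left_mono) auto
      finally show "norm (?g (b1 t) - ?g (b2 t) - h *\<^sub>R pderiv_at j ?g a) \<le> 3 * e * h"
        by (simp add: algebra_simps)
    qed
    moreover have "b1 (a i) = a(j := a j + h)" "b2 (a i) = a" by (auto simp: b1_def b2_def)
    ultimately show "norm (f (a(i := a i + h, j := a j + h)) - f (a(i := a i + h)) - f (a(j := a j + h)) + f a
       - (h * h) *\<^sub>R pderiv_at j (pderiv_at i f) a) \<le> 3 * e * (h * h)"
      unfolding b1_def[of "a i + h"] b2_def[of "a i + h"] using h by (simp add: algebra_simps)
  qed
qed

text \<open>The second difference is symmetric in \<open>i\<close> and \<open>j\<close>, and after
  division by h^2 it is close to either mixed derivative. The choice e / 6 makes each of the two
  errors e / 2.\<close>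

lemma smooth_on_pderiv_commute:
  assumes V: "openin (Euclidean_space q) V" and f: "smooth_on q V f" and a: "a \<in> V"
    and i: "i < q" and j: "j < q"
  shows "pderiv_at i (pderiv_at j f) a = pderiv_at j (pderiv_at i f) a"
proof (cases "i = j")
  case False
  let ?x = "pderiv_at j (pderiv_at i f) a" and ?y = "pderiv_at i (pderiv_at j f) a"
  have "norm (?x - ?y) \<le> e" if e: "e > 0" for e
  proof -
    have e6: "e / 6 > 0" using e by simp
    obtain d1 where d1: "d1 > 0" "\<And>h. 0 < h \<Longrightarrow> h < d1 \<Longrightarrow>
     norm (f (a(i := a i + h, j := a j + h)) - f (a(i := a i + h)) - f (a(j := a j + h)) + f a
       - (h * h) *\<^sub>R ?x) \<le> 3 * (e / 6) * (h * h)"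
      using smooth_on_second_difference[OF V f a e6 i j False] by metis
    obtain d2 where d2: "d2 > 0" "\<And>h. 0 < h \<Longrightarrow> h < d2 \<Longrightarrow>
     norm (f (a(j := a j + h, i := a i + h)) - f (a(j := a j + h)) - f (a(i := a i + h)) + f a
       - (h * h) *\<^sub>R ?y) \<le> 3 * (e / 6) * (h * h)"
      using smooth_on_second_difference[OF V f a e6 j i False[symmetric]] by metis
    define h where "h = min d1 d2 / 2"
    have h: "0 < h" "h < d1" "h < d2" using d1(1) d2(1) by (auto simp: h_def)
    let ?D = "f (a(i := a i + h, j := a j + h)) - f (a(i := a i + h)) - f (a(j := a j + h)) + f a"
    have 1: "norm (?D - (h * h) *\<^sub>R ?x) \<le> e / 2 * (h * h)" using d1(2)[OF h(1,2)] by simp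
    have D: "f (a(j := a j + h, i := a i + h)) - f (a(j := a j + h)) - f (a(i := a i + h)) + f a = ?D"
      using False by (simp add: fun_upd_twist)
    have 2: "norm (?D - (h * h) *\<^sub>R ?y) \<le> e / 2 * (h * h)" using d2(2)[OF h(1,3)] unfolding D by simp
    have "(h * h) * norm (?x - ?y) = norm ((?D - (h * h) *\<^sub>R ?y) - (?D - (h * h) *\<^sub>R ?x))"
      by (simp flip: scaleR_diff_right)
    also have "\<dots> \<le> e / 2 * (h * h) + e / 2 * (h * h)"
      using norm_triangle_ineq4 1 2 by (meson add_mono order_trans)
    finally have "(h * h) * norm (?x - ?y) \<le> (h * h) * e" by (simp add: algebra_simps)
    then show ?thesis using h(1) by simp
  qed
  then have "norm (?x - ?y) \<le> 0" by (rule field_le_epsilon) simp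
  then show ?thesis by (metis norm_le_zero_iff right_minus_eq)
qed simp

subsection \<open>Moving frames\<close>

text \<open>The coefficients are indexed by {..<q} and not by the image set, so coinciding values of
  \<open>f\<close> cause no trouble.\<close>

lemma span_image_sumE:
  fixes f :: "nat \<Rightarrow> 'a::real_vector"
  assumes "m \<in> span (f ` {..<q})"
  obtains c where "m = (\<Sum>i<q. c i *\<^sub>R f i)"
proof -
  have "\<exists>c. m = (\<Sum>i<q. c i *\<^sub>R f i)"
    using assms
  proof (induction rule: span_induct_alt)
    case base
    show ?case by (intro exI[of _ "\<lambda>_. 0"]) simp
  next
    case (step r x y)
    then obtain k c where k: "k < q" "x = f k" "y = (\<Sum>i<q. c i *\<^sub>R f i)" by auto
    have "r *\<^sub>R x + y = (\<Sum>i<q. (c i + (if i = k then r else 0)) *\<^sub>R f i)"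
    proof -
      have "(\<Sum>i<q. (c i + (if i = k then r else 0)) *\<^sub>R f i) = (\<Sum>i<q. c i *\<^sub>R f i + (if i = k then r *\<^sub>R f k else 0))"
        by (intro sum.cong) (auto simp: algebra_simps)
      then show ?thesis using k by (simp add: sum.distrib)
    qed
    then show ?case by (rule exI[where P="\<lambda>c. _ = (\<Sum>i<q. c i *\<^sub>R f i)"])
  qed
  then show ?thesis using that by blast
qed

lemma sum_in_span: "(\<Sum>i<q. c i *\<^sub>R f i) \<in> span (f ` {..<q::nat})"
  by (intro span_sum span_scale span_base) auto

text \<open>\<open>d i\<close> is the component of \<open>e i\<close> orthogonal to the span of the
  other vectors, rescaled; independence makes this component nonzero.\<close>

lemma dual_familyE:
  fixes e :: "nat \<Rightarrow> 'a::euclidean_space"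
  assumes ind: "\<forall>c. (\<Sum>i<q. c i *\<^sub>R e i) = 0 \<longrightarrow> (\<forall>i<q. c i = 0)"
  obtains d where "\<And>i. i < q \<Longrightarrow> d i \<in> span (e ` {..<q})"
    "\<And>i j. i < q \<Longrightarrow> j < q \<Longrightarrow> d i \<bullet> e j = (if i = j then 1 else 0)"
proof -
  have "\<exists>d. d \<in> span (e ` {..<q}) \<and> (\<forall>j<q. d \<bullet> e j = (if i = j then 1 else 0))" if i: "i < q" for i
  proof -
    let ?S = "e ` ({..<q} - {i})"
    obtain y z where y: "y \<in> span ?S" and z: "\<And>w. w \<in> span ?S \<Longrightarrow> orthogonal z w" and yz: "e i = y + z"
      using orthogonal_subspace_decomp_exists[of ?S "e i"] by metis
    have "z \<noteq> 0"
    proof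
      assume "z = 0"
      \<comment> \<open>Replacing the i-th vector by 0 instead of omitting it keeps the index set of
        the form {..<q}.\<close>
      have "y \<in> span ((\<lambda>j. if j = i then 0 else e j) ` {..<q})"
        by (rule subsetD[OF span_mono y]) auto
      then obtain c where c: "y = (\<Sum>j<q. c j *\<^sub>R (if j = i then 0 else e j))"
        using span_image_sumE by metis
      have "(\<Sum>j<q. (if j = i then -1 else c j) *\<^sub>R e j) =
         (\<Sum>j<q. c j *\<^sub>R (if j = i then 0 else e j) + (if j = i then - e i else 0))"
        by (intro sum.cong) auto
      also have "\<dots> = y - e i" using i c by (simp add: sum.distrib)
      also have "\<dots> = 0" using yz \<open>z = 0\<close> by simp
      finally have "\<forall>j<q. (if j = i then -1 else c j) = (0::real)" by (rule mp[OF spec[OF ind]])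
      then have "(-1::real) = 0" using i by metis
      then show False by simp
    qed
    have zs: "z \<in> span (e ` {..<q})"
    proof -
      have "y \<in> span (e ` {..<q})" by (rule subsetD[OF span_mono y]) auto
      moreover have "e i \<in> span (e ` {..<q})" using i by (intro span_base) auto
      ultimately show ?thesis using yz span_diff by (metis add_diff_cancel_left')
    qed
    have zj: "z \<bullet> e j = (if i = j then z \<bullet> z else 0)" if "j < q" for j
    proof (cases "i = j")
      case True
      then show ?thesis using z[OF y] yz by (auto simp: orthogonal_def inner_add_right)
    next
      case False
      then show ?thesis using z[of "e j"] that by (auto simp: orthogonal_def intro: span_base)
    qed
    show ?thesis
      by (rule exI[of _ "(1 / (z \<bullet> z)) *\<^sub>R z"]) (use zs zj \<open>z \<noteq> 0\<close> in \<open>auto intro: span_scale\<close>)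
  qed
  then obtain d where "\<And>i. i < q \<Longrightarrow> d i \<in> span (e ` {..<q}) \<and> (\<forall>j<q. d i \<bullet> e j = (if i = j then 1 else 0))"
    by metis
  then show ?thesis using that by metis
qed

text \<open>
  The Gram system is solved to first order by \<open>\<Sum>i<q. (\<alpha> i + t * \<beta> i) *\<^sub>R e i t\<close>; the error lies in the
  moving span and has inner products of order \<open>o(t)\<close> with the frame, hence is \<open>o(t)\<close> itself.
\<close>

lemma differentiable_moving_frame:
  fixes e :: "nat \<Rightarrow> real \<Rightarrow> 'a::euclidean_space" and b :: "nat \<Rightarrow> real \<Rightarrow> real" and m :: "real \<Rightarrow> 'a"
  assumes e: "\<And>i. i < q \<Longrightarrow> e i differentiable (at 0)"
    and b: "\<And>i. i < q \<Longrightarrow> b i differentiable (at 0)"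
    and ind: "\<forall>c. (\<Sum>i<q. c i *\<^sub>R e i 0) = 0 \<longrightarrow> (\<forall>i<q. c i = 0)"
    and m0: "m 0 \<in> span ((\<lambda>i. e i 0) ` {..<q})" "\<And>i. i < q \<Longrightarrow> m 0 \<bullet> e i 0 = b i 0"
    and m: "\<forall>\<^sub>F t in at 0. m t \<in> span ((\<lambda>i. e i t) ` {..<q}) \<and> (\<forall>i<q. m t \<bullet> e i t = b i t)"
  shows "m differentiable (at 0)"
proof -
  define e' where "e' i = vector_derivative (e i) (at 0)" for i
  have e': "(e i has_vector_derivative e' i) (at 0)" if "i < q" for i
    using e[OF that] by (simp add: e'_def vector_derivative_works)
  define b' where "b' i = vector_derivative (b i) (at 0)" for i
  have b': "(b i has_vector_derivative b' i) (at 0)" if "i < q" for i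
    using b[OF that] by (simp add: b'_def vector_derivative_works)
  obtain d where dsp: "\<And>i. i < q \<Longrightarrow> d i \<in> span ((\<lambda>i. e i 0) ` {..<q})"
    and de: "\<And>i j. i < q \<Longrightarrow> j < q \<Longrightarrow> d i \<bullet> e j 0 = (if i = j then 1 else 0)"
    using dual_familyE[OF ind] by blast
  obtain \<alpha> where \<alpha>: "m 0 = (\<Sum>i<q. \<alpha> i *\<^sub>R e i 0)" using span_image_sumE[OF m0(1)] by blast
  \<comment> \<open>Differentiating the Gram equation \<open>M t \<bullet> e j t = b j t\<close> at
    0 leaves \<open>w j\<close> as the required inner product of
    \<open>\<Sum>i<q. \<beta> i *\<^sub>R e i 0\<close> with \<open>e j 0\<close>.\<close>
  define w where "w j = b' j - ((\<Sum>i<q. \<alpha> i *\<^sub>R e' i) \<bullet> e j 0 + (\<Sum>i<q. \<alpha> i *\<^sub>R e i 0) \<bullet> e' j)" for j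
  have "(\<Sum>j<q. w j *\<^sub>R d j) \<in> span ((\<lambda>i. e i 0) ` {..<q})"
    by (intro span_sum span_scale dsp) auto
  then obtain \<beta> where \<beta>: "(\<Sum>j<q. w j *\<^sub>R d j) = (\<Sum>i<q. \<beta> i *\<^sub>R e i 0)" using span_image_sumE by blast
  have \<beta>w: "(\<Sum>i<q. \<beta> i *\<^sub>R e i 0) \<bullet> e j 0 = w j" if "j < q" for j
  proof -
    have "(\<Sum>i<q. \<beta> i *\<^sub>R e i 0) \<bullet> e j 0 = (\<Sum>i<q. w i * (if i = j then 1 else 0))"
      unfolding \<beta>[symmetric] inner_sum_left using de that by (intro sum.cong) auto
    then show ?thesis using that by (simp add: if_distrib cong: if_cong)
  qed
  define M where "M t = (\<Sum>i<q. \<alpha> i *\<^sub>R e i t) + t *\<^sub>R (\<Sum>i<q. \<beta> i *\<^sub>R e i t)" for t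
  define R where "R t = m t - M t" for t
  define M' where "M' = (\<Sum>i<q. \<alpha> i *\<^sub>R e' i) + (\<Sum>i<q. \<beta> i *\<^sub>R e i 0)"
  have sumd: "((\<lambda>t. \<Sum>i<q. c i *\<^sub>R e i t) has_vector_derivative (\<Sum>i<q. c i *\<^sub>R e' i)) (at 0)" for c
    by (rule has_vector_derivative_sum) (auto intro!: derivative_eq_intros e')
  have M': "(M has_vector_derivative M') (at 0)"
    unfolding M_def M'_def
    by (rule derivative_eq_intros sumd refl | simp)+
  define \<rho> where "\<rho> j t = b j t - M t \<bullet> e j t" for j t
  have M0: "M 0 = m 0" by (simp add: M_def \<alpha>)
  have \<rho>0: "\<rho> j 0 = 0" if "j < q" for j using m0(2)[OF that] by (simp add: \<rho>_def M0)
  have \<rho>': "(\<rho> j has_vector_derivative 0) (at 0)" if j: "j < q" for j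
  proof -
    have "((\<lambda>t. M t \<bullet> e j t) has_vector_derivative (M 0 \<bullet> e' j + M' \<bullet> e j 0)) (at 0)"
      by (rule bounded_bilinear.has_vector_derivative[OF bounded_bilinear_inner M' e'[OF j]])
    from has_vector_derivative_diff[OF b'[OF j] this]
    have "(\<rho> j has_vector_derivative b' j - (M 0 \<bullet> e' j + M' \<bullet> e j 0)) (at 0)"
      by (simp add: \<rho>_def[abs_def])
    moreover have "b' j - (M 0 \<bullet> e' j + M' \<bullet> e j 0) = 0"
      unfolding M'_def inner_add_left \<beta>w[OF j] by (simp add: w_def M0 \<alpha>)
    ultimately show ?thesis by simp
  qed
  define D where "D = (\<Sum>i<q. norm (d i))"
  have D0: "D \<ge> 0" unfolding D_def by (simp add: sum_nonneg)
  \<comment> \<open>Chosen so that \<open>D * \<epsilon> \<le> 1/2\<close>, which lets half of the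
    coefficient sum be absorbed in the next estimate; the summand 1 guards against D = 0.\<close>
  define \<epsilon> where "\<epsilon> = 1 / (2 * (D + 1))"
  have \<epsilon>: "\<epsilon> > 0" "D * \<epsilon> \<le> 1/2" using D0 by (auto simp: \<epsilon>_def field_simps)
  have econt: "\<forall>\<^sub>F t in at 0. norm (e i t - e i 0) < \<epsilon>" if "i < q" for i
  proof -
    have "(e i \<longlongrightarrow> e i 0) (at 0)"
      using has_vector_derivative_continuous[OF e'[OF that]] by (simp add: continuous_at)
    from tendstoD[OF this \<epsilon>(1)] show ?thesis by (simp add: dist_norm)
  qed
  have close: "\<forall>\<^sub>F t in at 0. \<forall>i\<in>{..<q}. norm (e i t - e i 0) < \<epsilon>"
    by (intro eventually_ball_finite) (use econt in auto)
  \<comment> \<open>Independence is stable: the dual family at time 0 bounds the coefficients with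
    respect to any frame that is \<epsilon>-close, uniformly in \<open>t\<close>.\<close>
  have bound: "(\<Sum>i<q. \<bar>c i\<bar>) \<le> 2 * D * norm (\<Sum>i<q. c i *\<^sub>R e i t)"
    if t: "\<forall>i\<in>{..<q}. norm (e i t - e i 0) < \<epsilon>" for t c
  proof -
    let ?r = "\<Sum>i<q. c i *\<^sub>R e i t" and ?\<Gamma> = "\<Sum>i<q. \<bar>c i\<bar>"
    have ci: "\<bar>c i\<bar> \<le> norm (d i) * (norm ?r + \<epsilon> * ?\<Gamma>)" if i: "i < q" for i
    proof -
      have "d i \<bullet> (\<Sum>j<q. c j *\<^sub>R e j 0) = (\<Sum>j<q. c j * (if i = j then 1 else 0))"
        unfolding inner_sum_right using de i by (intro sum.cong) auto
      then have "c i = d i \<bullet> (\<Sum>j<q. c j *\<^sub>R e j 0)" using i by (simp add: if_distrib cong: if_cong)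
      then have "\<bar>c i\<bar> \<le> norm (d i) * norm (\<Sum>j<q. c j *\<^sub>R e j 0)"
        using Cauchy_Schwarz_ineq2 by metis
      also have "(\<Sum>j<q. c j *\<^sub>R e j 0) = ?r - (\<Sum>j<q. c j *\<^sub>R (e j t - e j 0))"
        by (simp add: scaleR_diff_right sum_subtractf)
      also have "norm (?r - (\<Sum>j<q. c j *\<^sub>R (e j t - e j 0))) \<le> norm ?r + (\<Sum>j<q. \<bar>c j\<bar> * \<epsilon>)"
      proof -
        have "norm (\<Sum>j<q. c j *\<^sub>R (e j t - e j 0)) \<le> (\<Sum>j<q. \<bar>c j\<bar> * \<epsilon>)"
          by (rule sum_norm_le) (use t in \<open>auto intro!: mult_left_mono intro: less_imp_le\<close>)
        then show ?thesis using norm_triangle_ineq4 by (meson add_left_mono order_trans)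
      qed
      also have "(\<Sum>j<q. \<bar>c j\<bar> * \<epsilon>) = \<epsilon> * ?\<Gamma>" by (simp add: sum_distrib_left mult.commute)
      finally show ?thesis by (simp add: mult_left_mono)
    qed
    have "?\<Gamma> \<le> (\<Sum>i<q. norm (d i) * (norm ?r + \<epsilon> * ?\<Gamma>))" by (rule sum_mono) (use ci in auto)
    also have "\<dots> = D * norm ?r + (D * \<epsilon>) * ?\<Gamma>"
      unfolding sum_distrib_right[symmetric] D_def[symmetric] by (simp add: algebra_simps)
    also have "(D * \<epsilon>) * ?\<Gamma> \<le> 1/2 * ?\<Gamma>" by (intro mult_right_mono \<epsilon>) (simp add: sum_nonneg)
    finally show ?thesis by simp
  qed
  have "(R has_vector_derivative 0) (at 0)"
  proof (rule has_vector_derivative_zeroI)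
    show "R 0 = 0" by (simp add: R_def M0)
    fix \<delta> :: real assume \<delta>: "\<delta> > 0"
    define \<delta>' where "\<delta>' = \<delta> / (2 * D + 1)"
    have \<delta>': "\<delta>' > 0" "2 * D * \<delta>' \<le> \<delta>" using \<delta> D0 by (auto simp: \<delta>'_def field_simps)
    have "\<forall>\<^sub>F t in at 0. \<forall>j\<in>{..<q}. norm (\<rho> j t) \<le> \<delta>' * \<bar>t\<bar>"
      by (intro eventually_ball_finite) (use has_vector_derivative_zeroD[OF \<rho>' \<rho>0 \<delta>'(1)] in auto)
    with m close show "\<forall>\<^sub>F t in at 0. norm (R t) \<le> \<delta> * \<bar>t\<bar>"
    proof eventually_elim
      case (elim t)
      have Mt: "M t = (\<Sum>i<q. (\<alpha> i + t * \<beta> i) *\<^sub>R e i t)"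
        by (simp add: M_def scaleR_sum_right scaleR_add_left sum.distrib)
      have "R t \<in> span ((\<lambda>i. e i t) ` {..<q})"
        unfolding R_def Mt using elim(1) by (intro span_diff sum_in_span) auto
      then obtain c where c: "R t = (\<Sum>i<q. c i *\<^sub>R e i t)" using span_image_sumE by blast
      \<comment> \<open>\<open>R t\<close> is paired with itself, once expanded in the frame; its
        coefficients are bounded by a multiple of \<open>norm (R t)\<close>, so one factor cancels
        and \<open>norm (R t)\<close> is bounded by the residuals \<rho>.\<close>
      have "norm (R t) * norm (R t) = (\<Sum>i<q. c i *\<^sub>R e i t) \<bullet> R t"
        using c by (simp flip: power2_norm_eq_inner add: power2_eq_square)
      also have "\<dots> = (\<Sum>i<q. c i * \<rho> i t)"
        unfolding inner_sum_left using elim(1)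
        by (intro sum.cong) (auto simp: R_def \<rho>_def inner_diff_right inner_commute)
      also have "\<dots> \<le> (\<Sum>i<q. \<bar>c i\<bar> * (\<delta>' * \<bar>t\<bar>))"
      proof (rule sum_mono)
        fix i assume "i \<in> {..<q}"
        have "c i * \<rho> i t \<le> \<bar>c i\<bar> * \<bar>\<rho> i t\<bar>" by (metis abs_ge_self abs_mult)
        also have "\<dots> \<le> \<bar>c i\<bar> * (\<delta>' * \<bar>t\<bar>)" using elim(3) \<open>i \<in> {..<q}\<close> by (intro mult_left_mono) auto
        finally show "c i * \<rho> i t \<le> \<bar>c i\<bar> * (\<delta>' * \<bar>t\<bar>)" .
      qed
      also have "\<dots> = (\<Sum>i<q. \<bar>c i\<bar>) * (\<delta>' * \<bar>t\<bar>)" by (simp add: sum_distrib_right)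
      also have "\<dots> \<le> (2 * D * norm (R t)) * (\<delta>' * \<bar>t\<bar>)"
        using bound[OF elim(2), of c] \<delta>'(1) unfolding c by (intro mult_right_mono) auto
      also have "\<dots> = norm (R t) * ((2 * D * \<delta>') * \<bar>t\<bar>)" by simp
      also have "\<dots> \<le> norm (R t) * (\<delta> * \<bar>t\<bar>)" by (intro mult_left_mono mult_right_mono \<delta>') auto
      finally have le: "norm (R t) * norm (R t) \<le> norm (R t) * (\<delta> * \<bar>t\<bar>)" .
      show ?case
      proof (cases "R t = 0")
        case False
        with le show ?thesis by simp
      qed (use \<delta> in simp)
    qed
  qed
  from has_vector_derivative_add[OF this M'] have "(m has_vector_derivative M') (at 0)"
    by (simp add: R_def)
  then show ?thesis by (rule differentiableI_vector)
qed

text \<open>The Riesz representation inside \<open>T\<close>, which makes the definite description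
  meaningful. Linearity is assumed on \<open>T\<close> alone because the values of a one-form off
  the tangent space are arbitrary.\<close>

lemma covector_of_frame:
  fixes e :: "nat \<Rightarrow> real^'d"
  assumes ind: "\<forall>c. (\<Sum>i<q. c i *\<^sub>R e i) = 0 \<longrightarrow> (\<forall>i<q. c i = 0)"
    and T: "T = span (e ` {..<q})"
    and lin: "\<And>u v r s. u \<in> T \<Longrightarrow> v \<in> T \<Longrightarrow> l (r *\<^sub>R u + s *\<^sub>R v) = r * l u + s * l v"
  shows "covector_of T l \<in> T" and "\<And>v. v \<in> T \<Longrightarrow> covector_of T l \<bullet> v = l v"
proof -
  obtain d where dT: "\<And>i. i < q \<Longrightarrow> d i \<in> span (e ` {..<q})"
    and de: "\<And>i j. i < q \<Longrightarrow> j < q \<Longrightarrow> d i \<bullet> e j = (if i = j then 1 else 0)"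
    using dual_familyE[OF ind] by blast
  have eT: "e i \<in> T" if "i < q" for i unfolding T using that by (intro span_base) auto
  have l0: "l 0 = 0" using lin[of 0 0 0 0] by (simp add: T span_zero)
  have lsum: "k \<le> q \<Longrightarrow> (\<Sum>i<k. c i *\<^sub>R e i) \<in> T \<and> l (\<Sum>i<k. c i *\<^sub>R e i) = (\<Sum>i<k. c i * l (e i))" for k c
  proof (induction k)
    case 0
    then show ?case by (simp add: l0 T span_zero)
  next
    case (Suc k)
    then show ?case
      using lin[of "\<Sum>i<k. c i *\<^sub>R e i" "e k" 1 "c k"] eT[of k] by (auto simp: T intro!: span_add span_scale)
  qed
  let ?m = "\<Sum>i<q. l (e i) *\<^sub>R d i"
  have mT: "?m \<in> T" unfolding T by (intro span_sum span_scale dT) auto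
  have mv: "?m \<bullet> v = l v" if vT: "v \<in> T" for v
  proof -
    obtain c where c: "v = (\<Sum>i<q. c i *\<^sub>R e i)" using vT span_image_sumE unfolding T by blast
    have me: "?m \<bullet> e j = l (e j)" if "j < q" for j
    proof -
      have "?m \<bullet> e j = (\<Sum>i<q. l (e i) * (if i = j then 1 else 0))"
        unfolding inner_sum_left using de that by (intro sum.cong) auto
      then show ?thesis using that by (simp add: if_distrib cong: if_cong)
    qed
    have "?m \<bullet> v = (\<Sum>j<q. c j * (?m \<bullet> e j))"
      unfolding c by (simp add: inner_sum_right)
    also have "\<dots> = (\<Sum>j<q. c j * l (e j))" using me by (intro sum.cong) auto
    also have "\<dots> = l v" using lsum[of q c] c by simp
    finally show ?thesis .
  qed
  have "\<exists>!m. m \<in> T \<and> (\<forall>v\<in>T. m \<bullet> v = l v)"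
  proof (rule ex1I[of _ ?m])
    fix m assume m: "m \<in> T \<and> (\<forall>v\<in>T. m \<bullet> v = l v)"
    then have "m - ?m \<in> T" using mT unfolding T by (intro span_diff) auto
    then have "(m - ?m) \<bullet> (m - ?m) = 0" using m mv by (simp add: inner_diff_left)
    then show "m = ?m" by simp
  qed (use mT mv in auto)
  from theI'[OF this] show "covector_of T l \<in> T" and "\<And>v. v \<in> T \<Longrightarrow> covector_of T l \<bullet> v = l v"
    unfolding covector_of_def by auto
qed

subsection \<open>Immersions into the sphere\<close>

locale sphere_immersion =
  fixes q :: nat and A :: "'m::topological_space chart set" and x :: "'m \<Rightarrow> real^'d"
  assumes atlas: "oriented_atlas q A" and imm: "immersion q A x" and sph: "\<forall>p. x p \<in> sphere 0 1"
begin

definition frame :: "'m set \<Rightarrow> ('m \<Rightarrow> nat \<Rightarrow> real) \<Rightarrow> nat \<Rightarrow> 'm \<Rightarrow> real^'d" where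
  "frame U \<phi> i p = pderiv_at i (x \<circ> inv_into U \<phi>) (\<phi> p)"

lemma chartE:
  obtains U \<phi> where "(U, \<phi>) \<in> A" "p \<in> U"
proof -
  have "p \<in> (\<Union>(U, \<phi>)\<in>A. U)" using atlas unfolding oriented_atlas_def by simp
  then show ?thesis using that by auto
qed

lemma chart:
  assumes "(U, \<phi>) \<in> A"
  shows chart_open: "open U"
    and chart_image: "openin (Euclidean_space q) (\<phi> ` U)"
    and chart_homeo: "homeomorphic_map (top_of_set U) (subtopology (Euclidean_space q) (\<phi> ` U)) \<phi>"
    and chart_inj: "inj_on \<phi> U"
proof -
  have "is_chart q (U, \<phi>)" using atlas assms unfolding oriented_atlas_def by blast
  then show "open U" "openin (Euclidean_space q) (\<phi> ` U)"
    and h: "homeomorphic_map (top_of_set U) (subtopology (Euclidean_space q) (\<phi> ` U)) \<phi>"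
    by (auto simp: is_chart_def)
  then show "inj_on \<phi> U" using homeomorphic_imp_injective_map[OF h] by simp
qed

lemma chart_vanish: "(U, \<phi>) \<in> A \<Longrightarrow> p \<in> U \<Longrightarrow> i \<ge> q \<Longrightarrow> \<phi> p i = 0"
  using openin_Euclidean_spaceD[OF chart_image] by blast

lemma chart_image_Int:
  assumes "(U, \<phi>) \<in> A" "open W"
  shows "openin (Euclidean_space q) (\<phi> ` (U \<inter> W))"
proof -
  have "openin (top_of_set U) (U \<inter> W)" using assms(2) by (auto simp: openin_open)
  then have "openin (subtopology (Euclidean_space q) (\<phi> ` U)) (\<phi> ` (U \<inter> W))"
    using homeomorphic_imp_open_map[OF chart_homeo[OF assms(1)]] unfolding open_map_def by blast
  then show ?thesis by (rule openin_trans_full) (rule chart_image[OF assms(1)])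
qed

lemma smooth_x: "(U, \<phi>) \<in> A \<Longrightarrow> smooth_on q (\<phi> ` U) (x \<circ> inv_into U \<phi>)"
  using imm unfolding immersion_def by blast

lemma frame_independent:
  assumes "(U, \<phi>) \<in> A" "p \<in> U"
  shows "\<forall>c. (\<Sum>i<q. c i *\<^sub>R frame U \<phi> i p) = 0 \<longrightarrow> (\<forall>i<q. c i = 0)"
  using imm assms unfolding immersion_def frame_def by blast

lemma smooth_transition:
  assumes "(U, \<phi>) \<in> A" "(V, \<psi>) \<in> A" "k < q"
  shows "smooth_on q (\<phi> ` (U \<inter> V)) (\<lambda>a. \<psi> (inv_into U \<phi> a) k)"
  using atlas assms unfolding oriented_atlas_def by blast

lemma eventually_chart:
  assumes "(U, \<phi>) \<in> A" "isCont g (0::real)" "g 0 \<in> U"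
  shows "\<forall>\<^sub>F t in at 0. g t \<in> U"
  using assms(2,3) chart_open[OF assms(1)] unfolding isCont_def by (rule_tac topological_tendstoD)

lemma smooth_along_curve:
  assumes UA: "(U, \<phi>) \<in> A" and f: "smooth_on q (\<phi> ` U) f" and g: "isCont g 0" and p: "g 0 \<in> U"
    and c: "\<And>i. i < q \<Longrightarrow> ((\<lambda>t. \<phi> (g t) i) has_real_derivative c i) (at 0)"
  shows "((\<lambda>t. f (\<phi> (g t))) has_vector_derivative (\<Sum>i<q. c i *\<^sub>R pderiv_at i f (\<phi> (g 0)))) (at 0)"
proof -
  have "\<forall>\<^sub>F t in at 0. g t \<in> U" by (rule eventually_chart[OF UA g p])
  then have "\<forall>\<^sub>F t in at 0. \<forall>i\<ge>q. \<phi> (g t) i = 0"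
    by eventually_elim (use chart_vanish[OF UA] in auto)
  then show ?thesis
    using smooth_on_chain_rule[OF chart_image[OF UA] f, of "\<lambda>t. \<phi> (g t)" c] p c by auto
qed

lemma x_along_curve:
  assumes UA: "(U, \<phi>) \<in> A" and g: "isCont g 0" and p: "g 0 \<in> U"
    and c: "\<And>i. i < q \<Longrightarrow> ((\<lambda>t. \<phi> (g t) i) has_real_derivative c i) (at 0)"
  shows "((\<lambda>t. x (g t)) has_vector_derivative (\<Sum>i<q. c i *\<^sub>R frame U \<phi> i (g 0))) (at 0)"
proof (rule has_vector_derivative_transform_ev)
  show "((\<lambda>t. (x \<circ> inv_into U \<phi>) (\<phi> (g t))) has_vector_derivative (\<Sum>i<q. c i *\<^sub>R frame U \<phi> i (g 0))) (at 0)"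
    unfolding frame_def by (rule smooth_along_curve[OF UA smooth_x[OF UA] g p c])
  show "\<forall>\<^sub>F t in at 0. (x \<circ> inv_into U \<phi>) (\<phi> (g t)) = x (g t)"
    using eventually_chart[OF UA g p] by eventually_elim (simp add: inv_into_f_f[OF chart_inj[OF UA]])
  show "(x \<circ> inv_into U \<phi>) (\<phi> (g 0)) = x (g 0)"
    using p by (simp add: inv_into_f_f[OF chart_inj[OF UA]])
qed

text \<open>The velocity of the i-th coordinate line of \<phi> is computed in both charts;
  uniqueness of the derivative expresses it through the other frame, with entries of the Jacobian
  matrix of the transition map as coefficients. Hence the union in \<open>tangent_space\<close> is a
  single subspace.\<close>

lemma frame_in_span_frame:
  assumes UA: "(U, \<phi>) \<in> A" and VA: "(V, \<psi>) \<in> A" and pU: "p \<in> U" and pV: "p \<in> V" and i: "i < q"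
  shows "frame U \<phi> i p \<in> span ((\<lambda>j. frame V \<psi> j p) ` {..<q})"
proof -
  let ?a = "\<phi> p"
  let ?W = "\<phi> ` (U \<inter> V)"
  define g where "g t = inv_into U \<phi> (?a(i := ?a i + t))" for t
  have W: "openin (Euclidean_space q) ?W" by (rule chart_image_Int[OF UA chart_open[OF VA]])
  have aW: "?a \<in> ?W" using pU pV by blast
  have g0: "g 0 = p" using pU by (simp add: g_def inv_into_f_f[OF chart_inj[OF UA]])
  have vd: "((\<lambda>t. f (?a(i := ?a i + t))) has_vector_derivative pderiv_at i f ?a) (at 0)"
    if "smooth_on q ?W f \<or> smooth_on q (\<phi> ` U) f" for f :: "(nat \<Rightarrow> real) \<Rightarrow> 'b::real_normed_vector"
  proof -
    have "((\<lambda>t. f (?a(i := t))) has_vector_derivative pderiv_at i f ?a) (at (?a i))"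
      using that smooth_on_has_pderiv i aW pU by blast
    moreover have "((\<lambda>t. ?a i + t) has_real_derivative 1) (at 0)" by (auto intro!: derivative_eq_intros)
    ultimately show ?thesis
      using vector_diff_chain_at[of "\<lambda>t. ?a i + t" 1 0 "\<lambda>t. f (?a(i := t))" "pderiv_at i f ?a"]
      by (simp add: o_def has_real_derivative_iff_has_vector_derivative)
  qed
  have "\<forall>\<^sub>F t in at 0. ?a(i := ?a i + t) \<in> ?W"
  proof -
    obtain d where d: "d > 0" "qbox q ?a d \<subseteq> ?W" using openin_contains_qbox[OF W aW] by blast
    have "\<forall>\<^sub>F t in at 0. \<bar>t\<bar> < d" using d(1) by (auto simp: eventually_at dist_real_def intro!: exI[of _ d])
    then show ?thesis
    proof eventually_elim
      case (elim t)
      then have "?a(i := ?a i + t) \<in> qbox q ?a d"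
        using d(1) i chart_vanish[OF UA pU] by (auto simp: qbox_def)
      then show ?case using d(2) by blast
    qed
  qed
  then have gV: "\<forall>\<^sub>F t in at 0. g t \<in> V"
    by eventually_elim (auto simp: g_def inv_into_f_f[OF chart_inj[OF UA]])
  have \<psi>d: "((\<lambda>t. \<psi> (g t) k) has_real_derivative pderiv_at i (\<lambda>a. \<psi> (inv_into U \<phi> a) k) ?a) (at 0)" if "k < q" for k
    using vd[of "\<lambda>a. \<psi> (inv_into U \<phi> a) k"] smooth_transition[OF UA VA that]
    by (simp add: g_def has_real_derivative_iff_has_vector_derivative)
  have "((\<lambda>t. (x \<circ> inv_into V \<psi>) (\<psi> (g t))) has_vector_derivative
      (\<Sum>k<q. pderiv_at i (\<lambda>a. \<psi> (inv_into U \<phi> a) k) ?a *\<^sub>R pderiv_at k (x \<circ> inv_into V \<psi>) (\<psi> (g 0)))) (at 0)"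
  proof (rule smooth_on_chain_rule[OF chart_image[OF VA] smooth_x[OF VA]])
    show "\<psi> (g 0) \<in> \<psi> ` V" using pV g0 by simp
    show "\<forall>\<^sub>F t in at 0. \<forall>i\<ge>q. \<psi> (g t) i = 0"
      using gV by eventually_elim (use chart_vanish[OF VA] in auto)
  qed (rule \<psi>d)
  then have "((\<lambda>t. x (g t)) has_vector_derivative
      (\<Sum>k<q. pderiv_at i (\<lambda>a. \<psi> (inv_into U \<phi> a) k) ?a *\<^sub>R frame V \<psi> k p)) (at 0)"
    unfolding frame_def g0
    by (rule has_vector_derivative_transform_ev)
       (use gV pV g0 in \<open>auto elim!: eventually_mono simp: inv_into_f_f[OF chart_inj[OF VA]]\<close>)
  moreover have "((\<lambda>t. x (g t)) has_vector_derivative frame U \<phi> i p) (at 0)"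
    using vd[of "x \<circ> inv_into U \<phi>"] smooth_x[OF UA] by (simp add: g_def frame_def o_def)
  ultimately have "frame U \<phi> i p = (\<Sum>k<q. pderiv_at i (\<lambda>a. \<psi> (inv_into U \<phi> a) k) ?a *\<^sub>R frame V \<psi> k p)"
    using vector_derivative_unique_at by blast
  then show ?thesis using sum_in_span by metis
qed

lemma tangent_space_eq:
  assumes UA: "(U, \<phi>) \<in> A" and pU: "p \<in> U"
  shows "tangent_space q A x p = span ((\<lambda>i. frame U \<phi> i p) ` {..<q})"
proof -
  have "span ((\<lambda>i. frame V \<psi> i p) ` {..<q}) \<subseteq> span ((\<lambda>i. frame U \<phi> i p) ` {..<q})"
    if "(V, \<psi>) \<in> A" "p \<in> V" for V \<psi>
    by (rule span_minimal) (use frame_in_span_frame[OF that(1) UA that(2) pU] in auto)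
  then show ?thesis
    unfolding tangent_space_def frame_def using UA pU by (auto simp: frame_def)
qed

lemma inner_x_self: "x p \<bullet> x p = 1"
  using sph by (simp add: norm_eq_1)

lemma tangent_orthogonal_x:
  assumes "v \<in> tangent_space q A x p"
  shows "x p \<bullet> v = 0"
proof -
  obtain U \<phi> where UA: "(U, \<phi>) \<in> A" and pU: "p \<in> U" by (rule chartE)
  have "x p \<bullet> frame U \<phi> i p = 0" if "i < q" for i
  proof -
    let ?X = "\<lambda>t. (x \<circ> inv_into U \<phi>) ((\<phi> p)(i := t))"
    have X0: "?X (\<phi> p i) = x p" using pU by (simp add: inv_into_f_f[OF chart_inj[OF UA]])
    have "(?X has_vector_derivative frame U \<phi> i p) (at (\<phi> p i))"
      unfolding frame_def using smooth_on_has_pderiv[OF smooth_x[OF UA] that] pU by blast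
    from bounded_bilinear.has_vector_derivative[OF bounded_bilinear_inner this this]
    have "((\<lambda>t. 1) has_vector_derivative (x p \<bullet> frame U \<phi> i p + frame U \<phi> i p \<bullet> x p)) (at (\<phi> p i))"
      unfolding X0 by (simp add: inner_x_self)
    then have "x p \<bullet> frame U \<phi> i p + frame U \<phi> i p \<bullet> x p = 0"
      using vector_derivative_unique_at has_vector_derivative_const by blast
    then show ?thesis by (simp add: inner_commute)
  qed
  then have "orthogonal (x p) v"
    using assms unfolding tangent_space_eq[OF UA pU]
    by - (rule orthogonal_to_span, auto simp: orthogonal_def)
  then show ?thesis by (simp add: orthogonal_def)
qed

lemma covector_of_tangent_space:
  assumes "\<And>u v r s. u \<in> tangent_space q A x p \<Longrightarrow> v \<in> tangent_space q A x p \<Longrightarrow>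
     l (r *\<^sub>R u + s *\<^sub>R v) = r * l u + s * l v"
  shows "covector_of (tangent_space q A x p) l \<in> tangent_space q A x p"
    and "\<And>v. v \<in> tangent_space q A x p \<Longrightarrow> covector_of (tangent_space q A x p) l \<bullet> v = l v"
proof -
  obtain U \<phi> where UA: "(U, \<phi>) \<in> A" and pU: "p \<in> U" by (rule chartE)
  note * = covector_of_frame[OF frame_independent[OF UA pU] tangent_space_eq[OF UA pU], of l]
  show "covector_of (tangent_space q A x p) l \<in> tangent_space q A x p"
    by (rule *(1)) (rule assms)
  show "covector_of (tangent_space q A x p) l \<bullet> v = l v" if "v \<in> tangent_space q A x p" for v
    by (rule *(2)[OF _ that]) (rule assms)
qed

text \<open>The representative of \<open>\<mu> p\<close> is tangent, hence orthogonal to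
  \<open>x p\<close>, and subtracting it leaves a conormal covector. In this form membership is a
  set of equations that can be differentiated along curves.\<close>

lemma twisted_conormal_iff:
  assumes \<mu>: "one_form q A x \<mu>"
  shows "(p, \<eta>) \<in> twisted_conormal q A x \<mu> \<longleftrightarrow>
    x p \<bullet> \<eta> = 0 \<and> (\<forall>v\<in>tangent_space q A x p. \<eta> \<bullet> v = \<mu> p v)"
proof -
  let ?T = "tangent_space q A x p"
  let ?m = "covector_of ?T (\<mu> p)"
  have lin: "\<mu> p (r *\<^sub>R u + s *\<^sub>R v) = r * \<mu> p u + s * \<mu> p v" if "u \<in> ?T" "v \<in> ?T" for u v r s
    using \<mu> that unfolding one_form_def by blast
  note m = covector_of_tangent_space[of p "\<mu> p", OF lin]
  have "(p, \<eta>) \<in> twisted_conormal q A x \<mu> \<longleftrightarrow> \<eta> - ?m \<in> conormal_space q A x p"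
    unfolding twisted_conormal_def by (auto intro!: exI[of _ "\<eta> - ?m"])
  also have "\<dots> \<longleftrightarrow> x p \<bullet> \<eta> = 0 \<and> (\<forall>v\<in>?T. \<eta> \<bullet> v = \<mu> p v)"
    using tangent_orthogonal_x[OF m(1)] m(2)
    by (simp add: conormal_space_def inner_diff_left inner_diff_right)
  finally show ?thesis .
qed

end

subsection \<open>Curves in the quadric\<close>

definition cvec :: "real^'d \<Rightarrow> real^'d \<Rightarrow> complex^'d" where
  "cvec a b = (\<chi> k. Complex (a $ k) (b $ k))"

text \<open>The imaginary part is, up to sign, the standard symplectic pairing, so every evaluation
  of the form reduces to real inner products.\<close>

lemma herm_cvec: "herm (cvec a b) (cvec a' b') = Complex (a \<bullet> a' + b \<bullet> b') (b \<bullet> a' - a \<bullet> b')"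
  by (simp add: herm_def cvec_def inner_vec_def complex_eq_iff sum_subtractf sum.distrib)

lemma norm_cvec: "(norm (cvec a b))\<^sup>2 = a \<bullet> a + b \<bullet> b"
  using arg_cong[OF herm_self[of "cvec a b"], of Re] by (simp add: herm_cvec)

lemma has_vector_derivative_cvec:
  assumes "(a has_vector_derivative a') (at t)" "(b has_vector_derivative b') (at t)"
  shows "((\<lambda>t. cvec (a t) (b t)) has_vector_derivative cvec a' b') (at t)"
proof -
  have "linear (\<lambda>p::(real^'d) \<times> (real^'d). cvec (fst p) (snd p))"
    by (rule linearI) (simp_all add: cvec_def vec_eq_iff complex_eq_iff)
  then have "bounded_linear (\<lambda>p::(real^'d) \<times> (real^'d). cvec (fst p) (snd p))"
    by (simp add: linear_conv_bounded_linear)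
  moreover have "((\<lambda>t. (a t, b t)) has_vector_derivative (a', b')) (at t)"
    using has_derivative_Pair assms unfolding has_vector_derivative_def by fastforce
  ultimately show ?thesis
    using bounded_linear.has_vector_derivative by fastforce
qed

text \<open>
  \<open>Psi\<close> involves \<open>sinh r / r\<close>, which is 0 at \<open>r = 0\<close> by the convention for division; replacing it by
  its continuous extension does not change \<open>Psi\<close>.
\<close>

definition sinhc :: "real \<Rightarrow> real" where
  "sinhc r = (if r = 0 then 1 else sinh r / r)"

lemma isCont_sinhc_0: "isCont sinhc 0"
proof -
  have "((\<lambda>h. (sinh (0 + h) - sinh 0) / h) \<longlongrightarrow> cosh (0::real)) (at 0)"
    by (rule DERIV_D) (auto intro!: derivative_eq_intros)
  then have "((\<lambda>h::real. sinh h / h) \<longlongrightarrow> 1) (at 0)" by simp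
  then have "(sinhc \<longlongrightarrow> 1) (at 0)"
    by (rule tendsto_cong[THEN iffD1, rotated]) (auto simp: sinhc_def eventually_at_filter)
  then show ?thesis by (simp add: isCont_def sinhc_def)
qed

lemma Psi_eq_cvec: "Psi y \<eta> = cvec (cosh (norm \<eta>) *\<^sub>R y) (sinhc (norm \<eta>) *\<^sub>R \<eta>)"
  by (auto simp: Psi_def cvec_def vec_eq_iff sinhc_def)

section \<open>Derivatives of \<open>Psi\<close> along curves, including curves through the zero
  section\<close>

lemma norm_curve:
  fixes h :: "real \<Rightarrow> 'a::real_inner"
  assumes "(h has_vector_derivative h') (at 0)" "h 0 \<noteq> 0"
  shows "((\<lambda>t. norm (h t)) has_real_derivative h 0 \<bullet> h' / norm (h 0)) (at 0)"
  unfolding has_field_derivative_def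
  by (rule has_derivative_eq_rhs[OF has_derivative_compose[OF
        assms(1)[unfolded has_vector_derivative_def] has_derivative_norm[OF assms(2)]]])
     (auto simp: sgn_div_norm inner_commute divide_inverse fun_eq_iff)

text \<open>Where \<open>h 0 = 0\<close> the norm is not differentiable. The half-argument formula
  writes cosh |h| - 1 as a continuous factor times \<open>h t \<bullet> h t\<close>, which vanishes
  to second order.\<close>

lemma cosh_norm_curve:
  fixes h :: "real \<Rightarrow> real^'d"
  assumes "(h has_vector_derivative h') (at 0)"
  shows "((\<lambda>t. cosh (norm (h t))) has_real_derivative sinhc (norm (h 0)) * (h 0 \<bullet> h')) (at 0)"
proof (cases "h 0 = 0")
  case False
  have "(cosh has_real_derivative sinh (norm (h 0))) (at (norm (h 0)))"
    by (auto intro!: derivative_eq_intros)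
  from DERIV_chain2[OF this norm_curve[OF assms False]] show ?thesis
    using False by (simp add: sinhc_def)
next
  case True
  have h0: "((\<lambda>t. norm (h t)) \<longlongrightarrow> 0) (at 0)"
    using has_vector_derivative_continuous[OF assms] True
    by (auto simp: continuous_at intro!: tendsto_norm_zero)
  have c: "isCont (\<lambda>t. sinhc (norm (h t) / 2)) 0"
  proof -
    have "((\<lambda>t. norm (h t) / 2) \<longlongrightarrow> 0) (at 0)" using tendsto_divide[OF h0 tendsto_const[of 2]] by simp
    from isCont_tendsto_compose[OF isCont_sinhc_0 this] show ?thesis using True by (simp add: isCont_def)
  qed
  have c2: "isCont (\<lambda>t. (sinhc (norm (h t) / 2))\<^sup>2 / 2) 0"
    using c by (intro continuous_intros) auto
  have "((\<lambda>t. h t \<bullet> h t) has_vector_derivative 0) (at 0)"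
    using bounded_bilinear.has_vector_derivative[OF bounded_bilinear_inner assms assms] True by simp
  then have d: "((\<lambda>t. h t \<bullet> h t) has_derivative (\<lambda>_. 0)) (at 0)" by (simp add: has_vector_derivative_def)
  have *: "cosh (norm (h t)) = 1 + ((sinhc (norm (h t) / 2))\<^sup>2 / 2) *\<^sub>R (h t \<bullet> h t)" for t
  proof -
    have "cosh (norm (h t)) = cosh (2 * (norm (h t) / 2))" by simp
    also have "\<dots> = 1 + 2 * (sinh (norm (h t) / 2))\<^sup>2"
      by (subst cosh_double) (simp add: cosh_square_eq)
    also have "\<dots> = 1 + ((sinhc (norm (h t) / 2))\<^sup>2 / 2) *\<^sub>R (h t \<bullet> h t)"
      by (auto simp: sinhc_def power_divide field_simps simp flip: power2_norm_eq_inner)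
    finally show ?thesis .
  qed
  have "((\<lambda>t. cosh (norm (h t))) has_derivative (\<lambda>_. 0)) (at 0)"
    unfolding * using has_derivative_add[OF has_derivative_const has_derivative_scaleR_vanishing[OF c2 d]] True
    by simp
  then show ?thesis using True by (simp add: has_field_derivative_def lambda_zero)
qed

text \<open>\<open>S1\<close> is the rate of change of \<open>sinhc (norm (h t))\<close>. When
  \<open>h 0 = 0\<close> this rate need not exist, but its coefficient vanishes, so the value is
  left open.\<close>

lemma sinhc_norm_curve:
  fixes h :: "real \<Rightarrow> real^'d"
  assumes "(h has_vector_derivative h') (at 0)"
  obtains S1 where
    "((\<lambda>t. sinhc (norm (h t)) *\<^sub>R h t) has_vector_derivative sinhc (norm (h 0)) *\<^sub>R h' + S1 *\<^sub>R h 0) (at 0)"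
    "h 0 \<noteq> 0 \<Longrightarrow> S1 = (cosh (norm (h 0)) / norm (h 0) - sinh (norm (h 0)) / (norm (h 0))\<^sup>2) * (h 0 \<bullet> h' / norm (h 0))"
proof (cases "h 0 = 0")
  case True
  have h0: "((\<lambda>t. norm (h t)) \<longlongrightarrow> 0) (at 0)"
    using has_vector_derivative_continuous[OF assms] True
    by (auto simp: continuous_at intro!: tendsto_norm_zero)
  have c: "isCont (\<lambda>t. sinhc (norm (h t))) 0"
    using isCont_tendsto_compose[OF isCont_sinhc_0 h0] True by (simp add: isCont_def)
  have "((\<lambda>t. sinhc (norm (h t)) *\<^sub>R h t) has_vector_derivative sinhc (norm (h 0)) *\<^sub>R h') (at 0)"
    using has_derivative_scaleR_vanishing[OF c assms[unfolded has_vector_derivative_def] True]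
    by (simp add: has_vector_derivative_def mult.commute)
  then show ?thesis using that[of 0] True by simp
next
  case False
  let ?r = "norm (h 0)"
  let ?r' = "h 0 \<bullet> h' / ?r"
  let ?S1 = "(cosh ?r / ?r - sinh ?r / ?r\<^sup>2) * ?r'"
  note r = norm_curve[OF assms False]
  have "((\<lambda>r. sinh r / r) has_real_derivative (cosh ?r / ?r - sinh ?r / ?r\<^sup>2)) (at ?r)"
    using False by (auto intro!: derivative_eq_intros simp: field_simps power2_eq_square)
  then have "(sinhc has_real_derivative (cosh ?r / ?r - sinh ?r / ?r\<^sup>2)) (at ?r)"
    by (rule has_field_derivative_transform_within_open[where S="{0<..}"]) (use False in \<open>auto simp: sinhc_def\<close>)
  from DERIV_chain2[OF this r] have "((\<lambda>t. sinhc (norm (h t))) has_real_derivative ?S1) (at 0)" .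
  from has_vector_derivative_scaleR[OF this assms]
  show ?thesis using that[of ?S1] by simp
qed

lemma Psi_curve:
  fixes y h :: "real \<Rightarrow> real^'d"
  assumes y: "(y has_vector_derivative y') (at 0)" and h: "(h has_vector_derivative h') (at 0)"
  obtains S1 where
    "((\<lambda>t. Psi (y t) (h t)) has_vector_derivative
       cvec (cosh (norm (h 0)) *\<^sub>R y' + (sinhc (norm (h 0)) * (h 0 \<bullet> h')) *\<^sub>R y 0)
            (sinhc (norm (h 0)) *\<^sub>R h' + S1 *\<^sub>R h 0)) (at 0)"
    "h 0 \<noteq> 0 \<Longrightarrow> S1 = (cosh (norm (h 0)) / norm (h 0) - sinh (norm (h 0)) / (norm (h 0))\<^sup>2) * (h 0 \<bullet> h' / norm (h 0))"
proof -
  obtain S1 where S1: "((\<lambda>t. sinhc (norm (h t)) *\<^sub>R h t) has_vector_derivative sinhc (norm (h 0)) *\<^sub>R h' + S1 *\<^sub>R h 0) (at 0)"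
    "h 0 \<noteq> 0 \<Longrightarrow> S1 = (cosh (norm (h 0)) / norm (h 0) - sinh (norm (h 0)) / (norm (h 0))\<^sup>2) * (h 0 \<bullet> h' / norm (h 0))"
    using sinhc_norm_curve[OF h] by blast
  show ?thesis
    by (rule that[of S1])
       (use has_vector_derivative_cvec[OF has_vector_derivative_scaleR[OF cosh_norm_curve[OF h] y] S1(1)] S1(2)
        in \<open>auto simp: Psi_eq_cvec\<close>)
qed

lemma bil_velocity:
  assumes Z: "\<And>t. Z t \<in> quadric" and w: "(Z has_vector_derivative w) (at 0)"
  shows "bil (Z 0) w = 0"
proof -
  have "((\<lambda>t. bil (Z t) (Z t)) has_derivative (\<lambda>t. 2 * bil (Z 0) (t *\<^sub>R w))) (at 0)"
    by (rule has_derivative_compose[OF w[unfolded has_vector_derivative_def] has_derivative_bil_self])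
  then have "((\<lambda>t. 1) has_derivative (\<lambda>t. 2 * bil (Z 0) (t *\<^sub>R w))) (at (0::real))"
    using Z by (simp add: quadric_iff_bil)
  then have "(\<lambda>t::real. 2 * bil (Z 0) (t *\<^sub>R w)) = (\<lambda>_. 0)"
    using has_derivative_unique has_derivative_const by blast
  from fun_cong[OF this, of 1] show ?thesis by simp
qed

subsection \<open>The twisted conormal bundle\<close>

context sphere_immersion
begin

lemma quadric_curve:
  assumes "one_form q A x \<mu>" "(p, \<eta>) \<in> twisted_conormal q A x \<mu>"
  shows "Psi (x p) \<eta> \<in> quadric"
  using assms sph twisted_conormal_iff[OF assms(1)] by (intro Psi_in_quadric) auto

text \<open>The relation between \<open>h'\<close> and the base velocity is the derivative of
  \<open>x (g t) \<bullet> h t = 0\<close>. The curve is returned along with its velocities because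
  further identities have to be differentiated along it.\<close>

lemma tangent_vectorE:
  assumes \<mu>: "one_form q A x \<mu>" and UA: "(U, \<phi>) \<in> A" and pU: "p \<in> U"
    and w: "w \<in> tangent_vectors q A x (twisted_conormal q A x \<mu>) (p, \<eta>)"
  obtains g h c h' S1 where "isCont g 0" "g 0 = p" "h 0 = \<eta>"
    "\<And>t. (g t, h t) \<in> twisted_conormal q A x \<mu>"
    "\<And>i. i < q \<Longrightarrow> ((\<lambda>t. \<phi> (g t) i) has_real_derivative c i) (at 0)"
    "(h has_vector_derivative h') (at 0)"
    "w = cvec (cosh (norm \<eta>) *\<^sub>R (\<Sum>i<q. c i *\<^sub>R frame U \<phi> i p) + (sinhc (norm \<eta>) * (\<eta> \<bullet> h')) *\<^sub>R x p)
            (sinhc (norm \<eta>) *\<^sub>R h' + S1 *\<^sub>R \<eta>)"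
    "x p \<bullet> h' = - (\<eta> \<bullet> (\<Sum>i<q. c i *\<^sub>R frame U \<phi> i p))"
    "bil (Psi (x p) \<eta>) w = 0"
proof -
  let ?N = "twisted_conormal q A x \<mu>"
  obtain g h where dg: "differentiable_curve q A g" and dh: "h differentiable (at 0)"
    and N: "\<And>t. (g t, h t) \<in> ?N" and 0: "g 0 = p" "h 0 = \<eta>"
    and vd: "((\<lambda>t. Psi (x (g t)) (h t)) has_vector_derivative w) (at 0)"
    using w unfolding tangent_vectors_def by auto
  have g: "isCont g 0" using dg unfolding differentiable_curve_def by simp
  have "\<forall>i<q. \<exists>c. ((\<lambda>t. \<phi> (g t) i) has_real_derivative c) (at 0)"
    using dg UA pU 0 unfolding differentiable_curve_def real_differentiable_def by blast
  then obtain c where c: "\<And>i. i < q \<Longrightarrow> ((\<lambda>t. \<phi> (g t) i) has_real_derivative c i) (at 0)"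
    by metis
  define h' where "h' = vector_derivative h (at 0)"
  have h': "(h has_vector_derivative h') (at 0)" using dh by (simp add: h'_def vector_derivative_works)
  let ?y = "\<Sum>i<q. c i *\<^sub>R frame U \<phi> i p"
  have y: "((\<lambda>t. x (g t)) has_vector_derivative ?y) (at 0)"
    using x_along_curve[OF UA g, of c] c pU 0 by simp
  obtain S1 where "((\<lambda>t. Psi (x (g t)) (h t)) has_vector_derivative
       cvec (cosh (norm (h 0)) *\<^sub>R ?y + (sinhc (norm (h 0)) * (h 0 \<bullet> h')) *\<^sub>R x (g 0))
            (sinhc (norm (h 0)) *\<^sub>R h' + S1 *\<^sub>R h 0)) (at 0)"
    using Psi_curve[OF y h'] by blast
  from vector_derivative_unique_at[OF vd this]
  have weq: "w = cvec (cosh (norm \<eta>) *\<^sub>R ?y + (sinhc (norm \<eta>) * (\<eta> \<bullet> h')) *\<^sub>R x p)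
            (sinhc (norm \<eta>) *\<^sub>R h' + S1 *\<^sub>R \<eta>)" by (simp add: 0)
  have "((\<lambda>t. 0) has_vector_derivative x p \<bullet> h' + ?y \<bullet> \<eta>) (at (0::real))"
    using bounded_bilinear.has_vector_derivative[OF bounded_bilinear_inner y h'] N 0
    by (simp add: twisted_conormal_iff[OF \<mu>])
  then have "x p \<bullet> h' + ?y \<bullet> \<eta> = 0"
    using vector_derivative_unique_at has_vector_derivative_const by blast
  then have xh: "x p \<bullet> h' = - (\<eta> \<bullet> ?y)" by (simp add: inner_commute)
  have "bil (Psi (x p) \<eta>) w = 0"
    using bil_velocity[OF _ vd] quadric_curve[OF \<mu> N] 0 by simp
  then show ?thesis using that[OF g 0 N c h' weq xh] by blast
qed

text \<open>For conormal \<eta> this is the second fundamental form of the immersion paired with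
  \<eta>, in chart coordinates.\<close>

definition second_fundamental where
  "second_fundamental U \<phi> p \<eta> c d =
     (\<Sum>j<q. \<Sum>i<q. d j * c i * (\<eta> \<bullet> pderiv_at i (pderiv_at j (x \<circ> inv_into U \<phi>)) (\<phi> p)))"

lemma second_fundamental_commute:
  assumes UA: "(U, \<phi>) \<in> A" and pU: "p \<in> U"
  shows "second_fundamental U \<phi> p \<eta> c d = second_fundamental U \<phi> p \<eta> d c"
proof -
  have "pderiv_at i (pderiv_at j (x \<circ> inv_into U \<phi>)) (\<phi> p) = pderiv_at j (pderiv_at i (x \<circ> inv_into U \<phi>)) (\<phi> p)"
    if "i < q" "j < q" for i j
    using smooth_on_pderiv_commute[OF chart_image[OF UA] smooth_x[OF UA]] pU that by blast
  then show ?thesis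
    unfolding second_fundamental_def
    by (subst sum.swap) (intro sum.cong, auto simp: mult_ac)
qed

text \<open>The Weingarten relation: \<open>h t\<close> annihilates the frame at all times, and
  differentiating this moves the derivative from \<open>h\<close> to the frame.\<close>

lemma inner_conormal_velocity:
  assumes UA: "(U, \<phi>) \<in> A" and g: "isCont g 0" and pU: "g 0 \<in> U"
    and c: "\<And>i. i < q \<Longrightarrow> ((\<lambda>t. \<phi> (g t) i) has_real_derivative c i) (at 0)"
    and h: "(h has_vector_derivative h') (at 0)"
    and 0: "\<And>t v. v \<in> tangent_space q A x (g t) \<Longrightarrow> h t \<bullet> v = 0"
  shows "h' \<bullet> (\<Sum>j<q. d j *\<^sub>R frame U \<phi> j (g 0)) = - second_fundamental U \<phi> (g 0) (h 0) c d"
proof -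
  let ?D = "\<lambda>j. \<Sum>i<q. c i *\<^sub>R pderiv_at i (pderiv_at j (x \<circ> inv_into U \<phi>)) (\<phi> (g 0))"
  have e: "h' \<bullet> frame U \<phi> j (g 0) = - (h 0 \<bullet> ?D j)" if j: "j < q" for j
  proof -
    have "((\<lambda>t. frame U \<phi> j (g t)) has_vector_derivative ?D j) (at 0)"
      unfolding frame_def by (rule smooth_along_curve[OF UA smooth_on_pderiv[OF smooth_x[OF UA] j] g pU c])
    from bounded_bilinear.has_vector_derivative[OF bounded_bilinear_inner h this]
    have "((\<lambda>t. h t \<bullet> frame U \<phi> j (g t)) has_vector_derivative h 0 \<bullet> ?D j + h' \<bullet> frame U \<phi> j (g 0)) (at 0)" .
    moreover have "h t \<bullet> frame U \<phi> j (g t) = 0" if "g t \<in> U" for t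
      using j by (intro 0) (auto simp: tangent_space_eq[OF UA that] intro: span_base)
    then have "\<forall>\<^sub>F t in at 0. h t \<bullet> frame U \<phi> j (g t) = 0" "h 0 \<bullet> frame U \<phi> j (g 0) = 0"
      using eventually_chart[OF UA g pU] pU by (auto elim: eventually_mono)
    ultimately have "((\<lambda>t. 0) has_vector_derivative h 0 \<bullet> ?D j + h' \<bullet> frame U \<phi> j (g 0)) (at (0::real))"
      by (rule has_vector_derivative_transform_ev)
    then have "h 0 \<bullet> ?D j + h' \<bullet> frame U \<phi> j (g 0) = 0"
      using vector_derivative_unique_at has_vector_derivative_const by blast
    then show ?thesis by simp
  qed
  have "h' \<bullet> (\<Sum>j<q. d j *\<^sub>R frame U \<phi> j (g 0)) = (\<Sum>j<q. d j * (h' \<bullet> frame U \<phi> j (g 0)))"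
    by (simp add: inner_sum_right)
  also have "\<dots> = (\<Sum>j<q. - (d j * (h 0 \<bullet> ?D j)))" using e by (intro sum.cong) auto
  also have "\<dots> = - second_fundamental U \<phi> (g 0) (h 0) c d"
    by (simp add: second_fundamental_def inner_sum_right sum_distrib_left sum_negf mult.assoc)
  finally show ?thesis .
qed

text \<open>After the orthogonality relations, \<open>Im (herm u v)\<close> is a multiple of the
  difference of two values of the second fundamental form with exchanged arguments. The numbers
  \<open>herm u z\<close> and \<open>herm v z\<close> are real, so the second term of the form
  vanishes whatever \<open>g\<close> is.\<close>

lemma conormal_lagrangian:
  assumes \<mu>: "one_form q A x \<mu>" and 0: "\<forall>p. \<forall>v\<in>tangent_space q A x p. \<mu> p v = 0"
    and S: "stenzel_potential n c U" "n > 0"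
  shows "lagrangian q A x (stenzel_form U) (twisted_conormal q A x \<mu>)"
proof -
  let ?N = "twisted_conormal q A x \<mu>"
  have perp: "\<eta> \<bullet> v = 0" if "(p, \<eta>) \<in> ?N" "v \<in> tangent_space q A x p" for p \<eta> v
    using that 0 by (simp add: twisted_conormal_iff[OF \<mu>])
  obtain G :: "real \<Rightarrow> real" where form: "\<And>(z::complex^'d) u v. z \<in> quadric \<Longrightarrow> bil z u = 0 \<Longrightarrow> bil z v = 0 \<Longrightarrow>
       \<exists>g. stenzel_form U z u v =
          of_real (- 2 * (G ((norm z)\<^sup>2) * Im (herm u v) + g * Im (herm u z * cnj (herm v z))))"
    using stenzel_formE[OF S] by metis
  have "stenzel_form U (Psi (x p) \<eta>) u v = 0"
    if N: "(p, \<eta>) \<in> ?N" and u: "u \<in> tangent_vectors q A x ?N (p, \<eta>)"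
      and v: "v \<in> tangent_vectors q A x ?N (p, \<eta>)" for p \<eta> u v
  proof -
    obtain V \<phi> where VA: "(V, \<phi>) \<in> A" and pV: "p \<in> V" by (rule chartE)
    let ?y = "\<lambda>c. \<Sum>i<q. c i *\<^sub>R frame V \<phi> i p"
    have yT: "?y c \<in> tangent_space q A x p" for c
      unfolding tangent_space_eq[OF VA pV] by (rule sum_in_span)
    have \<eta>y: "\<eta> \<bullet> ?y c = 0" for c using perp[OF N yT] .
    have \<eta>x: "x p \<bullet> \<eta> = 0" using N by (simp add: twisted_conormal_iff[OF \<mu>])
    obtain g1 h1 c1 h1' S1 where 1: "isCont g1 0" "g1 0 = p" "h1 0 = \<eta>" "\<And>t. (g1 t, h1 t) \<in> ?N"
      "\<And>i. i < q \<Longrightarrow> ((\<lambda>t. \<phi> (g1 t) i) has_real_derivative c1 i) (at 0)"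
      "(h1 has_vector_derivative h1') (at 0)"
      "u = cvec (cosh (norm \<eta>) *\<^sub>R ?y c1 + (sinhc (norm \<eta>) * (\<eta> \<bullet> h1')) *\<^sub>R x p)
            (sinhc (norm \<eta>) *\<^sub>R h1' + S1 *\<^sub>R \<eta>)"
      "x p \<bullet> h1' = - (\<eta> \<bullet> ?y c1)" "bil (Psi (x p) \<eta>) u = 0"
      using tangent_vectorE[OF \<mu> VA pV u] by blast
    obtain g2 h2 c2 h2' S2 where 2: "isCont g2 0" "g2 0 = p" "h2 0 = \<eta>" "\<And>t. (g2 t, h2 t) \<in> ?N"
      "\<And>i. i < q \<Longrightarrow> ((\<lambda>t. \<phi> (g2 t) i) has_real_derivative c2 i) (at 0)"
      "(h2 has_vector_derivative h2') (at 0)"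
      "v = cvec (cosh (norm \<eta>) *\<^sub>R ?y c2 + (sinhc (norm \<eta>) * (\<eta> \<bullet> h2')) *\<^sub>R x p)
            (sinhc (norm \<eta>) *\<^sub>R h2' + S2 *\<^sub>R \<eta>)"
      "x p \<bullet> h2' = - (\<eta> \<bullet> ?y c2)" "bil (Psi (x p) \<eta>) v = 0"
      using tangent_vectorE[OF \<mu> VA pV v] by blast
    have "h1' \<bullet> ?y c2 = - second_fundamental V \<phi> p \<eta> c1 c2"
      using inner_conormal_velocity[OF VA 1(1), of c1 h1 h1' c2] 1(2-6) pV perp by blast
    moreover have "h2' \<bullet> ?y c1 = - second_fundamental V \<phi> p \<eta> c2 c1"
      using inner_conormal_velocity[OF VA 2(1), of c2 h2 h2' c1] 2(2-6) pV perp by blast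
    ultimately have sym: "h1' \<bullet> ?y c2 = ?y c1 \<bullet> h2'"
      using second_fundamental_commute[OF VA pV] by (simp add: inner_commute)
    have orth: "x p \<bullet> \<eta> = 0" "\<eta> \<bullet> x p = 0" "\<eta> \<bullet> ?y c = 0" "?y c \<bullet> \<eta> = 0"
      "x p \<bullet> h1' = 0" "h1' \<bullet> x p = 0" "x p \<bullet> h2' = 0" "h2' \<bullet> x p = 0" for c
      using \<eta>x \<eta>y 1(8) 2(8) by (simp_all add: inner_commute)
    have "Im (herm u v) = 0"
      unfolding 1(7) 2(7) herm_cvec by (simp add: inner_add_left inner_add_right orth sym)
    moreover have "Im (herm u (Psi (x p) \<eta>)) = 0" "Im (herm v (Psi (x p) \<eta>)) = 0"
      unfolding 1(7) 2(7) Psi_eq_cvec herm_cvec by (simp_all add: inner_add_left inner_add_right orth)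
    ultimately show ?thesis
      using form[OF quadric_curve[OF \<mu> N] 1(9) 2(9)] by auto
  qed
  then show ?thesis unfolding lagrangian_def by auto
qed

text \<open>Supplies vectors tangent to the bundle over an arbitrary base velocity. The base curve
  is a straight line in the chart; the covector follows it as \<eta>, corrected to stay cotangent to
  the sphere and to restrict to \<mu>. Differentiability of the second correction is the purpose of
  the moving-frame lemma.\<close>

lemma horizontal_curveE:
  assumes \<mu>: "one_form q A x \<mu>" and UA: "(U, \<phi>) \<in> A" and pU: "p \<in> U"
    and \<eta>: "(p, \<eta>) \<in> twisted_conormal q A x \<mu>"
  obtains g h where "differentiable_curve q A g" "h differentiable (at 0)" "g 0 = p" "h 0 = \<eta>"
    "\<And>t. (g t, h t) \<in> twisted_conormal q A x \<mu>"
    "((\<lambda>t. x (g t)) has_vector_derivative (\<Sum>i<q. c i *\<^sub>R frame U \<phi> i p)) (at 0)"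
proof -
  define a where "a t = (\<lambda>i. \<phi> p i + (if i < q then t * c i else 0))" for t
  \<comment> \<open>Curves must lie in the bundle for every real \<open>t\<close>, so the constant
    value \<open>p\<close> is used where the line has left the chart.\<close>
  define g where "g t = (if a t \<in> \<phi> ` U then inv_into U \<phi> (a t) else p)" for t
  have a0: "a 0 = \<phi> p" by (auto simp: a_def)
  have avan: "\<forall>i\<ge>q. a t i = 0" for t using chart_vanish[OF UA pU] by (simp add: a_def)
  have ad: "((\<lambda>t. a t i) has_real_derivative c i) (at 0)" if "i < q" for i
    using that by (auto simp: a_def intro!: derivative_eq_intros)
  have aW: "\<forall>\<^sub>F t in at 0. a t \<in> W" if WO: "openin (Euclidean_space q) W" and pW: "\<phi> p \<in> W" for W
  proof -
    obtain d where d: "d > 0" "qbox q (\<phi> p) d \<subseteq> W" using openin_contains_qbox[OF WO pW] by blast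
    have "((\<lambda>t. a t i) \<longlongrightarrow> \<phi> p i) (at 0)" if "i < q" for i
      using DERIV_isCont[OF ad[OF that]] a0 by (simp add: isCont_def)
    then have "\<forall>\<^sub>F t in at 0. a t \<in> qbox q (\<phi> p) d"
      using avan d(1) by (intro eventually_in_qbox) auto
    then show ?thesis by eventually_elim (use d(2) in auto)
  qed
  have g0: "g 0 = p" using pU by (simp add: g_def a0 inv_into_f_f[OF chart_inj[OF UA]])
  have ga: "g t \<in> V" "g t = inv_into U \<phi> (a t)" if "a t \<in> \<phi> ` (U \<inter> V)" for t V
    using that by (auto simp: g_def inv_into_f_f[OF chart_inj[OF UA]])
  have gc: "isCont g 0"
    unfolding isCont_def g0
  proof (rule topological_tendstoI)
    fix W :: "'m set" assume "open W" "p \<in> W"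
    then have "\<forall>\<^sub>F t in at 0. a t \<in> \<phi> ` (U \<inter> W)"
      using pU by (intro aW chart_image_Int[OF UA]) auto
    then show "\<forall>\<^sub>F t in at 0. g t \<in> W" by eventually_elim (rule ga(1))
  qed
  have gd: "differentiable_curve q A g"
    unfolding differentiable_curve_def
  proof (intro conjI gc, safe)
    \<comment> \<open>Differentiability is demanded in every chart around the point, hence the
      passage through the transition maps.\<close>
    fix V \<psi> k assume VA: "(V, \<psi>) \<in> A" and pV: "g 0 \<in> V" and k: "k < q"
    let ?f = "\<lambda>a. \<psi> (inv_into U \<phi> a) k"
    have W: "openin (Euclidean_space q) (\<phi> ` (U \<inter> V))" by (rule chart_image_Int[OF UA chart_open[OF VA]])
    have pW: "\<phi> p \<in> \<phi> ` (U \<inter> V)" using pU pV g0 by simp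
    have "((\<lambda>t. ?f (a t)) has_vector_derivative (\<Sum>i<q. c i *\<^sub>R pderiv_at i ?f (a 0))) (at 0)"
      using pW a0 avan by (intro smooth_on_chain_rule[OF W smooth_transition[OF UA VA k]] ad) auto
    moreover have "\<forall>\<^sub>F t in at 0. ?f (a t) = \<psi> (g t) k"
      using aW[OF W pW] by eventually_elim (simp add: ga(2))
    moreover have "?f (a 0) = \<psi> (g 0) k" using ga(2)[of 0 V] pW a0 by simp
    ultimately have "((\<lambda>t. \<psi> (g t) k) has_vector_derivative (\<Sum>i<q. c i *\<^sub>R pderiv_at i ?f (a 0))) (at 0)"
      by (rule has_vector_derivative_transform_ev)
    then show "(\<lambda>t. \<psi> (g t) k) differentiable (at 0)" by (rule differentiableI_vector)
  qed
  have gU: "\<forall>\<^sub>F t in at 0. g t \<in> U" using eventually_chart[OF UA gc] pU g0 by simp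
  have \<phi>g: "((\<lambda>t. \<phi> (g t) i) has_real_derivative c i) (at 0)" if "i < q" for i
    unfolding has_real_derivative_iff_has_vector_derivative
  proof (rule has_vector_derivative_transform_ev)
    show "((\<lambda>t. a t i) has_vector_derivative c i) (at 0)"
      using ad[OF that] by (simp add: has_real_derivative_iff_has_vector_derivative)
    have "\<forall>\<^sub>F t in at 0. a t \<in> \<phi> ` U" using pU by (intro aW chart_image[OF UA]) auto
    then show "\<forall>\<^sub>F t in at 0. a t i = \<phi> (g t) i"
      by eventually_elim (simp add: g_def f_inv_into_f)
    show "a 0 i = \<phi> (g 0) i" by (simp add: g0 a0)
  qed
  have x': "((\<lambda>t. x (g t)) has_vector_derivative (\<Sum>i<q. c i *\<^sub>R frame U \<phi> i p)) (at 0)"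
    using x_along_curve[OF UA gc, of c] \<phi>g pU g0 by simp
  \<comment> \<open>The amount by which the constant covector \<eta> fails to restrict to \<mu> on
    the tangent space at time \<open>t\<close>; it is zero at t = 0.\<close>
  define l where "l t v = \<mu> (g t) v - \<eta> \<bullet> v" for t v
  let ?T = "\<lambda>t. tangent_space q A x (g t)"
  define m where "m t = covector_of (?T t) (l t)" for t
  have lin: "l t (r *\<^sub>R u + s *\<^sub>R v) = r * l t u + s * l t v" if "u \<in> ?T t" "v \<in> ?T t" for t u v r s
  proof -
    have "\<mu> (g t) (r *\<^sub>R u + s *\<^sub>R v) = r * \<mu> (g t) u + s * \<mu> (g t) v"
      using \<mu> that unfolding one_form_def by blast
    then show ?thesis by (simp add: l_def inner_add_right algebra_simps)
  qed
  have mT: "m t \<in> ?T t" and mv: "\<And>v. v \<in> ?T t \<Longrightarrow> m t \<bullet> v = l t v" for t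
    unfolding m_def by (rule covector_of_tangent_space; use lin in blast)+
  let ?X = "x \<circ> inv_into U \<phi>"
  have fd: "(\<lambda>t. frame U \<phi> i (g t)) differentiable (at 0)" if "i < q" for i
    unfolding frame_def
    by (rule differentiableI_vector)
       (rule smooth_along_curve[OF UA smooth_on_pderiv[OF smooth_x[OF UA] that] gc _ \<phi>g], use pU g0 in simp)
  have \<mu>d: "(\<lambda>t. \<mu> (g t) (frame U \<phi> i (g t))) differentiable (at 0)" if i: "i < q" for i
  proof -
    let ?f = "\<lambda>a. \<mu> (inv_into U \<phi> a) (pderiv_at i ?X a)"
    have "smooth_on q (\<phi> ` U) ?f" using \<mu> UA i unfolding one_form_def by blast
    then have "((\<lambda>t. ?f (\<phi> (g t))) has_vector_derivative (\<Sum>k<q. c k *\<^sub>R pderiv_at k ?f (\<phi> (g 0)))) (at 0)"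
      by (rule smooth_along_curve[OF UA _ gc _ \<phi>g]) (use pU g0 in simp)
    moreover have "\<forall>\<^sub>F t in at 0. ?f (\<phi> (g t)) = \<mu> (g t) (frame U \<phi> i (g t))"
      using gU by eventually_elim (simp add: frame_def inv_into_f_f[OF chart_inj[OF UA]])
    moreover have "?f (\<phi> (g 0)) = \<mu> (g 0) (frame U \<phi> i (g 0))"
      using pU g0 by (simp add: frame_def inv_into_f_f[OF chart_inj[OF UA]])
    ultimately show ?thesis
      by (intro differentiableI_vector) (rule has_vector_derivative_transform_ev)
  qed
  have span_T: "m t \<in> span ((\<lambda>i. frame U \<phi> i (g t)) ` {..<q}) \<and> (\<forall>i<q. m t \<bullet> frame U \<phi> i (g t) = l t (frame U \<phi> i (g t)))"
    if "g t \<in> U" for t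
    using mT[of t] mv[of _ t] unfolding tangent_space_eq[OF UA that] by (auto intro: span_base)
  have md: "m differentiable (at 0)"
  proof (rule differentiable_moving_frame[where e="\<lambda>i t. frame U \<phi> i (g t)" and b="\<lambda>i t. l t (frame U \<phi> i (g t))"])
    show "(\<lambda>t. l t (frame U \<phi> i (g t))) differentiable (at 0)" if "i < q" for i
      unfolding l_def using \<mu>d[OF that] fd[OF that]
      by (intro differentiable_diff differentiable_inner differentiable_const)
    show "\<forall>c. (\<Sum>i<q. c i *\<^sub>R frame U \<phi> i (g 0)) = 0 \<longrightarrow> (\<forall>i<q. c i = 0)"
      using frame_independent[OF UA pU] g0 by simp
    show "\<forall>\<^sub>F t in at 0. m t \<in> span ((\<lambda>i. frame U \<phi> i (g t)) ` {..<q}) \<and>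
        (\<forall>i<q. m t \<bullet> frame U \<phi> i (g t) = l t (frame U \<phi> i (g t)))"
      using gU by eventually_elim (rule span_T)
  qed (use fd span_T[of 0] g0 pU in auto)
  \<comment> \<open>Removing the component along \<open>x\<close> makes the covector cotangent to
    the sphere without changing its values on tangent vectors. Both corrections vanish at t =
    0.\<close>
  define h where "h t = \<eta> - (\<eta> \<bullet> x (g t)) *\<^sub>R x (g t) + m t" for t
  have xd: "(\<lambda>t. x (g t)) differentiable (at 0)" using x' by (rule differentiableI_vector)
  have hd: "h differentiable (at 0)"
    unfolding h_def using xd md
    by (intro differentiable_add differentiable_diff differentiable_scaleR differentiable_inner differentiable_const)
  have \<eta>p: "x p \<bullet> \<eta> = 0" "\<And>v. v \<in> tangent_space q A x p \<Longrightarrow> \<eta> \<bullet> v = \<mu> p v"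
    using \<eta> by (auto simp: twisted_conormal_iff[OF \<mu>])
  have "m 0 \<bullet> m 0 = 0" using mv[OF mT, of 0] mT[of 0] \<eta>p(2) by (simp add: l_def g0)
  then have h0: "h 0 = \<eta>" using \<eta>p(1) by (simp add: h_def g0 inner_commute)
  have hN: "(g t, h t) \<in> twisted_conormal q A x \<mu>" for t
  proof -
    have "x (g t) \<bullet> h t = 0"
      using tangent_orthogonal_x[OF mT, of t] inner_x_self[of "g t"]
      by (simp add: h_def inner_add_right inner_diff_right inner_commute)
    moreover have "h t \<bullet> v = \<mu> (g t) v" if "v \<in> ?T t" for v
      using tangent_orthogonal_x[OF that] mv[OF that] by (simp add: h_def inner_add_left inner_diff_left l_def)
    ultimately show ?thesis by (simp add: twisted_conormal_iff[OF \<mu>])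
  qed
  show ?thesis by (rule that[OF gd hd g0 h0 hN x'])
qed

lemma tangent_vectorI:
  assumes "differentiable_curve q A g" "h differentiable (at 0)"
    "\<And>t. (g t, h t) \<in> N" "g 0 = p" "h 0 = \<eta>"
    "((\<lambda>t. Psi (x (g t)) (h t)) has_vector_derivative w) (at 0)"
  shows "w \<in> tangent_vectors q A x N (p, \<eta>)"
  using assms unfolding tangent_vectors_def by blast

text \<open>A dimension count: \<open>x p\<close> and the frame span at most q + 1 \<le> n of the n
  + 1 dimensions.\<close>

lemma conormal_vectorE:
  assumes "CARD('d) = n + 1" "q < n"
  obtains \<xi> where "\<xi> \<noteq> 0" "x p \<bullet> \<xi> = 0" "\<And>v. v \<in> tangent_space q A x p \<Longrightarrow> \<xi> \<bullet> v = 0"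
proof -
  obtain V \<phi> where VA: "(V, \<phi>) \<in> A" and pV: "p \<in> V" by (rule chartE)
  let ?F = "(\<lambda>i. frame V \<phi> i p) ` {..<q}"
  have "dim (insert (x p) ?F) \<le> card (insert (x p) ?F)" by (rule dim_le_card') simp
  also have "\<dots> \<le> Suc (card ?F)" by (rule card_insert_le_m1) auto
  also have "\<dots> \<le> Suc q" using card_image_le[of "{..<q}" "\<lambda>i. frame V \<phi> i p"] by simp
  also have "\<dots> < DIM(real^'d)" using assms by simp
  finally obtain \<xi> where \<xi>: "\<xi> \<noteq> 0" "\<And>y. y \<in> span (insert (x p) ?F) \<Longrightarrow> orthogonal \<xi> y"
    using orthogonal_to_subspace_exists by blast
  have "x p \<bullet> \<xi> = 0" using \<xi>(2)[of "x p"] by (simp add: orthogonal_def span_base inner_commute)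
  moreover have "\<xi> \<bullet> v = 0" if "v \<in> tangent_space q A x p" for v
    using \<xi>(2)[of v] that span_mono[of ?F "insert (x p) ?F"]
    unfolding tangent_space_eq[OF VA pV] by (auto simp: orthogonal_def)
  ultimately show ?thesis using that \<xi>(1) by blast
qed

text \<open>\<open>u\<close> is the velocity of the line \<eta> + t \<xi> in the fibre,
  \<open>w\<close> that of a horizontal curve over \<open>v\<close>. The covector velocity
  \<open>k'\<close> of the latter survives only in \<open>x p \<bullet> k' = - \<mu> p v\<close>, so
  no derivative of \<mu> appears and both results are multiples of \<open>\<mu> p v\<close>.\<close>

lemma mixed_vectorsE:
  assumes \<mu>: "one_form q A x \<mu>" and N: "(p, \<eta>) \<in> twisted_conormal q A x \<mu>" and \<eta>0: "\<eta> \<noteq> 0"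
    and \<xi>: "x p \<bullet> \<xi> = 0" "\<And>v. v \<in> tangent_space q A x p \<Longrightarrow> \<xi> \<bullet> v = 0"
    and v: "v \<in> tangent_space q A x p"
    and S: "S = sinh (norm \<eta>) / norm \<eta>" and C: "C = cosh (norm \<eta>)"
    and S1: "S1 = (cosh (norm \<eta>) / norm \<eta> - sinh (norm \<eta>) / (norm \<eta>)\<^sup>2) * (\<eta> \<bullet> \<xi> / norm \<eta>)"
  obtains u w where "u \<in> tangent_vectors q A x (twisted_conormal q A x \<mu>) (p, \<eta>)"
    "w \<in> tangent_vectors q A x (twisted_conormal q A x \<mu>) (p, \<eta>)"
    "bil (Psi (x p) \<eta>) u = 0" "bil (Psi (x p) \<eta>) w = 0"
    "Im (herm u w) = (S1 * C + S * (\<eta> \<bullet> \<xi>) * S) * \<mu> p v"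
    "Im (herm u (Psi (x p) \<eta>) * cnj (herm w (Psi (x p) \<eta>))) =
       (S * (\<eta> \<bullet> \<xi>) * C + S * S * (\<eta> \<bullet> \<xi>) + S1 * S * (norm \<eta>)\<^sup>2) * (2 * S * C) * \<mu> p v"
proof -
  let ?N = "twisted_conormal q A x \<mu>" and ?z = "Psi (x p) \<eta>"
  obtain V \<phi> where VA: "(V, \<phi>) \<in> A" and pV: "p \<in> V" by (rule chartE)
  obtain c where c: "v = (\<Sum>i<q. c i *\<^sub>R frame V \<phi> i p)"
    using v span_image_sumE unfolding tangent_space_eq[OF VA pV] by blast
  have Sc: "sinhc (norm \<eta>) = S" using \<eta>0 by (simp add: sinhc_def S)
  have \<eta>x: "x p \<bullet> \<eta> = 0" and \<eta>v: "\<And>v. v \<in> tangent_space q A x p \<Longrightarrow> \<eta> \<bullet> v = \<mu> p v"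
    using N by (auto simp: twisted_conormal_iff[OF \<mu>])
  have M: "\<eta> \<bullet> v = \<mu> p v" by (rule \<eta>v[OF v])

  define h where "h t = \<eta> + t *\<^sub>R \<xi>" for t :: real
  have h': "(h has_vector_derivative \<xi>) (at 0)" unfolding h_def by (auto intro!: derivative_eq_intros)
  have hN: "(p, h t) \<in> ?N" for t
    using \<eta>x \<xi> \<eta>v by (auto simp: twisted_conormal_iff[OF \<mu>] h_def inner_add_left inner_add_right)
  have h0: "h 0 = \<eta>" by (simp add: h_def)
  define u where "u = cvec ((S * (\<eta> \<bullet> \<xi>)) *\<^sub>R x p) (S *\<^sub>R \<xi> + S1 *\<^sub>R \<eta>)"
  have u': "((\<lambda>t. Psi (x p) (h t)) has_vector_derivative u) (at 0)"
  proof -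
    obtain S1' where 1: "((\<lambda>t. Psi (x p) (h t)) has_vector_derivative
       cvec (cosh (norm (h 0)) *\<^sub>R 0 + (sinhc (norm (h 0)) * (h 0 \<bullet> \<xi>)) *\<^sub>R x p)
            (sinhc (norm (h 0)) *\<^sub>R \<xi> + S1' *\<^sub>R h 0)) (at 0)"
      and 2: "h 0 \<noteq> 0 \<Longrightarrow> S1' = (cosh (norm (h 0)) / norm (h 0) - sinh (norm (h 0)) / (norm (h 0))\<^sup>2) * (h 0 \<bullet> \<xi> / norm (h 0))"
      using Psi_curve[OF has_vector_derivative_const h', of "x p"] by blast
    have "S1' = S1" using 2 \<eta>0 by (simp add: h0 S1)
    then show ?thesis using 1 by (simp add: u_def h0 Sc)
  qed
  have uT: "u \<in> tangent_vectors q A x ?N (p, \<eta>)"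
  proof (rule tangent_vectorI[where g="\<lambda>_. p" and h=h])
    show "differentiable_curve q A (\<lambda>_. p)" by (auto simp: differentiable_curve_def)
    show "h differentiable (at 0)" using h' by (rule differentiableI_vector)
  qed (use hN h0 u' in auto)
  have ub: "bil ?z u = 0"
    using bil_velocity[OF _ u'] quadric_curve[OF \<mu> hN] h0 by simp

  obtain g k where gd: "differentiable_curve q A g" and kd: "k differentiable (at 0)"
    and g0: "g 0 = p" and k0: "k 0 = \<eta>" and kN: "\<And>t. (g t, k t) \<in> ?N"
    and y': "((\<lambda>t. x (g t)) has_vector_derivative v) (at 0)"
    unfolding c using horizontal_curveE[OF \<mu> VA pV N, of c] by blast
  define k' where "k' = vector_derivative k (at 0)"
  have k': "(k has_vector_derivative k') (at 0)" using kd by (simp add: k'_def vector_derivative_works)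
  obtain S2 where w': "((\<lambda>t. Psi (x (g t)) (k t)) has_vector_derivative
       cvec (cosh (norm (k 0)) *\<^sub>R v + (sinhc (norm (k 0)) * (k 0 \<bullet> k')) *\<^sub>R x (g 0))
            (sinhc (norm (k 0)) *\<^sub>R k' + S2 *\<^sub>R k 0)) (at 0)"
    using Psi_curve[OF y' k'] by blast
  define w where "w = cvec (C *\<^sub>R v + (S * (\<eta> \<bullet> k')) *\<^sub>R x p) (S *\<^sub>R k' + S2 *\<^sub>R \<eta>)"
  have w': "((\<lambda>t. Psi (x (g t)) (k t)) has_vector_derivative w) (at 0)"
    using w' by (simp add: w_def g0 k0 Sc C)
  have wT: "w \<in> tangent_vectors q A x ?N (p, \<eta>)"
    by (rule tangent_vectorI[OF gd kd kN g0 k0 w'])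
  have wb: "bil ?z w = 0"
    using bil_velocity[OF _ w'] quadric_curve[OF \<mu> kN] g0 k0 by simp
  have "((\<lambda>t. 0) has_vector_derivative x p \<bullet> k' + v \<bullet> \<eta>) (at (0::real))"
    using bounded_bilinear.has_vector_derivative[OF bounded_bilinear_inner y' k'] kN g0 k0
    by (simp add: twisted_conormal_iff[OF \<mu>])
  then have "x p \<bullet> k' + v \<bullet> \<eta> = 0"
    using vector_derivative_unique_at has_vector_derivative_const by blast
  then have xk: "x p \<bullet> k' = - \<mu> p v" using M by (simp add: inner_commute)

  have xv: "x p \<bullet> v = 0" by (rule tangent_orthogonal_x[OF v])
  have orth: "\<eta> \<bullet> v = \<mu> p v" "v \<bullet> \<eta> = \<mu> p v" "x p \<bullet> \<eta> = 0" "\<eta> \<bullet> x p = 0" "\<xi> \<bullet> v = 0" "\<xi> \<bullet> x p = 0"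
     "x p \<bullet> \<xi> = 0" "x p \<bullet> k' = - \<mu> p v" "k' \<bullet> x p = - \<mu> p v" "x p \<bullet> x p = 1" "v \<bullet> x p = 0" "x p \<bullet> v = 0"
     "\<xi> \<bullet> \<eta> = \<eta> \<bullet> \<xi>"
    using M \<eta>x \<xi>(1) \<xi>(2)[OF v] xk xv inner_x_self by (simp_all add: inner_commute)
  have \<eta>\<eta>: "\<eta> \<bullet> \<eta> = (norm \<eta>)\<^sup>2" by (simp add: power2_norm_eq_inner)
  have "Im (herm u w) = (S1 * C + S * (\<eta> \<bullet> \<xi>) * S) * \<mu> p v"
    unfolding u_def w_def herm_cvec
    by (simp add: inner_add_left inner_add_right orth) (simp add: algebra_simps)
  moreover have "herm u ?z = Complex (S * (\<eta> \<bullet> \<xi>) * C + S * S * (\<eta> \<bullet> \<xi>) + S1 * S * (norm \<eta>)\<^sup>2) 0"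
    unfolding u_def Psi_eq_cvec Sc C[symmetric] herm_cvec
    by (simp add: inner_add_left inner_add_right orth \<eta>\<eta>) (simp add: algebra_simps)
  moreover have "Im (herm w ?z) = - (2 * S * C * \<mu> p v)"
    unfolding w_def Psi_eq_cvec Sc C[symmetric] herm_cvec
    by (simp add: inner_add_left inner_add_right orth)
  ultimately show ?thesis using that[OF uT wT ub wb] by simp
qed

text \<open>In the fibre over \<open>p\<close> the covectors m + s \<xi> have squared norm |m|^2 +
  s^2 |\<xi>|^2, so each radius r > |m| is reached with s > 0, where moving along \<xi> changes the
  radius at a nonzero rate. Dividing the Lagrangian condition by \<open>\<mu> p v\<close> then
  leaves a linear relation between \<open>G\<close> and \<open>g\<close> at w = 2 r.\<close>

lemma lagrangian_imp_zero:
  assumes card: "CARD('d) = n + 1" and qn: "q < n" and \<mu>: "one_form q A x \<mu>"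
    and S: "stenzel_potential n c U"
    and L: "lagrangian q A x (stenzel_form U) (twisted_conormal q A x \<mu>)"
    and v: "v \<in> tangent_space q A x p"
  shows "\<mu> p v = 0"
proof (rule ccontr)
  assume nz: "\<mu> p v \<noteq> 0"
  let ?T = "tangent_space q A x p" and ?N = "twisted_conormal q A x \<mu>"
  obtain V \<phi> where VA: "(V, \<phi>) \<in> A" and pV: "p \<in> V" by (rule chartE)
  have lin: "\<mu> p (r *\<^sub>R u + s *\<^sub>R v) = r * \<mu> p u + s * \<mu> p v" if "u \<in> ?T" "v \<in> ?T" for u v r s
    using \<mu> that unfolding one_form_def by blast
  have "q \<noteq> 0"
  proof
    assume "q = 0"
    then have "v = 0" using v unfolding tangent_space_eq[OF VA pV] by simp
    then show False using lin[OF v v, of 0 0] nz by simp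
  qed
  then have n2: "n \<ge> 2" and n0: "n > 0" using qn by auto
  obtain \<xi> where \<xi>0: "\<xi> \<noteq> 0" and \<xi>: "x p \<bullet> \<xi> = 0" "\<And>v. v \<in> ?T \<Longrightarrow> \<xi> \<bullet> v = 0"
    using conormal_vectorE[OF card qn, of p] by blast
  define m where "m = covector_of ?T (\<mu> p)"
  have mT: "m \<in> ?T" and mv: "\<And>v. v \<in> ?T \<Longrightarrow> m \<bullet> v = \<mu> p v"
    unfolding m_def by (rule covector_of_tangent_space; use lin in blast)+
  show False
  proof (rule stenzel_formE[OF S n0, where 'd='d])
    fix U' U'' G :: "real \<Rightarrow> real"
    assume c: "c > 0" and d: "\<And>w. w > 0 \<Longrightarrow> (U' has_real_derivative U'' w) (at w)"
      and P: "\<And>w. w > 0 \<Longrightarrow> ((\<lambda>s. U' s ^ n) has_real_derivative c * real n * sinh w ^ (n - 1)) (at w)"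
      and Gc: "\<And>w. w > 0 \<Longrightarrow> G (cosh w) = U' w / sinh w"
      and form: "\<And>(z::complex^'d) u v. z \<in> quadric \<Longrightarrow> bil z u = 0 \<Longrightarrow> bil z v = 0 \<Longrightarrow>
       \<exists>g. stenzel_form U z u v =
          of_real (- 2 * (G ((norm z)\<^sup>2) * Im (herm u v) + g * Im (herm u z * cnj (herm v z)))) \<and>
        (\<forall>w>0. (norm z)\<^sup>2 = cosh w \<longrightarrow> g = (U'' w * sinh w - U' w * cosh w) / sinh w ^ 3)"
    have eq: "U'' w = U' w / w" if w: "w > 2 * norm m" for w
    proof -
      define r where "r = w / 2"
      have r: "r > norm m" "r > 0" using w norm_ge_zero[of m] by (auto simp: r_def simp del: norm_ge_zero)
      \<comment> \<open>Solves |m + s \<xi>| = r, using that \<open>m\<close> and \<xi> are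
        orthogonal.\<close>
      define s where "s = sqrt (r\<^sup>2 - (norm m)\<^sup>2) / norm \<xi>"
      have "r\<^sup>2 > (norm m)\<^sup>2" using r by (intro power_strict_mono) auto
      then have s: "s > 0" "s\<^sup>2 * (norm \<xi>)\<^sup>2 = r\<^sup>2 - (norm m)\<^sup>2"
        using \<xi>0 by (auto simp: s_def power_divide)
      define \<eta> where "\<eta> = m + s *\<^sub>R \<xi>"
      have \<xi>m: "\<xi> \<bullet> m = 0" "m \<bullet> \<xi> = 0" using \<xi>(2)[OF mT] by (simp_all add: inner_commute)
      have "(norm \<eta>)\<^sup>2 = (norm m)\<^sup>2 + s\<^sup>2 * (norm \<xi>)\<^sup>2"
        unfolding power2_norm_eq_inner
        by (simp add: \<eta>_def inner_add_left inner_add_right \<xi>m power2_eq_square)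
      then have "(norm \<eta>)\<^sup>2 = r\<^sup>2" using s(2) by simp
      then have \<eta>r: "norm \<eta> = r" using r(2) by (simp add: power2_eq_iff_nonneg)
      have E: "\<eta> \<bullet> \<xi> \<noteq> 0" using \<xi>m s(1) \<xi>0 by (simp add: \<eta>_def inner_add_left)
      have N: "(p, \<eta>) \<in> ?N"
        using \<xi> mv tangent_orthogonal_x[OF mT]
        by (simp add: twisted_conormal_iff[OF \<mu>] \<eta>_def inner_add_left inner_add_right)
      have \<eta>0: "\<eta> \<noteq> 0" using \<eta>r r(2) by auto
      let ?z = "Psi (x p) \<eta>"
      define S where "S = sinh (norm \<eta>) / norm \<eta>"
      define C where "C = cosh (norm \<eta>)"
      define S1 where "S1 = (cosh (norm \<eta>) / norm \<eta> - sinh (norm \<eta>) / (norm \<eta>)\<^sup>2) * (\<eta> \<bullet> \<xi> / norm \<eta>)"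
      let ?a = "S1 * C + S * (\<eta> \<bullet> \<xi>) * S"
      let ?b = "(S * (\<eta> \<bullet> \<xi>) * C + S * S * (\<eta> \<bullet> \<xi>) + S1 * S * (norm \<eta>)\<^sup>2) * (2 * S * C)"
      obtain u u2 where u: "u \<in> tangent_vectors q A x ?N (p, \<eta>)" "u2 \<in> tangent_vectors q A x ?N (p, \<eta>)"
        "bil ?z u = 0" "bil ?z u2 = 0"
        "Im (herm u u2) = ?a * \<mu> p v" "Im (herm u ?z * cnj (herm u2 ?z)) = ?b * \<mu> p v"
        using mixed_vectorsE[OF \<mu> N \<eta>0 \<xi> v S_def C_def S1_def] by metis
      \<comment> \<open>From |z|^2 = cosh^2 r + sinh^2 r: the profile is evaluated at twice the
        length of the covector.\<close>
      have nz2: "(norm ?z)\<^sup>2 = cosh (2 * r)"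
      proof -
        have "\<eta> \<bullet> \<eta> = (norm \<eta>)\<^sup>2" by (simp add: power2_norm_eq_inner)
        then have "(norm ?z)\<^sup>2 = (cosh r)\<^sup>2 + (sinhc r)\<^sup>2 * (norm \<eta>)\<^sup>2"
          unfolding Psi_eq_cvec norm_cvec \<eta>r by (simp add: inner_x_self power2_eq_square)
        then show ?thesis using r(2) by (simp add: \<eta>r sinhc_def power_divide cosh_double)
      qed
      obtain g where g: "stenzel_form U ?z u u2 =
          of_real (- 2 * (G ((norm ?z)\<^sup>2) * Im (herm u u2) + g * Im (herm u ?z * cnj (herm u2 ?z))))"
        and g2: "\<forall>w>0. (norm ?z)\<^sup>2 = cosh w \<longrightarrow> g = (U'' w * sinh w - U' w * cosh w) / sinh w ^ 3"
        using form[OF quadric_curve[OF \<mu> N] u(3,4)] by blast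
      have "stenzel_form U ?z u u2 = 0" using L N u(1,2) unfolding lagrangian_def by blast
      then have "G (cosh (2 * r)) * (?a * \<mu> p v) + g * (?b * \<mu> p v) = 0"
        unfolding g u(5,6) nz2 of_real_eq_0_iff
        by (metis mult_eq_0_iff neg_equal_0_iff_equal zero_neq_numeral)
      then have "(G (cosh (2 * r)) * ?a + g * ?b) * \<mu> p v = 0"
        by (simp only: distrib_right mult.assoc)
      then have "G (cosh (2 * r)) * ?a + g * ?b = 0" using nz by simp
      then have z: "G (cosh (2 * r)) * (S1 * C + S * (\<eta> \<bullet> \<xi>) * S) +
          g * (S * (\<eta> \<bullet> \<xi>) * C + S * S * (\<eta> \<bullet> \<xi>) + S1 * S * r\<^sup>2) * (2 * S * C) = 0"
        unfolding \<eta>r by (simp only: mult.assoc)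
      have "U'' (2 * r) = U' (2 * r) / (2 * r)"
        by (rule stationary_profile_algebra[OF r(2) E S_def[unfolded \<eta>r] C_def[unfolded \<eta>r]
              S1_def[unfolded \<eta>r] Gc _ z]) (use r(2) g2 nz2 in auto)
      then show ?thesis by (simp add: r_def)
    qed
    \<comment> \<open>The relation holds on a whole ray, from \<open>2 * norm m\<close> on, and can
      therefore be differentiated.\<close>
    show False
      by (rule stenzel_profile_not_linear[OF n2 c _ d P eq]) auto
  qed
qed

end

theorem theorem4p1:
  fixes n q :: nat
    and A :: "'m::{t2_space, second_countable_topology} chart set"
    and x :: "'m \<Rightarrow> real^'d"
    and \<mu> :: "'m \<Rightarrow> real^'d \<Rightarrow> real"
    and c :: real and U :: "real \<Rightarrow> real"
  assumes "CARD('d) = n + 1"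
    and "q < n"
    and "oriented_atlas q A"
    and "immersion q A x"
    and "\<forall>p. x p \<in> sphere 0 1"
    and "one_form q A x \<mu>"
    and "stenzel_potential n c U"
  shows "lagrangian q A x (stenzel_form U) (twisted_conormal q A x \<mu>) \<longleftrightarrow>
         (\<forall>p. \<forall>v\<in>tangent_space q A x p. \<mu> p v = 0)"
proof -
  interpret sphere_immersion q A x
    using assms(3-5) by unfold_locales
  show ?thesis
    using lagrangian_imp_zero[OF assms(1,2,6,7)] conormal_lagrangian[OF assms(6) _ assms(7)] assms(2)
    by fastforce
qed

end
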